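(* Let $A$, $N$, $R_s$, $A_{|\Omega_s}$, $D_s$ ($s=1,\dots,N$) come from the discretized and decomposed linear elasticity problem described in the context, and let $M_s:=D_s^{-1}A_{|\Omega_s}D_s^{-1}$. Let the Additive Schwarz preconditioner be defined by the choice $\tilde A_s=R_sAR_s^\top$ for every $s\in\{1,\dots,N\}$, i.e. $$H:=\sum_{s=1}^NR_s^\top(R_sAR_s^\top)^{-1}R_s.$$ Given any threshold $\tau>1$, let the coarse space be defined - either as $V_0:=\sum_{s=1}^NR_s^\top\mathcal Y_L(\tau^{-1},M_s,R_sAR_s^\top)$, - or as $V_0:=\sum_{s=1}^NR_s^\top\operatorname{Ker}(M_s)+\sum_{s=1}^NR_s^\top W_s\,\mathcal Y_H(\tau,W_s^\top R_sAR_s^\top W_s,W_s^\top M_sW_s)$, where the columns of $W_s$ form an $\ell_2$-orthonormal basis of $\operatorname{range}(M_s)$. Let $R_0\in\mathbb R^{\dim(V_0)\times n}$ be a matrix whose rows form a basis of $V_0$, and let $P_0$, $H_{hyb}$, $H_{ad}$ be as in the context. Then, with $\lambda(B)$ denoting an arbitrary eigenvalue of $B$ and $N^c$ a coloring constant, $$\lambda(HA)\le N^c,$$ $$1/\tau\le\lambda(HAP_0)\le N^c\quad\text{if }\lambda(HAP_0)\ne0,$$ $$1/\tau\le\lambda(H_{hyb}A)\le N^c,$$ $$1/((1+2N^c)\tau)\le\lambda(H_{ad}A)\le N^c+1.$$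
   Context: Problem. $\Omega=[0,2]\times[0,1]$, $\partial\Omega_D$ is the left-hand side boundary of $\Omega$, $\mathcal V=\{v\in H^1(\Omega)^2: v=0\text{ on }\partial\Omega_D\}$. The bilinear form is $a_\omega(u,v)=\int_\omega[2\mu\,\varepsilon(u):\varepsilon(v)+L\operatorname{div}(u)\operatorname{div}(v)]\,dx$, with $\varepsilon_{ij}(u)=\frac12(\partial u_i/\partial x_j+\partial u_j/\partial x_i)$, $\mu=\frac{E}{2(1+\nu)}$, $L=\frac{E\nu}{(1+\nu)(1-2\nu)}$, $\nu=0.4$. $\mathcal V_h\subset\mathcal V$ is the space of continuous piecewise linear ($\mathbb P_1$) Lagrange finite elements on a uniform mesh of $\Omega$ with element size $h=1/42$ satisfying the Dirichlet condition, with (nodal) basis $\{\phi_k\}_{k=1}^n$, and $A\in\mathbb R^{n\times n}$ is the spd matrix $A_{ij}=a_\Omega(\phi_i,\phi_j)$. Decomposition. $\Omega$ is partitioned into $N=8$ non-overlapping, mesh-conforming subdomains $\Omega_s$ (computed by the graph partitioner Metis). Young's modulus $E$ is either $10^5$ in $\Omega_s$ for odd $s$ and $10^8$ for even $s$, or that distribution augmented by $10^9$ where $y\in[1/7,2/7]\cup[3/7,4/7]\cup[5/7,6/7]$. For each $s$, $\{S_s^1,\dots,S_s^{n_s}\}\subset\{1,\dots,n\}$ is the set of degrees of freedom (at the mesh nodes) in $\Omega_s$, including those on its interfaces; $R_s\in\mathbb R^{n_s\times n}$ is the Boolean matrix with $(R_s)_{ij}=1$ if $j=S_s^i$ and $0$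 otherwise. The local Neumann matrix is $A_{|\Omega_s}\in\mathbb R^{n_s\times n_s}$, $(A_{|\Omega_s})_{ij}:=a_{\Omega_s}(\phi_{S_s^i},\phi_{S_s^j})$, so that $A=\sum_{s=1}^NR_s^\top A_{|\Omega_s}R_s$. The partition of unity $(D_s)_{s}$ is either the multiplicity scaling $D_s:=R_s\left(\sum_{t=1}^NR_t^\top R_t\right)^{-1}R_s^\top$ for all $s$, or the $k$-scaling: $D_s$ diagonal with $(D_s)_{ii}:=(A_{|\Omega_s})_{ii}/(R_sAR_s^\top)_{ii}$ for all $s$; in both cases $\sum_sR_s^\top D_sR_s=I$. Operators: $P_0:=I-R_0^\top(R_0AR_0^\top)^{-1}R_0A$ ($A$-orthogonal projection with kernel $V_0$), $H_{hyb}:=P_0HP_0^\top+R_0^\top(R_0AR_0^\top)^{-1}R_0$, $H_{ad}:=H+R_0^\top(R_0AR_0^\top)^{-1}R_0$. Coloring constant: $N^c\in\mathbb N$ is such that there are subsets $\mathcal C_1,\dots,\mathcal C_{N^c}$ of $\{1,\dots,N\}$ with $\{1,\dots,N\}=\bigcup_{j}\mathcal C_j$ and, for each $j$ and all $s,t\in\mathcal C_j$ with $s\ne t$, $R_sAR_t^\top=0$. Spaces $\mathcal Y_L,\mathcal Y_H$: for $M_A\in\mathbb R^{m\times m}$ symmetric positive semi-definite, $M_B\in\mathbb R^{m\times m}$ symmetric positive definite (spd) and a scalar $\tau>0$, $\mathcal Y_L(\tau,M_A,M_B):=\operatorname{span}\{y: M_Ay=\lambda M_By\text{ with }\lambda<\tau\}$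 and $\mathcal Y_H(\tau,M_A,M_B):=\operatorname{span}\{y: M_Ay=\lambda M_By\text{ with }\lambda\ge\tau\}$. *)

theory Defs
  imports
    "HOL-Analysis.Analysis"
    "Jordan_Normal_Form.Gauss_Jordan_Elimination"
    "Jordan_Normal_Form.Matrix_Kernel"
    "Jordan_Normal_Form.Char_Poly"
begin

(* Here "$" selects components in real^2; it is handed over to JNF vectors further below. *)
no_notation Matrix.vec_index (infixl "$" 100)

definition Omega :: "(real^2) set" where
  "Omega = cbox (vector [0, 0]) (vector [2, 1])"

definition Dirichlet_boundary :: "(real^2) set" where
  "Dirichlet_boundary = {x \<in> Omega. x $ 1 = 0}"

definition grid :: "nat \<Rightarrow> nat \<Rightarrow> real^2" where
  "grid i j = vector [real i / 42, real j / 42]"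

definition mesh_nodes :: "(real^2) set" where
  "mesh_nodes = {grid i j | i j. i \<le> 84 \<and> j \<le> 42}"

(* Every square cell of side 1/42 is cut along a diagonal, the same one in all cells;
   the flag selects which of the two diagonals. *)
definition mesh :: "bool \<Rightarrow> (real^2) set set" where
  "mesh d = (\<Union>i<84. \<Union>j<42.
     if d
     then {convex hull {grid i j, grid (i+1) j, grid (i+1) (j+1)},
           convex hull {grid i j, grid i (j+1), grid (i+1) (j+1)}}
     else {convex hull {grid i j, grid (i+1) j, grid i (j+1)},
           convex hull {grid (i+1) j, grid i (j+1), grid (i+1) (j+1)}})"

(* Only the values on Omega matter. *)
definition V_h :: "bool \<Rightarrow> (real^2 \<Rightarrow> real^2) set" where
  "V_h d = {v. continuous_on Omega v
      \<and> (\<forall>T \<in> mesh d. \<exists>(B :: real^2^2) b. \<forall>x \<in> T. v x = B *v x + b)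
      \<and> (\<forall>x \<in> Dirichlet_boundary. v x = 0)}"

(* A degree of freedom is a mesh node off the Dirichlet boundary together with one of the
   two displacement components; dof numbers the degrees of freedom by 0, ..., n-1. *)
definition nodal_basis ::
  "bool \<Rightarrow> nat \<Rightarrow> (nat \<Rightarrow> (real^2) \<times> 2) \<Rightarrow> (nat \<Rightarrow> real^2 \<Rightarrow> real^2) \<Rightarrow> bool" where
  "nodal_basis d n dof \<phi> \<longleftrightarrow>
     bij_betw dof {..<n} ((mesh_nodes - Dirichlet_boundary) \<times> UNIV)
     \<and> (\<forall>k<n. \<phi> k \<in> V_h d
          \<and> (\<forall>p \<in> mesh_nodes. \<forall>c. \<phi> k p $ c = (if dof k = (p, c) then 1 else 0)))"

(* For piecewise linear continuous functions the weak derivative is the classical one, which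
   exists in the interior of each triangle, i.e. almost everywhere. *)
definition partial_deriv :: "(real^2 \<Rightarrow> real^2) \<Rightarrow> 2 \<Rightarrow> 2 \<Rightarrow> real^2 \<Rightarrow> real" where
  "partial_deriv u i j x = frechet_derivative u (at x) (axis j 1) $ i"

definition strain :: "(real^2 \<Rightarrow> real^2) \<Rightarrow> 2 \<Rightarrow> 2 \<Rightarrow> real^2 \<Rightarrow> real" where
  "strain u i j x = (partial_deriv u i j x + partial_deriv u j i x) / 2"

definition divergence :: "(real^2 \<Rightarrow> real^2) \<Rightarrow> real^2 \<Rightarrow> real" where
  "divergence u x = (\<Sum>i\<in>UNIV. partial_deriv u i i x)"

definition poisson_ratio :: real where
  "poisson_ratio = 0.4"

definition lame_mu :: "real \<Rightarrow> real" where
  "lame_mu e = e / (2 * (1 + poisson_ratio))"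

definition lame_L :: "real \<Rightarrow> real" where
  "lame_L e = e * poisson_ratio / ((1 + poisson_ratio) * (1 - 2 * poisson_ratio))"

definition elasticity_form ::
  "(real^2 \<Rightarrow> real) \<Rightarrow> (real^2) set \<Rightarrow> (real^2 \<Rightarrow> real^2) \<Rightarrow> (real^2 \<Rightarrow> real^2) \<Rightarrow> real" where
  "elasticity_form E \<omega> u v =
     (LINT x:\<omega>|lebesgue.
        2 * lame_mu (E x) * (\<Sum>i\<in>UNIV. \<Sum>j\<in>UNIV. strain u i j x * strain v i j x)
        + lame_L (E x) * divergence u x * divergence v x)"

definition decomposition :: "bool \<Rightarrow> (nat \<Rightarrow> (real^2) set set) \<Rightarrow> bool" where
  "decomposition d \<T> \<longleftrightarrow>
     (\<Union>s\<in>{1..8}. \<T> s) = mesh d \<and> disjoint_family_on \<T> {1..8} \<and> (\<forall>s\<in>{1..8}. \<T> s \<noteq> {})"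

definition subdomain :: "(nat \<Rightarrow> (real^2) set set) \<Rightarrow> nat \<Rightarrow> (real^2) set" where
  "subdomain \<T> s = \<Union>(\<T> s)"

(* The closed subdomains overlap in their interfaces, a null set, where the choice made here
   is immaterial. *)
definition young_checker :: "(nat \<Rightarrow> (real^2) set set) \<Rightarrow> real^2 \<Rightarrow> real" where
  "young_checker \<T> x =
     (if \<exists>s\<in>{1..8}. odd s \<and> x \<in> subdomain \<T> s then 10^5 else 10^8)"

definition young_layers :: "(nat \<Rightarrow> (real^2) set set) \<Rightarrow> real^2 \<Rightarrow> real" where
  "young_layers \<T> x = young_checker \<T> x
     + (if x $ 2 \<in> {1/7..2/7} \<union> {3/7..4/7} \<union> {5/7..6/7} then 10^9 else 0)"

no_notation Finite_Cartesian_Product.vec_nth (infixl "$" 90)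
notation Matrix.vec_index (infixl "$" 100)

(* Meaningful for invertible A only. *)
definition minv :: "real mat \<Rightarrow> real mat" where
  "minv A = the (mat_inverse A)"

definition msum :: "nat \<Rightarrow> nat \<Rightarrow> ('i \<Rightarrow> real mat) \<Rightarrow> 'i set \<Rightarrow> real mat" where
  "msum nr nc F I = Matrix.mat nr nc (\<lambda>(i, j). \<Sum>s\<in>I. F s $$ (i, j))"

definition vspan :: "nat \<Rightarrow> real Matrix.vec set \<Rightarrow> real Matrix.vec set" where
  "vspan m = LinearCombinations.module.span class_ring (module_vec TYPE(real) m)"

definition vlin_indpt :: "nat \<Rightarrow> real Matrix.vec set \<Rightarrow> bool" where
  "vlin_indpt m X \<longleftrightarrow>
     \<not> LinearCombinations.module.lin_dep class_ring (module_vec TYPE(real) m) X"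

definition mat_range :: "real mat \<Rightarrow> real Matrix.vec set" where
  "mat_range M = {M *\<^sub>v x | x. x \<in> carrier_vec (dim_col M)}"

definition space_sum ::
  "nat \<Rightarrow> nat set \<Rightarrow> (nat \<Rightarrow> real Matrix.vec set) \<Rightarrow> real Matrix.vec set" where
  "space_sum m I U = {finsum_vec TYPE(real) m u I | u. \<forall>s\<in>I. u s \<in> U s}"

definition rows_form_basis :: "nat \<Rightarrow> real mat \<Rightarrow> real Matrix.vec set \<Rightarrow> bool" where
  "rows_form_basis n R V \<longleftrightarrow> dim_col R = n \<and> distinct (rows R)
     \<and> vlin_indpt n (set (rows R)) \<and> vspan n (set (rows R)) = V"

definition orthonormal_range_basis :: "real mat \<Rightarrow> real mat \<Rightarrow> bool" where
  "orthonormal_range_basis W M \<longleftrightarrow> dim_row W = dim_row M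
     \<and> W\<^sup>T * W = 1\<^sub>m (dim_col W) \<and> vspan (dim_row M) (set (cols W)) = mat_range M"

definition Y_L :: "real \<Rightarrow> real mat \<Rightarrow> real mat \<Rightarrow> real Matrix.vec set" where
  "Y_L \<tau> MA MB = vspan (dim_row MA)
     {y \<in> carrier_vec (dim_row MA). \<exists>l<\<tau>. MA *\<^sub>v y = l \<cdot>\<^sub>v (MB *\<^sub>v y)}"

definition Y_H :: "real \<Rightarrow> real mat \<Rightarrow> real mat \<Rightarrow> real Matrix.vec set" where
  "Y_H \<tau> MA MB = vspan (dim_row MA)
     {y \<in> carrier_vec (dim_row MA). \<exists>l\<ge>\<tau>. MA *\<^sub>v y = l \<cdot>\<^sub>v (MB *\<^sub>v y)}"

(* Eigenvalues of a real, not necessarily symmetric, matrix are taken over the complex numbers. *)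
definition cplx_eigenvalue :: "real mat \<Rightarrow> complex \<Rightarrow> bool" where
  "cplx_eigenvalue B l \<longleftrightarrow> eigenvalue (map_mat complex_of_real B) l"

definition stiffness ::
  "(real^2 \<Rightarrow> real) \<Rightarrow> nat \<Rightarrow> (nat \<Rightarrow> real^2 \<Rightarrow> real^2) \<Rightarrow> real mat" where
  "stiffness E n \<phi> = Matrix.mat n n (\<lambda>(i, j). elasticity_form E Omega (\<phi> i) (\<phi> j))"

definition neumann ::
  "(real^2 \<Rightarrow> real) \<Rightarrow> (real^2) set \<Rightarrow> (nat \<Rightarrow> real^2 \<Rightarrow> real^2) \<Rightarrow> nat list \<Rightarrow> real mat" where
  "neumann E \<omega> \<phi> l = Matrix.mat (length l) (length l)
     (\<lambda>(i, j). elasticity_form E \<omega> (\<phi> (l ! i)) (\<phi> (l ! j)))"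

(* The list l = [S^1, ..., S^m] enumerates the degrees of freedom of a subdomain. *)
definition restriction :: "nat \<Rightarrow> nat list \<Rightarrow> real mat" where
  "restriction n l = Matrix.mat (length l) n (\<lambda>(i, j). if j = l ! i then 1 else 0)"

definition multiplicity_scaling :: "nat \<Rightarrow> (nat \<Rightarrow> real mat) \<Rightarrow> nat \<Rightarrow> real mat" where
  "multiplicity_scaling n R s =
     R s * minv (msum n n (\<lambda>t. (R t)\<^sup>T * R t) {1..8}) * (R s)\<^sup>T"

definition k_scaling ::
  "real mat \<Rightarrow> (nat \<Rightarrow> real mat) \<Rightarrow> (nat \<Rightarrow> real mat) \<Rightarrow> nat \<Rightarrow> real mat" where
  "k_scaling A R AN s = Matrix.mat (dim_row (AN s)) (dim_row (AN s))
     (\<lambda>(i, j). if i = j then AN s $$ (i, i) / (R s * A * (R s)\<^sup>T) $$ (i, i) else 0)"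

definition coloring :: "real mat \<Rightarrow> (nat \<Rightarrow> real mat) \<Rightarrow> nat \<Rightarrow> bool" where
  "coloring A R Nc \<longleftrightarrow> (\<exists>C :: nat \<Rightarrow> nat set. (\<Union>j\<in>{1..Nc}. C j) = {1..8}
     \<and> (\<forall>j\<in>{1..Nc}. \<forall>s\<in>C j. \<forall>t\<in>C j. s \<noteq> t \<longrightarrow>
          R s * A * (R t)\<^sup>T = 0\<^sub>m (dim_row (R s)) (dim_row (R t))))"

definition coarse_L ::
  "nat \<Rightarrow> real \<Rightarrow> real mat \<Rightarrow> (nat \<Rightarrow> real mat) \<Rightarrow> (nat \<Rightarrow> real mat) \<Rightarrow> real Matrix.vec set" where
  "coarse_L n \<tau> A R M = space_sum n {1..8}
     (\<lambda>s. (\<lambda>y. (R s)\<^sup>T *\<^sub>v y) ` Y_L (inverse \<tau>) (M s) (R s * A * (R s)\<^sup>T))"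

definition coarse_H ::
  "nat \<Rightarrow> real \<Rightarrow> real mat \<Rightarrow> (nat \<Rightarrow> real mat) \<Rightarrow> (nat \<Rightarrow> real mat) \<Rightarrow> (nat \<Rightarrow> real mat)
     \<Rightarrow> real Matrix.vec set" where
  "coarse_H n \<tau> A R M W =
     {u + v | u v.
        u \<in> space_sum n {1..8} (\<lambda>s. (\<lambda>y. (R s)\<^sup>T *\<^sub>v y) ` mat_kernel (M s))
      \<and> v \<in> space_sum n {1..8} (\<lambda>s. (\<lambda>y. (R s)\<^sup>T *\<^sub>v (W s *\<^sub>v y)) `
               Y_H \<tau> ((W s)\<^sup>T * (R s * A * (R s)\<^sup>T) * W s) ((W s)\<^sup>T * M s * W s))}"

definition additive_schwarz :: "nat \<Rightarrow> real mat \<Rightarrow> (nat \<Rightarrow> real mat) \<Rightarrow> real mat" where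
  "additive_schwarz n A R =
     msum n n (\<lambda>s. (R s)\<^sup>T * minv (R s * A * (R s)\<^sup>T) * R s) {1..8}"

definition coarse_solve :: "real mat \<Rightarrow> real mat \<Rightarrow> real mat" where
  "coarse_solve A R0 = R0\<^sup>T * minv (R0 * A * R0\<^sup>T) * R0"

definition coarse_proj :: "nat \<Rightarrow> real mat \<Rightarrow> real mat \<Rightarrow> real mat" where
  "coarse_proj n A R0 = 1\<^sub>m n - coarse_solve A R0 * A"

definition H_hyb :: "real mat \<Rightarrow> real mat \<Rightarrow> real mat \<Rightarrow> real mat \<Rightarrow> real mat" where
  "H_hyb H P0 A R0 = P0 * H * P0\<^sup>T + coarse_solve A R0"

definition H_ad :: "real mat \<Rightarrow> real mat \<Rightarrow> real mat \<Rightarrow> real mat" where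
  "H_ad H A R0 = H + coarse_solve A R0"

end

(* Everything is controlled by two quadratic forms, q(u) = <A u, u> and h(u) = <H A u, A u>. Within
   a colour the local solution operators are A-orthogonal projections onto A-orthogonal subspaces,
   whence h <= N^c q. For the lower bounds, D_s R_s u is split along the eigenvectors of the local
   pencil. The components that belong to the coarse space disappear under P_0, and the others have
   local energy at most tau times the local Neumann energy of u; since the Neumann energies add up
   to q(u), this is a stable splitting of u. A Cauchy-Schwarz argument then bounds q by tau h on
   range(P_0), which gives the bounds for the projected and the hybrid operator. For the additive
   operator only P_0 u is split and (I - P_0) u is added to the coarse component. *)
theory Submission
  imports
    Defs
    "Jordan_Normal_Form.Schur_Decomposition"
    "Jordan_Normal_Form.DL_Rank"
begin

section \<open>Bilinear forms and positive definite matrices\<close>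

text \<open>The preconditioned matrices need not be symmetric, so their eigenvalues are complex a
  priori. But a symmetric \<open>G\<close> times a positive definite \<open>A\<close> is
  self-adjoint for \<open>bil A\<close>; this makes the spectrum real and reduces each estimate to
  comparing \<open>bil G (A *\<^sub>v u) (A *\<^sub>v u)\<close> with \<open>bil A u u\<close>.
  \<open>H * A * P\<close> has this shape only after compression by \<open>P\<close>. The same
  observation makes the characteristic polynomial of a local pencil split over the reals, so that a
  real Schur form, together with the absence of Jordan chains, yields the eigenvector decomposition.
  From the discretization come four facts: \<open>A\<close> is definite, the Neumann matrices are
  semidefinite, they add up to \<open>A\<close>, and their diagonals are positive, which makes the
  \<open>k\<close>-scaling invertible. The constant \<open>(1 + 2 * Nc) * \<tau>\<close> arises
  because the splitting carries no bound on its coarse component. Such a bound is recovered from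
  \<open>h_le\<close> at the price of a factor \<open>Nc * \<tau>\<close>, doubled when the
  component is merged with \<open>(I - P) u\<close>; the remaining \<open>\<tau>\<close> is the
  local energy.\<close>

definition bil :: "real mat \<Rightarrow> real Matrix.vec \<Rightarrow> real Matrix.vec \<Rightarrow> real" where
  "bil M x y = Matrix.scalar_prod x (M *\<^sub>v y)"

abbreviation sp :: "real Matrix.vec \<Rightarrow> real Matrix.vec \<Rightarrow> real" where
  "sp \<equiv> Matrix.scalar_prod"

lemma bil_add_right:
  assumes "M \<in> carrier_mat p q" "x \<in> carrier_vec p" "y \<in> carrier_vec q" "z \<in> carrier_vec q"
  shows "bil M x (y + z) = bil M x y + bil M x z"
  using assms by (simp add: bil_def mult_add_distrib_mat_vec[OF assms(1)] scalar_prod_add_distrib[of _ p])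

lemma bil_add_left:
  assumes "M \<in> carrier_mat p q" "x \<in> carrier_vec p" "y \<in> carrier_vec p" "z \<in> carrier_vec q"
  shows "bil M (x + y) z = bil M x z + bil M y z"
  using assms by (simp add: bil_def add_scalar_prod_distrib[of _ p])

lemma bil_minus_right:
  assumes "M \<in> carrier_mat p q" "x \<in> carrier_vec p" "y \<in> carrier_vec q" "z \<in> carrier_vec q"
  shows "bil M x (y - z) = bil M x y - bil M x z"
  using assms by (simp add: bil_def mult_minus_distrib_mat_vec[OF assms(1)] scalar_prod_minus_distrib[of _ p])

lemma bil_minus_left:
  assumes "M \<in> carrier_mat p q" "x \<in> carrier_vec p" "y \<in> carrier_vec p" "z \<in> carrier_vec q"
  shows "bil M (x - y) z = bil M x z - bil M y z"
  using assms by (simp add: bil_def minus_scalar_prod_distrib[of _ p])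

lemma bil_smult_right:
  assumes "M \<in> carrier_mat p q" "x \<in> carrier_vec p" "y \<in> carrier_vec q"
  shows "bil M x (c \<cdot>\<^sub>v y) = c * bil M x y"
  using assms by (simp add: bil_def mult_mat_vec[OF assms(1)])

lemma bil_smult_left:
  assumes "M \<in> carrier_mat p q" "x \<in> carrier_vec p" "y \<in> carrier_vec q"
  shows "bil M (c \<cdot>\<^sub>v x) y = c * bil M x y"
  using assms by (simp add: bil_def)

lemmas bil_linear = bil_add_right bil_add_left bil_minus_right bil_minus_left
  bil_smult_right bil_smult_left

lemma sp_mult_mat_left:
  assumes "B \<in> carrier_mat p q" "x \<in> carrier_vec q" "y \<in> carrier_vec p"
  shows "sp (B *\<^sub>v x) y = sp x (B\<^sup>T *\<^sub>v y)"
  using transpose_vec_mult_scalar[of "B\<^sup>T" q p y x] assms by simp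

lemma bil_mult_left:
  assumes "M \<in> carrier_mat p q" "B \<in> carrier_mat p r" "x \<in> carrier_vec r" "y \<in> carrier_vec q"
  shows "bil M (B *\<^sub>v x) y = bil (B\<^sup>T * M) x y"
  using assms by (simp add: bil_def sp_mult_mat_left[of B p r] assoc_mult_mat_vec[of _ r p _ q])

lemma bil_mult_right:
  assumes "M \<in> carrier_mat p q" "B \<in> carrier_mat q r" "x \<in> carrier_vec p" "y \<in> carrier_vec r"
  shows "bil M x (B *\<^sub>v y) = bil (M * B) x y"
  using assms by (simp add: bil_def assoc_mult_mat_vec[of _ p q _ r])

lemma bil_transpose:
  assumes "M \<in> carrier_mat p q" "x \<in> carrier_vec p" "y \<in> carrier_vec q"
  shows "bil M\<^sup>T y x = bil M x y"
  using assms transpose_vec_mult_scalar[of M p q y x]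
  by (simp add: bil_def comm_scalar_prod[of y q])

lemma bil_conj:
  assumes "M \<in> carrier_mat p p" "B \<in> carrier_mat p r" "x \<in> carrier_vec r" "y \<in> carrier_vec r"
  shows "bil (B\<^sup>T * M * B) x y = bil M (B *\<^sub>v x) (B *\<^sub>v y)"
  using assms by (simp add: bil_mult_left[of M p p B r] bil_mult_right[of _ r p B r])

lemma bil_add_mat:
  assumes "M \<in> carrier_mat p q" "K \<in> carrier_mat p q" "x \<in> carrier_vec p" "y \<in> carrier_vec q"
  shows "bil (M + K) x y = bil M x y + bil K x y"
  using assms by (simp add: bil_def add_mult_distrib_mat_vec[of M p q K] scalar_prod_add_distrib[of _ p])

lemma bil_mat_sum:
  assumes "M \<in> carrier_mat p q" "x \<in> carrier_vec p" "y \<in> carrier_vec q"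
  shows "bil M x y = (\<Sum>i<p. \<Sum>j<q. x $ i * M $$ (i, j) * y $ j)"
  using assms by (auto simp: bil_def scalar_prod_def sum_distrib_left mult.assoc lessThan_atLeast0
      intro!: sum.cong)

lemma bil_msum:
  assumes "\<And>s. s \<in> I \<Longrightarrow> F s \<in> carrier_mat p q" "x \<in> carrier_vec p" "y \<in> carrier_vec q"
  shows "bil (msum p q F I) x y = (\<Sum>s\<in>I. bil (F s) x y)"
proof -
  have "bil (msum p q F I) x y = (\<Sum>i<p. \<Sum>j<q. \<Sum>s\<in>I. x $ i * F s $$ (i, j) * y $ j)"
    using assms by (simp add: bil_mat_sum[of _ p q] msum_def sum_distrib_left sum_distrib_right)
  also have "\<dots> = (\<Sum>s\<in>I. \<Sum>i<p. \<Sum>j<q. x $ i * F s $$ (i, j) * y $ j)"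
    by (simp add: sum.swap[of _ I])
  finally show ?thesis using assms by (simp add: bil_mat_sum[of _ p q])
qed

definition sym_psd :: "nat \<Rightarrow> real mat \<Rightarrow> bool" where
  "sym_psd n A \<longleftrightarrow> A \<in> carrier_mat n n \<and> A\<^sup>T = A \<and> (\<forall>x\<in>carrier_vec n. 0 \<le> bil A x x)"

definition sym_pd :: "nat \<Rightarrow> real mat \<Rightarrow> bool" where
  "sym_pd n A \<longleftrightarrow> A \<in> carrier_mat n n \<and> A\<^sup>T = A
     \<and> (\<forall>x\<in>carrier_vec n. x \<noteq> 0\<^sub>v n \<longrightarrow> 0 < bil A x x)"

lemma bil_zero [simp]: "x \<in> carrier_vec p \<Longrightarrow> M \<in> carrier_mat p q \<Longrightarrow> bil M x (0\<^sub>v q) = 0"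
  by (simp add: bil_def scalar_prod_def)

lemma sym_pd_psd: "sym_pd n A \<Longrightarrow> sym_psd n A"
  unfolding sym_pd_def sym_psd_def using bil_zero by (metis less_eq_real_def zero_carrier_vec)

lemma bil_sym:
  assumes "A \<in> carrier_mat n n" "A\<^sup>T = A" "x \<in> carrier_vec n" "y \<in> carrier_vec n"
  shows "bil A x y = bil A y x"
  using bil_transpose[of A n n y x] assms by simp

text \<open>Congruence by an injective matrix. With \<open>B\<close> the transpose of
  \<open>R s\<close> or of \<open>R0\<close> it gives the local and the coarse matrices, with
  \<open>B = W\<close> the first matrix of the compressed pencil.\<close>

lemma sym_pd_conj:
  assumes A: "sym_pd n A" and B: "B \<in> carrier_mat n k"
    and inj: "\<And>x. x \<in> carrier_vec k \<Longrightarrow> B *\<^sub>v x = 0\<^sub>v n \<Longrightarrow> x = 0\<^sub>v k"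
  shows "sym_pd k (B\<^sup>T * A * B)"
proof -
  have A': "A \<in> carrier_mat n n" "A\<^sup>T = A" using A by (auto simp: sym_pd_def)
  have "(B\<^sup>T * A * B)\<^sup>T = B\<^sup>T * (B\<^sup>T * A)\<^sup>T"
    using A' B by (intro transpose_mult) auto
  also have "(B\<^sup>T * A)\<^sup>T = A * B"
    using A' B transpose_mult[of "B\<^sup>T" k n A n] by simp
  also have "B\<^sup>T * (A * B) = B\<^sup>T * A * B"
    using A' B by (intro assoc_mult_mat[symmetric]) auto
  finally show ?thesis
    using A A' B inj mult_mat_vec_carrier[OF B] bil_conj[OF A'(1) B] unfolding sym_pd_def
    by (smt (verit) mult_carrier_mat transpose_carrier_mat)
qed

section \<open>Inverses of real matrices\<close>

lemma minvI:
  assumes "A \<in> carrier_mat n n" "B \<in> carrier_mat n n" "A * B = 1\<^sub>m n" "B * A = 1\<^sub>m n"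
  shows "minv A = B"
proof (cases "mat_inverse A")
  case None
  \<comment> \<open>A two-sided inverse makes \<open>A\<close> a unit of the matrix ring, whereas
    \<open>mat_inverse\<close> returns \<open>None\<close> only on non-units.\<close>
  have "A \<in> Units (ring_mat TYPE(real) n ())"
    using assms by (auto simp: Units_def ring_mat_def)
  then show ?thesis using mat_inverse(1)[OF assms(1) None, of "()"] by simp
next
  case (Some C)
  from mat_inverse(2)[OF assms(1) Some]
  have C: "A * C = 1\<^sub>m n" "C * A = 1\<^sub>m n" "C \<in> carrier_mat n n" by auto
  have "C = C * (A * B)" using C assms by simp
  also have "\<dots> = (C * A) * B" using C assms by (intro assoc_mult_mat[symmetric]) auto
  finally show ?thesis using C assms Some by (simp add: minv_def)
qed

lemma minv_inverse:
  assumes A: "A \<in> carrier_mat n n"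
    and inj: "\<And>x. x \<in> carrier_vec n \<Longrightarrow> A *\<^sub>v x = 0\<^sub>v n \<Longrightarrow> x = 0\<^sub>v n"
  shows "minv A \<in> carrier_mat n n" "A * minv A = 1\<^sub>m n" "minv A * A = 1\<^sub>m n"
proof -
  have "Determinant.det A \<noteq> 0"
    using det_0_iff_vec_prod_zero_field[OF A] inj by auto
  from det_non_zero_imp_unit[OF A this, of "()"]
  obtain B where "B \<in> carrier_mat n n" "A * B = 1\<^sub>m n" "B * A = 1\<^sub>m n"
    by (auto simp: Units_def ring_mat_def)
  with minvI[OF A] A show "minv A \<in> carrier_mat n n" "A * minv A = 1\<^sub>m n" "minv A * A = 1\<^sub>m n"
    by auto
qed

lemma sym_pd_minv:
  assumes A: "sym_pd n A"
  shows "minv A \<in> carrier_mat n n" "A * minv A = 1\<^sub>m n" "minv A * A = 1\<^sub>m n"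
    "(minv A)\<^sup>T = minv A"
proof -
  have A': "A \<in> carrier_mat n n" "A\<^sup>T = A" using A by (auto simp: sym_pd_def)
  have "x = 0\<^sub>v n" if "x \<in> carrier_vec n" "A *\<^sub>v x = 0\<^sub>v n" for x
    using A that by (force simp: sym_pd_def bil_def)
  note m = minv_inverse[OF A'(1) this]
  then show "minv A \<in> carrier_mat n n" "A * minv A = 1\<^sub>m n" "minv A * A = 1\<^sub>m n" by auto
  have "A * (minv A)\<^sup>T = 1\<^sub>m n" "(minv A)\<^sup>T * A = 1\<^sub>m n"
    using transpose_mult[of "minv A" n n A n] transpose_mult[of A n n "minv A" n] m A'
    by (metis transpose_one)+
  then show "(minv A)\<^sup>T = minv A" using minvI[of A n "(minv A)\<^sup>T"] A' m by simp
qed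

text \<open>\<open>G * A\<close> is self-adjoint for the inner product \<open>bil A\<close>, because
  \<open>bil A x (G A y) = bil G (A x) (A y)\<close>. The complex eigenvector is split into real and
  imaginary parts so that only real forms occur; once \<open>l\<close> is real, whichever part is
  nonzero is a real eigenvector.\<close>

lemma cplx_eigenvalue_sym_mult_pd:
  assumes G: "G \<in> carrier_mat n n" "G\<^sup>T = G" and A: "sym_pd n A"
    and ev: "cplx_eigenvalue (G * A) l"
  shows "l \<in> \<real>" "\<exists>x\<in>carrier_vec n. x \<noteq> 0\<^sub>v n \<and> (G * A) *\<^sub>v x = Re l \<cdot>\<^sub>v x"
proof -
  have A': "A \<in> carrier_mat n n" "A\<^sup>T = A" using A by (auto simp: sym_pd_def)
  let ?T = "G * A"
  have T: "?T \<in> carrier_mat n n" using G A' by simp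
  from ev obtain v where v: "v \<in> carrier_vec n" "v \<noteq> 0\<^sub>v n"
    "map_mat complex_of_real ?T *\<^sub>v v = l \<cdot>\<^sub>v v"
    using T by (auto simp: cplx_eigenvalue_def eigenvalue_def eigenvector_def)
  define p where "p = map_vec Re v"
  define q where "q = map_vec Im v"
  have pq: "p \<in> carrier_vec n" "q \<in> carrier_vec n" using v by (auto simp: p_def q_def)
  have eq: "(\<Sum>j<n. complex_of_real (?T $$ (i, j)) * v $ j) = l * v $ i" if "i < n" for i
  proof -
    have "(map_mat complex_of_real ?T *\<^sub>v v) $ i = (l \<cdot>\<^sub>v v) $ i" using v by simp
    moreover have "(map_mat complex_of_real ?T *\<^sub>v v) $ i
        = (\<Sum>j<n. complex_of_real (?T $$ (i, j)) * v $ j)"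
      using that v(1) T by (auto simp: scalar_prod_def lessThan_atLeast0 simp del: index_mult_mat intro!: sum.cong)
    ultimately show ?thesis using that v(1) by (simp del: index_mult_mat_vec index_mult_mat)
  qed
  have Tp: "?T *\<^sub>v p = Re l \<cdot>\<^sub>v p - Im l \<cdot>\<^sub>v q"
  proof (rule eq_vecI)
    fix i assume "i < dim_vec (Re l \<cdot>\<^sub>v p - Im l \<cdot>\<^sub>v q)"
    then have i: "i < n" using pq by auto
    have "(?T *\<^sub>v p) $ i = Re (\<Sum>j<n. complex_of_real (?T $$ (i, j)) * v $ j)"
      using i v T by (simp add: scalar_prod_def lessThan_atLeast0 p_def del: index_mult_mat)
    then show "(?T *\<^sub>v p) $ i = (Re l \<cdot>\<^sub>v p - Im l \<cdot>\<^sub>v q) $ i"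
      using i v pq by (simp add: eq p_def q_def)
  qed (use T pq in auto)
  have Tq: "?T *\<^sub>v q = Re l \<cdot>\<^sub>v q + Im l \<cdot>\<^sub>v p"
  proof (rule eq_vecI)
    fix i assume "i < dim_vec (Re l \<cdot>\<^sub>v q + Im l \<cdot>\<^sub>v p)"
    then have i: "i < n" using pq by auto
    have "(?T *\<^sub>v q) $ i = Im (\<Sum>j<n. complex_of_real (?T $$ (i, j)) * v $ j)"
      using i v T by (simp add: scalar_prod_def lessThan_atLeast0 q_def del: index_mult_mat)
    then show "(?T *\<^sub>v q) $ i = (Re l \<cdot>\<^sub>v q + Im l \<cdot>\<^sub>v p) $ i"
      using i v pq by (simp add: eq p_def q_def)
  qed (use T pq in auto)
  have AG: "bil A x (?T *\<^sub>v y) = bil A y (?T *\<^sub>v x)" if "x \<in> carrier_vec n" "y \<in> carrier_vec n" for x y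
  proof -
    have e: "bil A x (?T *\<^sub>v y) = bil G (A *\<^sub>v x) (A *\<^sub>v y)" if "x \<in> carrier_vec n" "y \<in> carrier_vec n" for x y
      using A' G that
      by (simp add: bil_def sp_mult_mat_left[of A n n] assoc_mult_mat_vec[of G n n A n])
    show ?thesis using e[of x y] e[of y x] that bil_sym[of G n "A *\<^sub>v x" "A *\<^sub>v y"] G A' by simp
  qed
  have "bil A q (?T *\<^sub>v p) = bil A p (?T *\<^sub>v q)" using AG pq by simp
  \<comment> \<open>The mixed terms cancel by symmetry of \<open>A\<close>; the two sides differ by
    \<open>Im l\<close> times the energies of \<open>p\<close> and \<open>q\<close>.\<close>
  then have "Im l * (bil A p p + bil A q q) = 0"
    using pq A' bil_sym[of A n p q] by (simp add: Tp Tq bil_linear[of A n n] algebra_simps)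
  moreover have "p \<noteq> 0\<^sub>v n \<or> q \<noteq> 0\<^sub>v n"
  proof (rule ccontr)
    assume a: "\<not> ?thesis"
    have "v $ i = 0" if "i < n" for i
    proof -
      have "p $ i = 0" "q $ i = 0" using a that by auto
      then show ?thesis using that v by (simp add: p_def q_def complex_eq_iff)
    qed
    then have "v = 0\<^sub>v n" using v by (intro eq_vecI) auto
    with v show False by simp
  qed
  moreover then have "bil A p p + bil A q q > 0"
    using A pq sym_pd_psd[OF A] unfolding sym_pd_def sym_psd_def
    by (metis add_nonneg_pos add_pos_nonneg)
  ultimately have Im: "Im l = 0" by auto
  then show "l \<in> \<real>" by (simp add: complex_is_Real_iff)
  show "\<exists>x\<in>carrier_vec n. x \<noteq> 0\<^sub>v n \<and> ?T *\<^sub>v x = Re l \<cdot>\<^sub>v x"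
  proof (cases "p = 0\<^sub>v n")
    case True
    have "?T *\<^sub>v q = Re l \<cdot>\<^sub>v q" using Tq Im pq by (auto intro!: eq_vecI)
    then show ?thesis using pq True \<open>p \<noteq> 0\<^sub>v n \<or> q \<noteq> 0\<^sub>v n\<close> by auto
  next
    case False
    have "?T *\<^sub>v p = Re l \<cdot>\<^sub>v p" using Tp Im pq by (auto intro!: eq_vecI)
    then show ?thesis using pq False by auto
  qed
qed

section \<open>Symmetric pencils\<close>

text \<open>A componentwise sum lies in the carrier whatever the summands are, which keeps side
  conditions out of the calculations; \<open>finsum_vec_eq_vsum\<close> is the bridge to
  \<open>space_sum\<close>.\<close>

definition vsum :: "nat \<Rightarrow> ('i \<Rightarrow> real Matrix.vec) \<Rightarrow> 'i set \<Rightarrow> real Matrix.vec" where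
  "vsum m z F = Matrix.vec m (\<lambda>i. \<Sum>s\<in>F. z s $ i)"

lemma vsum_carrier [simp]: "vsum m z F \<in> carrier_vec m"
  by (simp add: vsum_def)

lemma finsum_vec_eq_vsum:
  assumes "finite F" "\<And>s. s \<in> F \<Longrightarrow> z s \<in> carrier_vec m"
  shows "finsum_vec TYPE(real) m z F = vsum m z F"
proof -
  have z: "z \<in> F \<rightarrow> carrier_vec m" using assms by auto
  show ?thesis
    using finsum_vec_closed[OF z] assms(1)
    by (intro eq_vecI) (auto simp: vsum_def index_finsum_vec[OF _ _ z])
qed

lemma vsum_insert:
  assumes "finite F" "a \<notin> F" "z a \<in> carrier_vec m"
  shows "vsum m z (insert a F) = z a + vsum m z F"
  using assms by (intro eq_vecI) (auto simp: vsum_def)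

lemma vsum_empty: "vsum m z {} = 0\<^sub>v m"
  by (intro eq_vecI) (auto simp: vsum_def)

lemma mult_mat_vsum:
  assumes "M \<in> carrier_mat p q" "\<And>s. s \<in> F \<Longrightarrow> z s \<in> carrier_vec q"
  shows "M *\<^sub>v vsum q z F = vsum p (\<lambda>s. M *\<^sub>v z s) F"
proof (rule eq_vecI)
  fix i assume "i < dim_vec (vsum p (\<lambda>s. M *\<^sub>v z s) F)"
  then have i: "i < p" by (simp add: vsum_def)
  have "(M *\<^sub>v vsum q z F) $ i = (\<Sum>j<q. \<Sum>s\<in>F. M $$ (i, j) * z s $ j)"
    using i assms(1) by (auto simp: vsum_def scalar_prod_def lessThan_atLeast0 sum_distrib_left)
  also have "\<dots> = (\<Sum>s\<in>F. \<Sum>j<q. M $$ (i, j) * z s $ j)"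
    by (rule sum.swap)
  also have "\<dots> = (\<Sum>s\<in>F. (M *\<^sub>v z s) $ i)"
  proof (rule sum.cong)
    fix s assume "s \<in> F"
    then show "(\<Sum>j<q. M $$ (i, j) * z s $ j) = (M *\<^sub>v z s) $ i"
      using assms(1) assms(2)[of s] i by (simp add: scalar_prod_def lessThan_atLeast0)
  qed simp
  finally show "(M *\<^sub>v vsum q z F) $ i = vsum p (\<lambda>s. M *\<^sub>v z s) F $ i"
    using i by (simp add: vsum_def)
qed (use assms in \<open>auto simp: vsum_def\<close>)

lemma sp_vsum_right:
  assumes "x \<in> carrier_vec p" "\<And>s. s \<in> F \<Longrightarrow> z s \<in> carrier_vec p"
  shows "sp x (vsum p z F) = (\<Sum>s\<in>F. sp x (z s))"
proof -
  have "sp x (vsum p z F) = (\<Sum>j<p. \<Sum>s\<in>F. x $ j * z s $ j)"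
    using assms(1) by (auto simp: vsum_def scalar_prod_def lessThan_atLeast0 sum_distrib_left)
  also have "\<dots> = (\<Sum>s\<in>F. \<Sum>j<p. x $ j * z s $ j)" by (rule sum.swap)
  also have "\<dots> = (\<Sum>s\<in>F. sp x (z s))"
    using carrier_vecD[OF assms(2)]
    by (intro sum.cong) (simp_all add: scalar_prod_def lessThan_atLeast0)
  finally show ?thesis .
qed

lemma sp_vsum_left:
  assumes "x \<in> carrier_vec p" "\<And>s. s \<in> F \<Longrightarrow> z s \<in> carrier_vec p"
  shows "sp (vsum p z F) x = (\<Sum>s\<in>F. sp (z s) x)"
proof -
  have "sp (vsum p z F) x = sp x (vsum p z F)" using assms by (intro comm_scalar_prod) auto
  also have "\<dots> = (\<Sum>s\<in>F. sp x (z s))" using assms by (rule sp_vsum_right)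
  also have "\<dots> = (\<Sum>s\<in>F. sp (z s) x)"
    using assms by (intro sum.cong refl comm_scalar_prod) auto
  finally show ?thesis .
qed

lemma bil_vsum:
  assumes "M \<in> carrier_mat p q" "\<And>s. s \<in> F \<Longrightarrow> x s \<in> carrier_vec p"
    "\<And>s. s \<in> G \<Longrightarrow> y s \<in> carrier_vec q"
  shows "bil M (vsum p x F) (vsum q y G) = (\<Sum>s\<in>F. \<Sum>t\<in>G. bil M (x s) (y t))"
  using assms by (simp add: bil_def mult_mat_vsum sp_vsum_right sp_vsum_left) (rule sum.swap)

lemma mult_mat_vec_eq_vsum:
  assumes "P \<in> carrier_mat m q" "c \<in> carrier_vec q"
  shows "P *\<^sub>v c = vsum m (\<lambda>i. c $ i \<cdot>\<^sub>v col P i) {..<q}"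
  using assms by (intro eq_vecI)
    (auto simp: vsum_def scalar_prod_def lessThan_atLeast0 mult.commute intro!: sum.cong)

lemma vsum_in_vspan:
  assumes "finite F" "\<And>s. s \<in> F \<Longrightarrow> z s \<in> U" "U \<subseteq> carrier_vec m"
  shows "vsum m z F \<in> vspan m U"
proof -
  interpret vec_space "TYPE(real)" m .
  show ?thesis using assms(1,2)
  proof (induction F rule: finite_induct)
    case empty
    then show ?case using vectorspace.span_zero[OF vec_vs, of m U] by (simp add: vsum_empty vspan_def)
  next
    case (insert a F)
    have "z a \<in> carrier_vec m" using insert assms(3) by auto
    then show ?case using insert span_add1[of U "z a" "vsum m z F"] span_mem[of U "z a"] assms(3)
      by (auto simp: vsum_insert vspan_def)
  qed
qed

definition eigvec_pencil :: "nat \<Rightarrow> real mat \<Rightarrow> real mat \<Rightarrow> real \<Rightarrow> real Matrix.vec \<Rightarrow> bool" where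
  "eigvec_pencil m MA MB l z \<longleftrightarrow> z \<in> carrier_vec m \<and> MA *\<^sub>v z = l \<cdot>\<^sub>v (MB *\<^sub>v z)"

text \<open>The summands are indexed by the eigenvalue itself, so distinct summands are orthogonal
  without a choice of basis inside an eigenspace. Values off \<open>F\<close> are zero, so two
  families can be added on the union of their index sets.\<close>

definition eigsum :: "nat \<Rightarrow> real mat \<Rightarrow> real mat \<Rightarrow> real Matrix.vec \<Rightarrow> bool" where
  "eigsum m MA MB y \<longleftrightarrow> (\<exists>F z. finite F \<and> (\<forall>l. eigvec_pencil m MA MB l (z l))
     \<and> (\<forall>l. l \<notin> F \<longrightarrow> z l = 0\<^sub>v m) \<and> y = vsum m z F)"

section \<open>Eigenvector decomposition of a symmetric-definite pencil\<close>

lemma mult_mat_zero_vec: "M \<in> carrier_mat p q \<Longrightarrow> M *\<^sub>v 0\<^sub>v q = 0\<^sub>v p"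
  by (intro eq_vecI) auto

locale pencil =
  fixes m :: nat and MA MB :: "real mat"
  assumes MA: "MA \<in> carrier_mat m m" "MA\<^sup>T = MA"
    and MB: "sym_pd m MB"
begin

lemma MB': "MB \<in> carrier_mat m m" "MB\<^sup>T = MB"
  using MB by (auto simp: sym_pd_def)

abbreviation "ev \<equiv> eigvec_pencil m MA MB"
abbreviation "es \<equiv> eigsum m MA MB"

lemma ev_zero: "ev l (0\<^sub>v m)"
  using MA MB' by (auto simp: eigvec_pencil_def mult_mat_zero_vec intro!: eq_vecI)

lemma ev_smult: "ev l z \<Longrightarrow> ev l (c \<cdot>\<^sub>v z)"
  using MA MB' by (auto simp: eigvec_pencil_def mult_mat_vec[of _ m m] smult_smult_assoc mult.commute)

lemma ev_add: "ev l z \<Longrightarrow> ev l w \<Longrightarrow> ev l (z + w)"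
  using MA MB' by (auto simp: eigvec_pencil_def mult_add_distrib_mat_vec[of _ m m]
      smult_add_distrib_vec[of _ m])

lemma es_ev:
  assumes "ev l z"
  shows "es z"
proof -
  let ?z = "\<lambda>k. if k = l then z else 0\<^sub>v m"
  have "z \<in> carrier_vec m" using assms by (simp add: eigvec_pencil_def)
  then have "z = vsum m ?z {l}" by (intro eq_vecI) (auto simp: vsum_def)
  moreover have "ev k (?z k)" for k using assms ev_zero by simp
  ultimately show ?thesis unfolding eigsum_def
    by (intro exI[of _ "{l}"] exI[of _ ?z]) auto
qed

lemma es_carrier: "es y \<Longrightarrow> y \<in> carrier_vec m"
  by (auto simp: eigsum_def)

lemma es_add:
  assumes "es x" "es y"
  shows "es (x + y)"
proof -
  from assms obtain F z G w where F: "finite F" "\<And>l. ev l (z l)" "\<And>l. l \<notin> F \<Longrightarrow> z l = 0\<^sub>v m" "x = vsum m z F"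
    and G: "finite G" "\<And>l. ev l (w l)" "\<And>l. l \<notin> G \<Longrightarrow> w l = 0\<^sub>v m" "y = vsum m w G"
    unfolding eigsum_def by metis
  have c: "z l \<in> carrier_vec m" "w l \<in> carrier_vec m" for l
    using F(2) G(2) by (auto simp: eigvec_pencil_def)
  have "x + y = vsum m (\<lambda>l. z l + w l) (F \<union> G)"
  proof (rule eq_vecI)
    fix i assume "i < dim_vec (vsum m (\<lambda>l. z l + w l) (F \<union> G))"
    then have i: "i < m" by (simp add: vsum_def)
    have "(\<Sum>l\<in>F. z l $ i) = (\<Sum>l\<in>F\<union>G. z l $ i)"
      using F G i by (intro sum.mono_neutral_left) auto
    moreover have "(\<Sum>l\<in>G. w l $ i) = (\<Sum>l\<in>F\<union>G. w l $ i)"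
      using F G i by (intro sum.mono_neutral_left) auto
    moreover have "(z l + w l) $ i = z l $ i + w l $ i" for l
      using i c[of l] by simp
    ultimately show "(x + y) $ i = vsum m (\<lambda>l. z l + w l) (F \<union> G) $ i"
      using i by (simp add: F(4) G(4) vsum_def sum.distrib)
  qed (simp add: F G vsum_def)
  then show ?thesis unfolding eigsum_def using F G
    by (intro exI[of _ "F \<union> G"] exI[of _ "\<lambda>l. z l + w l"]) (auto intro: ev_add)
qed

lemma es_smult:
  assumes "es x"
  shows "es (c \<cdot>\<^sub>v x)"
proof -
  from assms obtain F z where F: "finite F" "\<And>l. ev l (z l)" "\<And>l. l \<notin> F \<Longrightarrow> z l = 0\<^sub>v m" "x = vsum m z F"
    unfolding eigsum_def by metis
  have c: "z l \<in> carrier_vec m" for l using F(2) by (auto simp: eigvec_pencil_def)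
  have "c \<cdot>\<^sub>v x = vsum m (\<lambda>l. c \<cdot>\<^sub>v z l) F"
    using carrier_vecD[OF c] by (intro eq_vecI) (auto simp: F(4) vsum_def sum_distrib_left)
  then show ?thesis unfolding eigsum_def using F
    by (intro exI[of _ F] exI[of _ "\<lambda>l. c \<cdot>\<^sub>v z l"]) (auto intro: ev_smult)
qed

lemma es_vsum:
  assumes "finite F" "\<And>s. s \<in> F \<Longrightarrow> es (x s)"
  shows "es (vsum m x F)"
  using assms
proof (induction F rule: finite_induct)
  case empty
  then show ?case using es_ev[OF ev_zero] by (simp add: vsum_empty)
next
  case (insert a F)
  then show ?case by (simp add: vsum_insert es_carrier es_add)
qed

lemma ev_bil:
  assumes "ev l z" "x \<in> carrier_vec m"
  shows "bil MA x z = l * bil MB x z" "bil MA z x = l * bil MB z x"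
proof -
  show 1: "bil MA x z = l * bil MB x z"
    using assms MB' by (simp add: bil_def eigvec_pencil_def)
  show "bil MA z x = l * bil MB z x"
    using 1 assms bil_sym[OF MA] bil_sym[OF MB'] by (simp add: eigvec_pencil_def)
qed

text \<open>Evaluating \<open>bil MA z w\<close> through either eigenvector gives
  \<open>l * bil MB z w = k * bil MB z w\<close>.\<close>

lemma ev_orthogonal:
  assumes "ev l z" "ev k w" "l \<noteq> k"
  shows "bil MB z w = 0" "bil MA z w = 0"
proof -
  have c: "z \<in> carrier_vec m" "w \<in> carrier_vec m" using assms by (auto simp: eigvec_pencil_def)
  have "l * bil MB z w = k * bil MB z w"
    using ev_bil(2)[OF assms(1) c(2)] ev_bil(1)[OF assms(2) c(1)] by linarith
  then have "(l - k) * bil MB z w = 0" by (simp add: left_diff_distrib)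
  then show "bil MB z w = 0" using assms(3) by simp
  then show "bil MA z w = 0" using ev_bil(2)[OF assms(1) c(2)] by simp
qed

text \<open>The step excludes Jordan chains: a generalised eigenvector of order two of a pencil with
  positive definite second matrix is already an eigenvector.\<close>

lemma es_step:
  assumes w: "w \<in> carrier_vec m" and r: "es r"
    and eq: "MA *\<^sub>v w = l \<cdot>\<^sub>v (MB *\<^sub>v w) + MB *\<^sub>v r"
  shows "es w"
proof -
  from r obtain F z where F: "finite F" "\<And>l. ev l (z l)" "\<And>l. l \<notin> F \<Longrightarrow> z l = 0\<^sub>v m" "r = vsum m z F"
    unfolding eigsum_def by metis
  have c: "z k \<in> carrier_vec m" for k using F(2) by (auto simp: eigvec_pencil_def)
  \<comment> \<open>Solves \<open>(MA - l MB) x = MB r\<close> for every component of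
    \<open>r\<close> except the resonant one \<open>z l\<close>, where \<open>k - l\<close> would
    vanish.\<close>
  define x where "x = vsum m (\<lambda>k. inverse (k - l) \<cdot>\<^sub>v z k) (F - {l})"
  have xc: "x \<in> carrier_vec m" by (simp add: x_def)
  have es_x: "es x" unfolding x_def using F by (intro es_vsum es_ev[OF ev_smult]) auto
  have Ax: "MA *\<^sub>v x = l \<cdot>\<^sub>v (MB *\<^sub>v x) + MB *\<^sub>v r - MB *\<^sub>v z l"
  proof (rule eq_vecI)
    fix i assume "i < dim_vec (l \<cdot>\<^sub>v (MB *\<^sub>v x) + MB *\<^sub>v r - MB *\<^sub>v z l)"
    then have i: "i < m" using MB' by simp
    have d: "dim_vec (z k) = m" "dim_row MB = m" "dim_row MA = m" for k
      using c[of k] MB' MA by auto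
    have Az: "MA *\<^sub>v z k = k \<cdot>\<^sub>v (MB *\<^sub>v z k)" for k using F(2)[of k] by (simp add: eigvec_pencil_def)
    let ?b = "\<lambda>k. (MB *\<^sub>v z k) $ i"
    have Mx: "M *\<^sub>v x = vsum m (\<lambda>k. inverse (k - l) \<cdot>\<^sub>v (M *\<^sub>v z k)) (F - {l})"
      if "M \<in> carrier_mat m m" for M
      using that c by (simp add: x_def mult_mat_vsum[of _ m m] mult_mat_vec[of _ m m])
    have Mr: "MB *\<^sub>v r = vsum m (\<lambda>k. MB *\<^sub>v z k) F"
      using c MB' by (simp add: F(4) mult_mat_vsum[of _ m m])
    have "(MA *\<^sub>v x) $ i = (\<Sum>k\<in>F-{l}. inverse (k - l) * (k * ?b k))"
      unfolding Mx[OF MA(1)] Az using i d by (simp add: vsum_def del: index_mult_mat_vec)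
    also have "\<dots> = (\<Sum>k\<in>F-{l}. l * (inverse (k - l) * ?b k) + ?b k)"
      by (intro sum.cong) (auto simp: field_simps simp del: index_mult_mat_vec)
    also have "\<dots> = l * (\<Sum>k\<in>F-{l}. inverse (k - l) * ?b k) + (\<Sum>k\<in>F-{l}. ?b k)"
      by (simp add: sum.distrib sum_distrib_left del: index_mult_mat_vec)
    also have "(\<Sum>k\<in>F-{l}. inverse (k - l) * ?b k) = (MB *\<^sub>v x) $ i"
      unfolding Mx[OF MB'(1)] using i d by (simp add: vsum_def del: index_mult_mat_vec)
    also have "(\<Sum>k\<in>F-{l}. ?b k) = (\<Sum>k\<in>F. ?b k) - ?b l"
    proof (cases "l \<in> F")
      case True
      then show ?thesis using F(1) by (simp add: sum_diff1 del: index_mult_mat_vec)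
    next
      case False
      then have "?b l = 0" using F(3) i MB' by (simp add: mult_mat_zero_vec del: index_mult_mat_vec)
      then show ?thesis using False by (simp del: index_mult_mat_vec)
    qed
    also have "(\<Sum>k\<in>F. ?b k) = (MB *\<^sub>v r) $ i"
      unfolding Mr using i d by (simp add: vsum_def del: index_mult_mat_vec)
    finally show "(MA *\<^sub>v x) $ i = (l \<cdot>\<^sub>v (MB *\<^sub>v x) + MB *\<^sub>v r - MB *\<^sub>v z l) $ i"
      using i d by (simp del: index_mult_mat_vec)
  qed (use MA MB' in auto)
  define e where "e = w - x"
  have ec: "e \<in> carrier_vec m" using w xc by (simp add: e_def)
  have Ae: "MA *\<^sub>v e = l \<cdot>\<^sub>v (MB *\<^sub>v e) + MB *\<^sub>v z l"
  proof (rule eq_vecI)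
    fix i assume "i < dim_vec (l \<cdot>\<^sub>v (MB *\<^sub>v e) + MB *\<^sub>v z l)"
    then have i: "i < m" using MB' by simp
    then show "(MA *\<^sub>v e) $ i = (l \<cdot>\<^sub>v (MB *\<^sub>v e) + MB *\<^sub>v z l) $ i"
      using MA MB' w xc
      by (simp add: e_def mult_minus_distrib_mat_vec[of _ m m] Ax eq right_diff_distrib
          del: index_mult_mat_vec)
  qed (use MA MB' in auto)
  \<comment> \<open>Pairing with the eigenvector \<open>z l\<close> gives the same
    \<open>l\<close>-term on both sides, so \<open>z l\<close> has no \<open>MB\<close>-energy and
    \<open>e\<close> is itself an eigenvector.\<close>
  have "bil MA (z l) e = l * bil MB (z l) e + bil MB (z l) (z l)"
    using c[of l] ec MB' by (simp add: bil_def Ae scalar_prod_add_distrib[of _ m])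
  moreover have "bil MA (z l) e = l * bil MB (z l) e"
    using ev_bil(2)[OF F(2) ec] .
  ultimately have "bil MB (z l) (z l) = 0" by simp
  then have "z l = 0\<^sub>v m" using MB c[of l] unfolding sym_pd_def by force
  then have "ev l e" using Ae ec MB' by (simp add: eigvec_pencil_def mult_mat_zero_vec)
  then have "es (x + e)" using es_add[OF es_x es_ev] by blast
  moreover have "x + e = w" using w xc by (intro eq_vecI) (auto simp: e_def)
  ultimately show ?thesis by simp
qed

text \<open>Every complex root is an eigenvalue of a symmetric times a positive definite matrix,
  hence real. The factorization descends to the reals because the embedding of real into complex
  polynomials is injective.\<close>

lemma real_char_poly_splits:
  "\<exists>as. char_poly (minv MB * MA) = (\<Prod>a\<leftarrow>as. [:- a, 1:])"
proof -
  interpret of_real_poly_hom: map_poly_inj_comm_ring_hom "of_real :: real \<Rightarrow> complex" ..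
  note B = sym_pd_minv[OF MB]
  let ?T = "minv MB * MA"
  have T: "?T \<in> carrier_mat m m" using B MA by simp
  \<comment> \<open>The identity \<open>?T = ?G * MB\<close> with symmetric \<open>?G\<close> brings
    \<open>?T\<close> into the form that has real eigenvalues.\<close>
  let ?G = "minv MB * MA * minv MB"
  have "?G\<^sup>T = minv MB * (MA * minv MB)"
    using B MA transpose_mult[of "minv MB" m m MA m] transpose_mult[of "minv MB * MA" m m "minv MB" m]
    by simp
  then have G: "?G \<in> carrier_mat m m" "?G\<^sup>T = ?G"
    using B MA assoc_mult_mat[of "minv MB" m m MA m "minv MB" m] by simp_all
  have TG: "?T = ?G * MB"
    using B MA MB' assoc_mult_mat[of "?T" m m "minv MB" m MB m] by (simp del: assoc_mult_mat)
  let ?C = "map_mat complex_of_real ?T"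
  from char_poly_factorized[of ?C m] T obtain cs where
    cs: "char_poly ?C = (\<Prod>a\<leftarrow>cs. [:- a, 1:])" by auto
  have real: "complex_of_real (Re a) = a" if "a \<in> set cs" for a
  proof -
    have "poly (char_poly ?C) a = 0" unfolding cs using that linear_poly_root by blast
    then have "eigenvalue ?C a" using eigenvalue_root_char_poly[of ?C m a] T by simp
    then have "cplx_eigenvalue (?G * MB) a" by (simp only: cplx_eigenvalue_def TG[symmetric])
    then have "a \<in> \<real>" using cplx_eigenvalue_sym_mult_pd(1)[OF G MB] by blast
    then show ?thesis by simp
  qed
  have "map_poly complex_of_real (char_poly ?T) = char_poly ?C"
    by (rule of_real_hom.char_poly_hom[OF T, symmetric])
  also have "\<dots> = (\<Prod>a\<leftarrow>cs. [:- a, 1:])" by (rule cs)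
  also have "map (\<lambda>a. [:- a, 1:]) cs = map (\<lambda>a. map_poly complex_of_real [:- Re a, 1:]) cs"
  proof (rule map_cong[OF refl])
    fix a assume "a \<in> set cs"
    from real[OF this] show "[:- a, 1:] = map_poly complex_of_real [:- Re a, 1:]" by simp
  qed
  also have "prod_list \<dots> = map_poly complex_of_real (\<Prod>a\<leftarrow>map Re cs. [:- a, 1:])"
    by (simp only: of_real_poly_hom.hom_prod_list map_map o_def)
  finally have "char_poly ?T = (\<Prod>a\<leftarrow>map Re cs. [:- a, 1:])"
    by (rule of_real_poly_hom.injectivity)
  then show ?thesis by blast
qed

text \<open>Triangularize \<open>minv MB * MA\<close> over the reals. Each column of the Schur basis
  satisfies the eigenvector equation up to a combination of earlier columns, so
  \<open>es_step\<close> applies by strong induction along the columns.\<close>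

lemma es_all:
  assumes y: "y \<in> carrier_vec m"
  shows "es y"
proof -
  note B = sym_pd_minv[OF MB]
  let ?T = "minv MB * MA"
  have T: "?T \<in> carrier_mat m m" using B MA by simp
  obtain as where as: "char_poly ?T = (\<Prod>a\<leftarrow>as. [:- a, 1:])" using real_char_poly_splits by blast
  obtain U P Q where "schur_decomposition ?T as = (U, P, Q)" by (cases "schur_decomposition ?T as") auto
  from schur_decomposition[OF T as this] have sim: "similar_mat_wit ?T U P Q" and U: "upper_triangular U"
    by auto
  from similar_mat_witD2[OF T sim] have PQ: "P * Q = 1\<^sub>m m" "Q * P = 1\<^sub>m m" "?T = P * U * Q"
    and c: "U \<in> carrier_mat m m" "P \<in> carrier_mat m m" "Q \<in> carrier_mat m m" by auto
  have "?T * P = P * U"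
    unfolding PQ(3) using c PQ(1,2) assoc_mult_mat[of "P * U" m m Q m P m] by (simp del: assoc_mult_mat)
  have "MA = MB * minv MB * MA"
    using B(2) MA by simp
  also have "\<dots> = MB * ?T" by (rule assoc_mult_mat[OF MB'(1) B(1) MA(1)])
  also have "\<dots> * P = MB * (?T * P)" by (rule assoc_mult_mat[OF MB'(1) T c(2)])
  finally have "MA * P = MB * (P * U)" unfolding \<open>?T * P = P * U\<close> .
  have cols: "es (col P k)" if "k < m" for k
    using that
  proof (induction k rule: less_induct)
    case (less k)
    let ?r = "vsum m (\<lambda>i. U $$ (i, k) \<cdot>\<^sub>v col P i) {..<k}"
    have p: "col P k \<in> carrier_vec m" using c less by simp
    have es_r: "es ?r" using less by (intro es_vsum es_smult) auto
    have "MA *\<^sub>v col P k = col (MA * P) k"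
      using less.prems by (rule col_mult2[OF MA(1) c(2), symmetric])
    also have "\<dots> = col (MB * (P * U)) k" by (simp only: \<open>MA * P = MB * (P * U)\<close>)
    also have "\<dots> = MB *\<^sub>v col (P * U) k"
      using c less.prems by (intro col_mult2[OF MB'(1)]) auto
    also have "col (P * U) k = P *\<^sub>v col U k" using less.prems by (rule col_mult2[OF c(2,1)])
    finally have Ap: "MA *\<^sub>v col P k = MB *\<^sub>v (P *\<^sub>v col U k)" .
    have "P *\<^sub>v col U k = vsum m (\<lambda>i. col U k $ i \<cdot>\<^sub>v col P i) {..<m}"
      using c less by (intro mult_mat_vec_eq_vsum) auto
    also have "\<dots> = vsum m (\<lambda>i. U $$ (i, k) \<cdot>\<^sub>v col P i) {..k}"
    proof (rule eq_vecI)
      fix i assume "i < dim_vec (vsum m (\<lambda>i. U $$ (i, k) \<cdot>\<^sub>v col P i) {..k})"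
      then have i: "i < m" by (simp add: vsum_def)
      have U0: "U $$ (j, k) = 0" if "j < m" "\<not> j \<le> k" for j
        using U c that by (auto simp: upper_triangular_def)
      show "vsum m (\<lambda>i. col U k $ i \<cdot>\<^sub>v col P i) {..<m} $ i
          = vsum m (\<lambda>i. U $$ (i, k) \<cdot>\<^sub>v col P i) {..k} $ i"
      proof -
        have "(\<Sum>s<m. (col U k $ s \<cdot>\<^sub>v col P s) $ i) = (\<Sum>s\<le>k. (U $$ (s, k) \<cdot>\<^sub>v col P s) $ i)"
        proof (rule sum.mono_neutral_cong_right)
          show "\<forall>s\<in>{..<m} - {..k}. (col U k $ s \<cdot>\<^sub>v col P s) $ i = 0"
            using i c less.prems U0 by simp
        qed (use i c less.prems in auto)
        then show ?thesis using i by (simp add: vsum_def)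
      qed
    qed (simp add: vsum_def)
    also have "\<dots> = U $$ (k, k) \<cdot>\<^sub>v col P k + ?r"
      using vsum_insert[of "{..<k}" k "\<lambda>i. U $$ (i, k) \<cdot>\<^sub>v col P i" m] p
      by (simp add: lessThan_Suc_atMost[symmetric] lessThan_Suc)
    finally have "MA *\<^sub>v col P k = MB *\<^sub>v (U $$ (k, k) \<cdot>\<^sub>v col P k + ?r)" by (simp only: Ap)
    also have "\<dots> = U $$ (k, k) \<cdot>\<^sub>v (MB *\<^sub>v col P k) + MB *\<^sub>v ?r"
      using p MB' by (simp add: mult_add_distrib_mat_vec[of _ m m] mult_mat_vec[of _ m m]
          del: col_dim)
    finally show ?case by (rule es_step[OF p es_r])
  qed
  define q where "q = Q *\<^sub>v y"
  have "y = (P * Q) *\<^sub>v y" unfolding PQ(1) using y by simp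
  also have "\<dots> = P *\<^sub>v q" unfolding q_def using c y by (intro assoc_mult_mat_vec) auto
  also have "\<dots> = vsum m (\<lambda>i. q $ i \<cdot>\<^sub>v col P i) {..<m}"
    unfolding q_def using c y by (intro mult_mat_vec_eq_vsum) auto
  finally have "y = vsum m (\<lambda>i. q $ i \<cdot>\<^sub>v col P i) {..<m}" .
  moreover have "es (vsum m (\<lambda>i. q $ i \<cdot>\<^sub>v col P i) {..<m})"
    using cols by (intro es_vsum es_smult) auto
  ultimately show ?thesis by simp
qed

text \<open>The summands with eigenvalue below \<open>t\<close> are separated from the others. The
  groups are orthogonal for both forms, and on each nonzero group the quotient of the forms is a
  weighted mean of its eigenvalues.\<close>

lemma split_at:
  assumes y: "y \<in> carrier_vec m"
  shows "\<exists>yL yH. yL \<in> Y_L t MA MB \<and> yH \<in> Y_H t MA MB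
    \<and> yL \<in> carrier_vec m \<and> yH \<in> carrier_vec m \<and> y = yL + yH
    \<and> bil MA yL yH = 0 \<and> bil MB yL yH = 0
    \<and> bil MA yL yL \<le> t * bil MB yL yL \<and> t * bil MB yH yH \<le> bil MA yH yH"
proof -
  from es_all[OF y] obtain F z where F: "finite F" "\<And>l. ev l (z l)" "y = vsum m z F"
    unfolding eigsum_def by metis
  have c: "z k \<in> carrier_vec m" for k using F(2) by (auto simp: eigvec_pencil_def)
  define L where "L = {l \<in> F. l < t}"
  define K where "K = {l \<in> F. \<not> l < t}"
  have fin: "finite L" "finite K" "L \<inter> K = {}" "F = L \<union> K" using F by (auto simp: L_def K_def)
  have diag: "bil MB (vsum m z X) (vsum m z X) = (\<Sum>l\<in>X. bil MB (z l) (z l))"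
    "bil MA (vsum m z X) (vsum m z X) = (\<Sum>l\<in>X. l * bil MB (z l) (z l))" if "finite X" for X
  proof -
    have "(\<Sum>k\<in>X. bil MB (z l) (z k)) = bil MB (z l) (z l)" if "l \<in> X" for l
    proof -
      have "(\<Sum>k\<in>X. bil MB (z l) (z k)) = (\<Sum>k\<in>X. if k = l then bil MB (z l) (z l) else 0)"
        using ev_orthogonal(1)[OF F(2) F(2)] by (intro sum.cong) auto
      then show ?thesis using that \<open>finite X\<close> by simp
    qed
    moreover have "(\<Sum>k\<in>X. bil MA (z l) (z k)) = l * bil MB (z l) (z l)" if "l \<in> X" for l
    proof -
      have "(\<Sum>k\<in>X. bil MA (z l) (z k)) = (\<Sum>k\<in>X. if k = l then l * bil MB (z l) (z l) else 0)"
        using ev_orthogonal(2)[OF F(2) F(2)] ev_bil(1)[OF F(2) c] by (intro sum.cong) auto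
      then show ?thesis using that \<open>finite X\<close> by simp
    qed
    ultimately show "bil MB (vsum m z X) (vsum m z X) = (\<Sum>l\<in>X. bil MB (z l) (z l))"
      "bil MA (vsum m z X) (vsum m z X) = (\<Sum>l\<in>X. l * bil MB (z l) (z l))"
      using c by (auto simp: bil_vsum[OF MA(1)] bil_vsum[OF MB'(1)])
  qed
  have nn: "0 \<le> bil MB (z l) (z l)" for l
    using sym_pd_psd[OF MB] c by (auto simp: sym_psd_def)
  have orth: "bil MA (z l) (z k) = 0" "bil MB (z l) (z k) = 0" if "l \<in> L" "k \<in> K" for l k
  proof -
    have "l \<noteq> k" using that fin(3) by auto
    from ev_orthogonal[OF F(2) F(2) this]
    show "bil MA (z l) (z k) = 0" "bil MB (z l) (z k) = 0" by auto
  qed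
  show ?thesis
  proof (intro exI conjI)
    have dim: "dim_row MA = m" using MA(1) by simp
    have zL: "z l \<in> {y \<in> carrier_vec m. \<exists>l<t. MA *\<^sub>v y = l \<cdot>\<^sub>v (MB *\<^sub>v y)}" if "l \<in> L" for l
    proof -
      have "l < t" using that by (simp add: L_def)
      then show ?thesis using F(2)[of l] unfolding eigvec_pencil_def by blast
    qed
    have zK: "z l \<in> {y \<in> carrier_vec m. \<exists>l\<ge>t. MA *\<^sub>v y = l \<cdot>\<^sub>v (MB *\<^sub>v y)}" if "l \<in> K" for l
    proof -
      have "t \<le> l" using that by (simp add: K_def)
      then show ?thesis using F(2)[of l] unfolding eigvec_pencil_def by blast
    qed
    show "vsum m z L \<in> Y_L t MA MB" unfolding Y_L_def dim
      by (rule vsum_in_vspan[OF fin(1) zL]) auto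
    show "vsum m z K \<in> Y_H t MA MB" unfolding Y_H_def dim
      by (rule vsum_in_vspan[OF fin(2) zK]) auto
    show "y = vsum m z L + vsum m z K"
      using fin by (intro eq_vecI) (auto simp: F(3) vsum_def sum.union_disjoint)
    show "bil MA (vsum m z L) (vsum m z K) = 0" "bil MB (vsum m z L) (vsum m z K) = 0"
      using c orth by (simp_all add: bil_vsum[OF MA(1)] bil_vsum[OF MB'(1)])
    show "bil MA (vsum m z L) (vsum m z L) \<le> t * bil MB (vsum m z L) (vsum m z L)"
      unfolding diag[OF fin(1)] using nn by (auto simp: sum_distrib_left L_def mult.assoc intro!: sum_mono mult_right_mono)
    show "t * bil MB (vsum m z K) (vsum m z K) \<le> bil MA (vsum m z K) (vsum m z K)"
      unfolding diag[OF fin(2)] using nn by (auto simp: sum_distrib_left K_def mult.assoc intro!: sum_mono mult_right_mono)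
  qed auto
qed

end

section \<open>Two-level Schwarz preconditioners\<close>

lemma sym_pd_nonneg: "sym_pd n A \<Longrightarrow> x \<in> carrier_vec n \<Longrightarrow> 0 \<le> bil A x x"
  using sym_pd_psd by (auto simp: sym_psd_def)

text \<open>Expand the form at \<open>c x - y\<close> and divide by \<open>c\<close>. This weighted
  inequality takes the place of Cauchy-Schwarz: the parameter is chosen at each use, and no square
  roots appear.\<close>

lemma sym_psd_young:
  assumes A: "sym_psd n A" and x: "x \<in> carrier_vec n" and y: "y \<in> carrier_vec n" and c: "0 < c"
  shows "2 * bil A x y \<le> c * bil A x x + bil A y y / c"
proof -
  have A': "A \<in> carrier_mat n n" "A\<^sup>T = A" using A by (auto simp: sym_psd_def)
  have "0 \<le> bil A (c \<cdot>\<^sub>v x - y) (c \<cdot>\<^sub>v x - y)" using A x y by (auto simp: sym_psd_def)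
  also have "\<dots> = c * (c * bil A x x) - 2 * c * bil A x y + bil A y y"
    using A' x y bil_sym[OF A' x y] by (simp add: bil_linear[of A n n] algebra_simps)
  finally have "0 \<le> (c * (c * bil A x x) - 2 * c * bil A x y + bil A y y) / c" using c by simp
  then show ?thesis using c by (simp add: field_simps)
qed

text \<open>The Rayleigh quotient at an eigenvector equals \<open>l\<close>. The energy bound is
  assumed at this one vector only, which suits operators whose bound is known just on a
  subspace.\<close>

lemma pd_eigenvalue_bounds:
  assumes G: "G \<in> carrier_mat n n" "G\<^sup>T = G" and A: "sym_pd n A"
    and x: "x \<in> carrier_vec n" "x \<noteq> 0\<^sub>v n" and eq: "(G * A) *\<^sub>v x = l \<cdot>\<^sub>v x"
  shows "a * bil A x x \<le> bil G (A *\<^sub>v x) (A *\<^sub>v x) \<Longrightarrow> a \<le> l"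
    "bil G (A *\<^sub>v x) (A *\<^sub>v x) \<le> b * bil A x x \<Longrightarrow> l \<le> b"
proof -
  have A': "A \<in> carrier_mat n n" "A\<^sup>T = A" using A by (auto simp: sym_pd_def)
  have "bil G (A *\<^sub>v x) (A *\<^sub>v x) = bil A x ((G * A) *\<^sub>v x)"
    using A' G x by (simp add: bil_def sp_mult_mat_left[of A n n] assoc_mult_mat_vec[of G n n A n])
  then have e: "bil G (A *\<^sub>v x) (A *\<^sub>v x) = l * bil A x x"
    using A' x by (simp add: eq bil_smult_right[of A n n])
  have "0 < bil A x x" using A x by (simp add: sym_pd_def)
  then show "a * bil A x x \<le> bil G (A *\<^sub>v x) (A *\<^sub>v x) \<Longrightarrow> a \<le> l"
    "bil G (A *\<^sub>v x) (A *\<^sub>v x) \<le> b * bil A x x \<Longrightarrow> l \<le> b"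
    by (simp_all add: e)
qed

lemma cplx_eigenvalue_bounds:
  assumes G: "G \<in> carrier_mat n n" "G\<^sup>T = G" and A: "sym_pd n A"
    and ev: "cplx_eigenvalue (G * A) l"
  shows "l \<in> \<real>"
    "(\<And>x. x \<in> carrier_vec n \<Longrightarrow> a * bil A x x \<le> bil G (A *\<^sub>v x) (A *\<^sub>v x)) \<Longrightarrow> a \<le> Re l"
    "(\<And>x. x \<in> carrier_vec n \<Longrightarrow> bil G (A *\<^sub>v x) (A *\<^sub>v x) \<le> b * bil A x x) \<Longrightarrow> Re l \<le> b"
proof -
  show "l \<in> \<real>" using cplx_eigenvalue_sym_mult_pd(1)[OF assms] .
  obtain x where x: "x \<in> carrier_vec n" "x \<noteq> 0\<^sub>v n" "(G * A) *\<^sub>v x = Re l \<cdot>\<^sub>v x"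
    using cplx_eigenvalue_sym_mult_pd(2)[OF assms] by blast
  show "(\<And>x. x \<in> carrier_vec n \<Longrightarrow> a * bil A x x \<le> bil G (A *\<^sub>v x) (A *\<^sub>v x)) \<Longrightarrow> a \<le> Re l"
    using pd_eigenvalue_bounds(1)[OF G A x] x(1) by blast
  show "(\<And>x. x \<in> carrier_vec n \<Longrightarrow> bil G (A *\<^sub>v x) (A *\<^sub>v x) \<le> b * bil A x x) \<Longrightarrow> Re l \<le> b"
    using pd_eigenvalue_bounds(2)[OF G A x] x(1) by blast
qed

text \<open>If \<open>X P v = l v\<close> with \<open>l\<close> nonzero, then \<open>P v\<close> is
  nonzero and an eigenvector of \<open>P X P\<close>. Stated over a field because it is applied to
  complexified matrices.\<close>

lemma eigenvalue_compress:
  fixes X P :: "'a :: field mat"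
  assumes X: "X \<in> carrier_mat n n" and P: "P \<in> carrier_mat n n" "P * P = P"
    and ev: "eigenvalue (X * P) l" "l \<noteq> 0"
  shows "eigenvalue (P * (X * P)) l"
proof -
  from ev(1) obtain v where v: "v \<in> carrier_vec n" "v \<noteq> 0\<^sub>v n" "(X * P) *\<^sub>v v = l \<cdot>\<^sub>v v"
    using X P by (auto simp: eigenvalue_def eigenvector_def)
  define y where "y = P *\<^sub>v v"
  have y: "y \<in> carrier_vec n" using P v by (simp add: y_def)
  have Py: "P *\<^sub>v y = y"
    unfolding y_def using P v assoc_mult_mat_vec[of P n n P n v] by simp
  have Xy: "X *\<^sub>v y = l \<cdot>\<^sub>v v"
    unfolding y_def using X P v assoc_mult_mat_vec[of X n n P n v] by simp
  have "y \<noteq> 0\<^sub>v n"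
  proof
    assume "y = 0\<^sub>v n"
    then have lv: "l \<cdot>\<^sub>v v = 0\<^sub>v n" using Xy X by (simp add: mult_mat_zero_vec)
    have "v $ i = 0" if "i < n" for i
      using arg_cong[OF lv, of "\<lambda>x. x $ i"] that v(1) ev(2) by simp
    then have "v = 0\<^sub>v n" using v(1) by (intro eq_vecI) auto
    with v(2) show False by simp
  qed
  moreover have "(P * (X * P)) *\<^sub>v y = l \<cdot>\<^sub>v y"
  proof -
    have "(P * (X * P)) *\<^sub>v y = P *\<^sub>v (X *\<^sub>v (P *\<^sub>v y))"
      using P X y by (simp add: assoc_mult_mat_vec[of _ n n _ n])
    also have "\<dots> = l \<cdot>\<^sub>v y"
      unfolding Py Xy using P v by (simp add: mult_mat_vec[of _ n n] y_def)
    finally show ?thesis .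
  qed
  ultimately show ?thesis using X P y by (auto simp: eigenvalue_def eigenvector_def intro!: exI[of _ y])
qed

lemma cplx_eigenvalue_compress:
  assumes X: "X \<in> carrier_mat n n" and P: "P \<in> carrier_mat n n" "P * P = P"
    and ev: "cplx_eigenvalue (X * P) l" "l \<noteq> 0"
  shows "cplx_eigenvalue (P * (X * P)) l"
proof -
  let ?c = "map_mat complex_of_real"
  have XP: "?c (X * P) = ?c X * ?c P" by (rule of_real_hom.mat_hom_mult[OF X P(1)])
  have "?c (P * (X * P)) = ?c P * ?c (X * P)"
    using X P by (intro of_real_hom.mat_hom_mult) auto
  moreover have "?c (P * P) = ?c P * ?c P" by (rule of_real_hom.mat_hom_mult[OF P(1) P(1)])
  ultimately show ?thesis using eigenvalue_compress[of "?c X" n "?c P" l] X P ev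
    by (simp add: cplx_eigenvalue_def XP)
qed

lemma mat_eq_of_mult_vec:
  fixes X Y :: "'a :: semiring_1 mat"
  assumes "X \<in> carrier_mat p q" "Y \<in> carrier_mat p q" "\<And>u. u \<in> carrier_vec q \<Longrightarrow> X *\<^sub>v u = Y *\<^sub>v u"
  shows "X = Y"
proof (rule eq_matI)
  fix i j assume "i < dim_row Y" "j < dim_col Y"
  then have ij: "i < p" "j < q" using assms(2) by auto
  have "(X *\<^sub>v unit_vec q j) $ i = (Y *\<^sub>v unit_vec q j) $ i"
    using assms(3)[of "unit_vec q j"] by simp
  then show "X $$ (i, j) = Y $$ (i, j)"
    using ij assms(1,2) by (simp add: scalar_prod_right_unit)
qed (use assms in auto)

text \<open>The algebraic core, free of finite elements: the spectral choice of the coarse space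
  enters only through \<open>stable\<close>. The splitting of \<open>u\<close> into
  \<open>R0\<^sup>T z\<close> and the \<open>(R s)\<^sup>T y s\<close> is stated there in weak form,
  since it is only ever paired with vectors in the range of \<open>A\<close>.\<close>

locale two_level =
  fixes n k :: nat and A R0 :: "real mat" and I :: "nat set" and m :: "nat \<Rightarrow> nat"
    and R :: "nat \<Rightarrow> real mat" and \<tau> :: real and Nc :: nat and H :: "real mat"
  assumes A: "sym_pd n A" and I: "finite I"
    and R: "\<And>s. s \<in> I \<Longrightarrow> R s \<in> carrier_mat (m s) n"
    and local_pd: "\<And>s. s \<in> I \<Longrightarrow> sym_pd (m s) (R s * A * (R s)\<^sup>T)"
    and R0: "R0 \<in> carrier_mat k n" and coarse_pd: "sym_pd k (R0 * A * R0\<^sup>T)"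
    and H: "H = msum n n (\<lambda>s. (R s)\<^sup>T * minv (R s * A * (R s)\<^sup>T) * R s) I"
    and colors: "\<exists>C :: nat \<Rightarrow> nat set. (\<Union>j\<in>{1..Nc}. C j) = I
     \<and> (\<forall>j\<in>{1..Nc}. \<forall>s\<in>C j. \<forall>t\<in>C j. s \<noteq> t \<longrightarrow>
          R s * A * (R t)\<^sup>T = 0\<^sub>m (dim_row (R s)) (dim_row (R t)))"
    and Nc: "Nc \<ge> 1" and tau: "\<tau> > 1"
    and stable: "\<And>u. u \<in> carrier_vec n \<Longrightarrow> \<exists>z y. z \<in> carrier_vec k
      \<and> (\<forall>s\<in>I. y s \<in> carrier_vec (m s))
      \<and> (\<forall>f\<in>carrier_vec n. sp u f = sp z (R0 *\<^sub>v f) + (\<Sum>s\<in>I. sp (y s) (R s *\<^sub>v f)))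
      \<and> (\<Sum>s\<in>I. bil (R s * A * (R s)\<^sup>T) (y s) (y s)) \<le> \<tau> * bil A u u"
begin

abbreviation "B s \<equiv> R s * A * (R s)\<^sup>T"
abbreviation "q u \<equiv> bil A u u"
abbreviation "h u \<equiv> bil H (A *\<^sub>v u) (A *\<^sub>v u)"
abbreviation "K \<equiv> coarse_solve A R0"
abbreviation "P \<equiv> coarse_proj n A R0"

section \<open>Energy of the one-level operator\<close>

lemma A': "A \<in> carrier_mat n n" "A\<^sup>T = A"
  using A by (auto simp: sym_pd_def)

lemma Au: "u \<in> carrier_vec n \<Longrightarrow> A *\<^sub>v u \<in> carrier_vec n"
  using A' by simp

lemma H_carrier: "H \<in> carrier_mat n n"
  by (simp add: H msum_def)

lemma local_carrier: "s \<in> I \<Longrightarrow> (R s)\<^sup>T * minv (B s) * R s \<in> carrier_mat n n"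
  by (intro mult_carrier_mat[of _ n "m s"] mult_carrier_mat[of "(R s)\<^sup>T" n "m s"])
    (auto intro: R sym_pd_minv(1)[OF local_pd])

lemma bil_H:
  assumes "f \<in> carrier_vec n" "g \<in> carrier_vec n"
  shows "bil H f g = (\<Sum>s\<in>I. bil (minv (B s)) (R s *\<^sub>v f) (R s *\<^sub>v g))"
proof -
  have "bil H f g = (\<Sum>s\<in>I. bil ((R s)\<^sup>T * minv (B s) * R s) f g)"
    unfolding H by (rule bil_msum) (use assms local_carrier in auto)
  also have "\<dots> = (\<Sum>s\<in>I. bil (minv (B s)) (R s *\<^sub>v f) (R s *\<^sub>v g))"
    by (rule sum.cong[OF refl]) (rule bil_conj[OF sym_pd_minv(1)[OF local_pd] R assms])
  finally show ?thesis .
qed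

lemma H_sym: "H\<^sup>T = H"
proof (rule eq_matI)
  fix i j assume ij: "i < dim_row H" "j < dim_col H"
  have sym: "((R s)\<^sup>T * minv (B s) * R s) $$ (j, i) = ((R s)\<^sup>T * minv (B s) * R s) $$ (i, j)" if "s \<in> I" for s
  proof -
    let ?X = "(R s)\<^sup>T * minv (B s) * R s"
    note b = sym_pd_minv[OF local_pd[OF that]]
    have "?X\<^sup>T = ?X"
      using R[OF that] b transpose_mult[of "(R s)\<^sup>T" n "m s" "minv (B s)" "m s"]
        transpose_mult[of "(R s)\<^sup>T * minv (B s)" n "m s" "R s" n] by simp
    moreover have "?X \<in> carrier_mat n n" using R[OF that] b(1) by simp
    ultimately show ?thesis using ij H_carrier
      by (metis carrier_matD(1,2) index_transpose_mat(1))
  qed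
  show "H\<^sup>T $$ (i, j) = H $$ (i, j)"
    using ij H_carrier sym by (simp add: H msum_def)
qed (use H_carrier in auto)

lemma minv_local:
  assumes "s \<in> I" "x \<in> carrier_vec (m s)"
  shows "minv (B s) *\<^sub>v x \<in> carrier_vec (m s)" "B s *\<^sub>v (minv (B s) *\<^sub>v x) = x"
proof -
  note b = sym_pd_minv[OF local_pd[OF assms(1)]]
  have "B s \<in> carrier_mat (m s) (m s)" using local_pd[OF assms(1)] by (simp add: sym_pd_def)
  then show "minv (B s) *\<^sub>v x \<in> carrier_vec (m s)" "B s *\<^sub>v (minv (B s) *\<^sub>v x) = x"
    using b assms(2) assoc_mult_mat_vec[of "B s" "m s" "m s" "minv (B s)" "m s" x] by simp_all
qed

text \<open>Young's inequality in the inner product of \<open>B s\<close>, applied to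
  \<open>y s\<close> and to the local solution with right-hand side \<open>R s f\<close>; the
  energies of the latter add up to \<open>bil H f f\<close>.\<close>

lemma young_local:
  assumes f: "f \<in> carrier_vec n" and y: "\<And>s. s \<in> I \<Longrightarrow> y s \<in> carrier_vec (m s)" and c: "0 < c"
  shows "2 * (\<Sum>s\<in>I. sp (y s) (R s *\<^sub>v f)) \<le> c * (\<Sum>s\<in>I. bil (B s) (y s) (y s)) + bil H f f / c"
proof -
  have "2 * sp (y s) (R s *\<^sub>v f)
      \<le> c * bil (B s) (y s) (y s) + bil (minv (B s)) (R s *\<^sub>v f) (R s *\<^sub>v f) / c" if s: "s \<in> I" for s
  proof -
    let ?g = "minv (B s) *\<^sub>v (R s *\<^sub>v f)"
    have Rf: "R s *\<^sub>v f \<in> carrier_vec (m s)" using R[OF s] f by simp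
    note g = minv_local[OF s Rf]
    have "2 * bil (B s) (y s) ?g \<le> c * bil (B s) (y s) (y s) + bil (B s) ?g ?g / c"
      using sym_psd_young[OF sym_pd_psd[OF local_pd[OF s]] y[OF s] g(1) c] .
    moreover have "bil (B s) ?g ?g = bil (minv (B s)) (R s *\<^sub>v f) (R s *\<^sub>v f)"
      unfolding bil_def g(2) using g(1) Rf by (rule comm_scalar_prod)
    ultimately show ?thesis by (simp add: bil_def[of "B s" "y s" ?g] g(2))
  qed
  then have "(\<Sum>s\<in>I. 2 * sp (y s) (R s *\<^sub>v f))
      \<le> (\<Sum>s\<in>I. c * bil (B s) (y s) (y s) + bil (minv (B s)) (R s *\<^sub>v f) (R s *\<^sub>v f) / c)"
    by (rule sum_mono)
  then show ?thesis
    using f by (simp add: bil_H sum.distrib sum_distrib_left sum_divide_distrib)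
qed

text \<open>Within one colour the local solution operators are \<open>A\<close>-orthogonal projections with pairwise
  \<open>A\<close>-orthogonal ranges, so their sum is again such a projection and has norm at most one.\<close>

lemma h_le:
  assumes u: "u \<in> carrier_vec n"
  shows "h u \<le> Nc * q u"
proof -
  obtain C :: "nat \<Rightarrow> nat set" where C: "(\<Union>j\<in>{1..Nc}. C j) = I"
    "\<And>j s t. j \<in> {1..Nc} \<Longrightarrow> s \<in> C j \<Longrightarrow> t \<in> C j \<Longrightarrow> s \<noteq> t \<Longrightarrow>
      R s * A * (R t)\<^sup>T = 0\<^sub>m (dim_row (R s)) (dim_row (R t))"
    using colors by metis
  define f where "f = A *\<^sub>v u"
  have f: "f \<in> carrier_vec n" using Au[OF u] by (simp add: f_def)
  define g where "g s = minv (B s) *\<^sub>v (R s *\<^sub>v f)" for s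
  \<comment> \<open>The local solution extended by zero, that is the \<open>A\<close>-orthogonal
    projection of \<open>u\<close> onto the range of \<open>(R s)\<^sup>T\<close>; its energy is the
    \<open>s\<close>-th term of \<open>h u\<close>.\<close>
  define v where "v s = (R s)\<^sup>T *\<^sub>v g s" for s
  define e where "e s = bil (minv (B s)) (R s *\<^sub>v f) (R s *\<^sub>v f)" for s
  have Rf: "R s *\<^sub>v f \<in> carrier_vec (m s)" if "s \<in> I" for s using R[OF that] f by simp
  have g: "g s \<in> carrier_vec (m s)" "B s *\<^sub>v g s = R s *\<^sub>v f" if "s \<in> I" for s
    using minv_local[OF that Rf[OF that]] by (auto simp: g_def)
  have v: "v s \<in> carrier_vec n" if "s \<in> I" for s using R[OF that] g(1)[OF that] by (simp add: v_def)
  have vAx: "bil A (v s) x = sp (g s) (R s *\<^sub>v (A *\<^sub>v x))" if "s \<in> I" "x \<in> carrier_vec n" for s x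
    using R[OF that(1)] g(1)[OF that(1)] Au[OF that(2)]
    by (simp add: bil_def v_def sp_mult_mat_left[of _ n "m s"])
  have ev: "bil A (v s) u = e s" if "s \<in> I" for s
    using vAx[OF that u] comm_scalar_prod[OF g(1)[OF that] Rf[OF that]]
    by (simp add: f_def[symmetric] e_def bil_def g_def)
  have vv: "bil A (v s) (v t) = sp (g s) ((R s * A * (R t)\<^sup>T) *\<^sub>v g t)" if "s \<in> I" "t \<in> I" for s t
    using vAx[OF that(1) v[OF that(2)]] R[OF that(1)] R[OF that(2)] A' g(1)[OF that(2)]
    by (simp add: v_def assoc_mult_mat_vec[of A n n "(R t)\<^sup>T" "m t"]
        assoc_mult_mat_vec[of "R s" "m s" n "A * (R t)\<^sup>T" "m t"])
  have vs: "bil A (v s) (v s) = e s" if "s \<in> I" for s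
    using vv[OF that that] g[OF that] comm_scalar_prod[OF g(1)[OF that] Rf[OF that]]
    by (simp add: e_def bil_def g_def)
  have e0: "0 \<le> e s" if "s \<in> I" for s
    using vs[OF that] sym_pd_nonneg[OF A v[OF that]] by simp
  have color: "(\<Sum>s\<in>C j. e s) \<le> q u" if j: "j \<in> {1..Nc}" for j
  proof -
    have CI: "C j \<subseteq> I" using C(1) j by blast
    then have fin: "finite (C j)" using I finite_subset by blast
    define w where "w = vsum n v (C j)"
    have w: "w \<in> carrier_vec n" by (simp add: w_def)
    have vc: "\<And>s. s \<in> C j \<Longrightarrow> v s \<in> carrier_vec n" using v CI by blast
    have vst: "bil A (v s) (v t) = (if t = s then e s else 0)" if "s \<in> C j" "t \<in> C j" for s t
    proof (cases "t = s")
      case False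
      have st: "s \<in> I" "t \<in> I" using CI that by auto
      have "R s * A * (R t)\<^sup>T = 0\<^sub>m (m s) (m t)"
        using C(2)[OF j that] False R[OF st(1)] R[OF st(2)] by auto
      moreover have "0\<^sub>m (m s) (m t) *\<^sub>v g t = 0\<^sub>v (m s)"
        using g(1)[OF st(2)] by (intro eq_vecI) auto
      ultimately show ?thesis using vv[OF st] g(1)[OF st(1)] False by simp
    qed (use vs CI that in auto)
    have ww: "bil A w w = (\<Sum>s\<in>C j. e s)"
    proof -
      have "bil A w w = (\<Sum>s\<in>C j. \<Sum>t\<in>C j. bil A (v s) (v t))"
        unfolding w_def by (rule bil_vsum[OF A'(1)]) (use vc in auto)
      also have "\<dots> = (\<Sum>s\<in>C j. \<Sum>t\<in>C j. if t = s then e s else 0)"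
        using vst by (intro sum.cong refl) auto
      finally show ?thesis using fin by simp
    qed
    have "bil A w u = (\<Sum>s\<in>C j. bil A (v s) u)"
      unfolding bil_def w_def using Au[OF u] vc by (rule sp_vsum_left)
    then have wu: "bil A w u = (\<Sum>s\<in>C j. e s)" using ev CI by (simp add: subset_iff)
    \<comment> \<open>The energy of \<open>w\<close> and its pairing with \<open>u\<close> both
      equal the sum of the \<open>e s\<close>, so the expansion leaves \<open>q u\<close> minus that
      sum.\<close>
    have "0 \<le> bil A (u - w) (u - w)" using sym_pd_nonneg[OF A] u w by simp
    also have "\<dots> = q u - 2 * bil A w u + bil A w w"
      using u w A' bil_sym[OF A' u w] by (simp add: bil_linear[of A n n])
    finally show ?thesis by (simp add: ww wu)
  qed
  have "h u = (\<Sum>s\<in>I. e s)" unfolding f_def[symmetric] bil_H[OF f f] e_def ..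
  also have "\<dots> = (\<Sum>s\<in>(\<Union>j\<in>{1..Nc}. C j). e s)" by (simp only: C(1))
  \<comment> \<open>Colours may overlap; a subdomain counted more than once only enlarges the
    right-hand side, as \<open>e s\<close> is nonnegative.\<close>
  also have "\<dots> \<le> (\<Sum>j\<in>{1..Nc}. \<Sum>s\<in>C j. e s)"
  proof -
    have "finite J \<Longrightarrow> J \<subseteq> {1..Nc} \<Longrightarrow> (\<Sum>s\<in>(\<Union>j\<in>J. C j). e s) \<le> (\<Sum>j\<in>J. \<Sum>s\<in>C j. e s)" for J
    proof (induction J rule: finite_induct)
      case (insert j J)
      have sub: "C j \<subseteq> I" "(\<Union>j\<in>J. C j) \<subseteq> I" using C(1) insert.prems by blast+
      then have fin: "finite (C j)" "finite (\<Union>j\<in>J. C j)" using I finite_subset by blast+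
      have "(\<Sum>s\<in>C j \<union> (\<Union>j\<in>J. C j). e s) = sum e (C j) + sum e (\<Union>j\<in>J. C j) - sum e (C j \<inter> (\<Union>j\<in>J. C j))"
        by (rule sum_Un[OF fin])
      moreover have "0 \<le> sum e (C j \<inter> (\<Union>j\<in>J. C j))"
        using e0 sub(1) by (intro sum_nonneg) auto
      ultimately show ?case using insert by simp
    qed simp
    then show ?thesis by simp
  qed
  also have "\<dots> \<le> (\<Sum>j\<in>{1..Nc}. q u)" using color by (intro sum_mono) auto
  finally show ?thesis by simp
qed

section \<open>The coarse projection\<close>

lemma K_carrier: "K \<in> carrier_mat n n"
  using R0 sym_pd_minv(1)[OF coarse_pd] by (simp add: coarse_solve_def)

lemma K_sym: "K\<^sup>T = K"
  using R0 sym_pd_minv[OF coarse_pd] transpose_mult[of "R0\<^sup>T" n k "minv (R0 * A * R0\<^sup>T)" k]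
    transpose_mult[of "R0\<^sup>T * minv (R0 * A * R0\<^sup>T)" n k "R0" n]
  by (simp add: coarse_solve_def)

lemma P_carrier: "P \<in> carrier_mat n n"
  unfolding coarse_proj_def by (rule minus_carrier_mat[OF mult_carrier_mat[OF K_carrier A'(1)]])

text \<open>The \<open>A\<close>-orthogonal projection of \<open>u\<close> onto the coarse space,
  that is \<open>(I - P) u\<close>; \<open>cvec\<close> holds its coordinates with respect to the
  rows of \<open>R0\<close>.\<close>

definition cpart :: "real Matrix.vec \<Rightarrow> real Matrix.vec" where
  "cpart u = K *\<^sub>v (A *\<^sub>v u)"

definition cvec :: "real Matrix.vec \<Rightarrow> real Matrix.vec" where
  "cvec u = minv (R0 * A * R0\<^sup>T) *\<^sub>v (R0 *\<^sub>v (A *\<^sub>v u))"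

lemma cvec:
  assumes "u \<in> carrier_vec n"
  shows "cvec u \<in> carrier_vec k" "cpart u = R0\<^sup>T *\<^sub>v cvec u"
  using R0 sym_pd_minv(1)[OF coarse_pd] Au[OF assms]
  by (auto simp: cvec_def cpart_def coarse_solve_def
      assoc_mult_mat_vec[of "R0\<^sup>T * minv (R0 * A * R0\<^sup>T)" n k R0 n]
      assoc_mult_mat_vec[of "R0\<^sup>T" n k "minv (R0 * A * R0\<^sup>T)" k] simp del: assoc_mult_mat)

lemma cpart_carrier: "u \<in> carrier_vec n \<Longrightarrow> cpart u \<in> carrier_vec n"
  using K_carrier Au by (simp add: cpart_def)

lemma P_eq:
  assumes "u \<in> carrier_vec n"
  shows "P *\<^sub>v u = u - cpart u"
proof -
  have "P *\<^sub>v u = 1\<^sub>m n *\<^sub>v u - (K * A) *\<^sub>v u"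
    unfolding coarse_proj_def using K_carrier A' assms by (intro minus_mult_distrib_mat_vec) auto
  then show ?thesis using K_carrier A' assms by (simp add: cpart_def assoc_mult_mat_vec[of K n n A n])
qed

text \<open>Galerkin orthogonality of the residual. Together with \<open>P_fix\<close> it shows that
  the equation \<open>R0 A w = 0\<close> describes exactly the range of \<open>P\<close>; later
  lemmas take this equation as their hypothesis.\<close>

lemma R0_A_P:
  assumes "u \<in> carrier_vec n"
  shows "R0 *\<^sub>v (A *\<^sub>v (P *\<^sub>v u)) = 0\<^sub>v k"
proof -
  let ?S = "R0 * A * R0\<^sup>T"
  have S: "?S \<in> carrier_mat k k" using R0 A' by simp
  have "R0 *\<^sub>v (A *\<^sub>v cpart u) = ?S *\<^sub>v cvec u"
    using R0 A' cvec[OF assms]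
    by (simp add: assoc_mult_mat_vec[of "R0 * A" k n "R0\<^sup>T" k] assoc_mult_mat_vec[of R0 k n A n]
        del: assoc_mult_mat)
  also have "\<dots> = R0 *\<^sub>v (A *\<^sub>v u)"
    unfolding cvec_def using S sym_pd_minv[OF coarse_pd] R0 Au[OF assms]
      assoc_mult_mat_vec[of ?S k k "minv ?S" k "R0 *\<^sub>v (A *\<^sub>v u)"] by (simp del: assoc_mult_mat)
  finally show ?thesis
    using R0 A' assms cpart_carrier[OF assms]
    by (simp add: P_eq mult_minus_distrib_mat_vec[of A n n] mult_minus_distrib_mat_vec[of R0 k n])
qed

lemma coarse_orth:
  assumes "z \<in> carrier_vec k" "w \<in> carrier_vec n" "R0 *\<^sub>v (A *\<^sub>v w) = 0\<^sub>v k"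
  shows "bil A (R0\<^sup>T *\<^sub>v z) w = 0"
  using assms R0 Au[OF assms(2)] by (simp add: bil_def sp_mult_mat_left[of _ n k])

lemma P_fix:
  assumes "w \<in> carrier_vec n" "R0 *\<^sub>v (A *\<^sub>v w) = 0\<^sub>v k"
  shows "P *\<^sub>v w = w"
proof -
  have "cvec w = 0\<^sub>v k" using assms(2) sym_pd_minv(1)[OF coarse_pd]
    by (simp add: cvec_def mult_mat_zero_vec[of _ k k] del: assoc_mult_mat)
  then have "cpart w = 0\<^sub>v n" using cvec[OF assms(1)] R0 by (simp add: mult_mat_zero_vec[of _ n k])
  then show ?thesis using P_eq[OF assms(1)] assms(1) by (auto intro!: eq_vecI)
qed

lemma P_vec:
  assumes "u \<in> carrier_vec n"
  shows "P *\<^sub>v u \<in> carrier_vec n" "P *\<^sub>v (P *\<^sub>v u) = P *\<^sub>v u"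
  using P_carrier assms P_fix[OF _ R0_A_P[OF assms]] by auto

lemma P_idem: "P * P = P"
proof (rule mat_eq_of_mult_vec)
  fix u :: "real Matrix.vec" assume "u \<in> carrier_vec n"
  then show "(P * P) *\<^sub>v u = P *\<^sub>v u"
    using P_vec P_carrier by (simp add: assoc_mult_mat_vec[of P n n P n])
qed (use P_carrier in auto)

text \<open>\<open>P\<close> is self-adjoint for \<open>bil A\<close>; this moves the factor
  \<open>P\<^sup>T\<close> of the hybrid operator onto the vector.\<close>

lemma P_adjoint:
  assumes "u \<in> carrier_vec n"
  shows "P\<^sup>T *\<^sub>v (A *\<^sub>v u) = A *\<^sub>v (P *\<^sub>v u)"
proof -
  have "P\<^sup>T = 1\<^sub>m n - A * K"
    using K_carrier A' K_sym transpose_mult[of K n n A n] transpose_minus[of "1\<^sub>m n" n n "K * A"]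
    by (simp add: coarse_proj_def)
  then have "P\<^sup>T *\<^sub>v (A *\<^sub>v u) = 1\<^sub>m n *\<^sub>v (A *\<^sub>v u) - (A * K) *\<^sub>v (A *\<^sub>v u)"
    using K_carrier A' Au[OF assms] by (simp add: minus_mult_distrib_mat_vec[of _ n n] del: one_mult_mat_vec)
  also have "\<dots> = A *\<^sub>v u - A *\<^sub>v cpart u"
    using K_carrier A' Au[OF assms] by (simp add: cpart_def assoc_mult_mat_vec[of A n n K n])
  also have "\<dots> = A *\<^sub>v (P *\<^sub>v u)"
    using A' assms cpart_carrier[OF assms] by (simp add: P_eq mult_minus_distrib_mat_vec[of A n n])
  finally show ?thesis .
qed

text \<open>\<open>P u\<close> and \<open>cpart u\<close> are \<open>A\<close>-orthogonal. In the
  second equation \<open>K A u\<close> is \<open>cpart u\<close>, whose pairing with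
  \<open>A u\<close> sees only the coarse part of \<open>u\<close>.\<close>

lemma pythagoras:
  assumes u: "u \<in> carrier_vec n"
  shows "q u = q (P *\<^sub>v u) + q (cpart u)" "bil K (A *\<^sub>v u) (A *\<^sub>v u) = q (cpart u)"
proof -
  let ?w = "P *\<^sub>v u" and ?c = "cpart u"
  have w: "?w \<in> carrier_vec n" and c: "?c \<in> carrier_vec n" using P_vec(1) cpart_carrier u by auto
  have eq: "u = ?w + ?c" using u c by (auto simp: P_eq intro!: eq_vecI)
  have cw: "bil A ?c ?w = 0"
    using coarse_orth[OF cvec(1)[OF u] w R0_A_P[OF u]] cvec(2)[OF u] by simp
  have "q u = bil A (?w + ?c) (?w + ?c)" using eq by simp
  also have "\<dots> = q ?w + q ?c"
    using w c A' cw bil_sym[OF A' c w] by (simp add: bil_linear[of A n n])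
  finally show "q u = q ?w + q ?c" .
  have "bil K (A *\<^sub>v u) (A *\<^sub>v u) = sp ?c (A *\<^sub>v u)"
    unfolding bil_def cpart_def[symmetric] using Au[OF u] c by (rule comm_scalar_prod)
  also have "\<dots> = bil A ?c (?w + ?c)" using eq by (simp add: bil_def)
  finally show "bil K (A *\<^sub>v u) (A *\<^sub>v u) = q ?c"
    using w c A' cw by (simp add: bil_linear[of A n n])
qed

section \<open>Lower energy bounds from the stable splitting\<close>

lemma q_nonneg: "u \<in> carrier_vec n \<Longrightarrow> 0 \<le> q u"
  using sym_pd_nonneg[OF A] .

text \<open>Testing the splitting of \<open>w\<close> with \<open>A w\<close> removes its coarse
  component, because \<open>R0 A w = 0\<close>.\<close>

lemma stable_on_range:
  assumes w: "w \<in> carrier_vec n" and Rw: "R0 *\<^sub>v (A *\<^sub>v w) = 0\<^sub>v k"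
  shows "q w \<le> \<tau> * h w"
proof -
  obtain z y where z: "z \<in> carrier_vec k" and y: "\<And>s. s \<in> I \<Longrightarrow> y s \<in> carrier_vec (m s)"
    and eq: "\<And>f. f \<in> carrier_vec n \<Longrightarrow> sp w f = sp z (R0 *\<^sub>v f) + (\<Sum>s\<in>I. sp (y s) (R s *\<^sub>v f))"
    and le: "(\<Sum>s\<in>I. bil (B s) (y s) (y s)) \<le> \<tau> * q w"
    using stable[OF w] by (elim exE conjE) (rule that, auto)
  have "2 * q w = 2 * (\<Sum>s\<in>I. sp (y s) (R s *\<^sub>v (A *\<^sub>v w)))"
    using eq[OF Au[OF w]] z Rw by (simp add: bil_def)
  \<comment> \<open>With weight \<open>1 / \<tau>\<close> the local energies cost one
    \<open>q w\<close>, which is absorbed by the two on the left.\<close>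
  also have "\<dots> \<le> (1 / \<tau>) * (\<Sum>s\<in>I. bil (B s) (y s) (y s)) + h w / (1 / \<tau>)"
    using tau by (intro young_local[OF Au[OF w] y]) auto
  also have "\<dots> \<le> (1 / \<tau>) * (\<tau> * q w) + h w / (1 / \<tau>)"
    using tau le by (intro add_right_mono mult_left_mono) auto
  finally show ?thesis using tau by (simp add: mult.commute)
qed

text \<open>The splitting \<open>P u = e + v\<close> comes with no bound on its coarse component
  \<open>e\<close>; one is recovered by applying \<open>h_le\<close> to the local remainder
  \<open>v\<close>. In the constant, \<open>2 * Nc * \<tau>\<close> pays for \<open>e\<close> and
  one further \<open>\<tau>\<close> for the local energies.\<close>

lemma ad_lower:
  assumes u: "u \<in> carrier_vec n"
  shows "q u \<le> (1 + 2 * real Nc) * \<tau> * (h u + q (cpart u))"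
proof -
  let ?w = "P *\<^sub>v u" and ?c = "cpart u" and ?C = "(1 + 2 * real Nc) * \<tau>"
  have w: "?w \<in> carrier_vec n" and c: "?c \<in> carrier_vec n" using P_vec(1) cpart_carrier u by auto
  note Rw = R0_A_P[OF u]
  have C: "?C > 2"
  proof -
    have "3 * 1 < ?C" using Nc tau by (intro mult_le_less_imp_less) auto
    then show ?thesis by simp
  qed
  obtain z y where z: "z \<in> carrier_vec k" and y: "\<And>s. s \<in> I \<Longrightarrow> y s \<in> carrier_vec (m s)"
    and eq: "\<And>f. f \<in> carrier_vec n \<Longrightarrow> sp ?w f = sp z (R0 *\<^sub>v f) + (\<Sum>s\<in>I. sp (y s) (R s *\<^sub>v f))"
    and le: "(\<Sum>s\<in>I. bil (B s) (y s) (y s)) \<le> \<tau> * q ?w"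
    using stable[OF w] by (elim exE conjE) (rule that, auto)
  let ?Y = "\<Sum>s\<in>I. bil (B s) (y s) (y s)"
  define e where "e = R0\<^sup>T *\<^sub>v z"
  define v where "v = ?w - e"
  have e: "e \<in> carrier_vec n" using R0 z by (simp add: e_def)
  have v: "v \<in> carrier_vec n" using w e by (simp add: v_def)
  have ef: "sp e f = sp z (R0 *\<^sub>v f)" if "f \<in> carrier_vec n" for f
    using R0 z that by (simp add: e_def sp_mult_mat_left[of _ n k])
  have vf: "sp v f = (\<Sum>s\<in>I. sp (y s) (R s *\<^sub>v f))" if "f \<in> carrier_vec n" for f
    using eq[OF that] ef[OF that] w e that by (simp add: v_def minus_scalar_prod_distrib[of _ n])
  have ew: "bil A e ?w = 0" unfolding e_def by (rule coarse_orth[OF z w Rw])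
  have cw: "bil A ?c ?w = 0"
    using coarse_orth[OF cvec(1)[OF u] w Rw] cvec(2)[OF u] by simp
  \<comment> \<open>As \<open>e\<close> and \<open>P u\<close> are \<open>A\<close>-orthogonal, a
    bound on \<open>q v\<close> is also a bound on \<open>q e\<close>.\<close>
  have qv: "q v = q ?w + q e"
    unfolding v_def using w e A' ew bil_sym[OF A' e w] by (simp add: bil_linear[of A n n])
  have "2 * q v = 2 * (\<Sum>s\<in>I. sp (y s) (R s *\<^sub>v (A *\<^sub>v v)))"
    using vf[OF Au[OF v]] by (simp add: bil_def)
  \<comment> \<open>With weight \<open>Nc\<close>, the bound \<open>h v \<le> Nc * q v\<close> turns
    the last term into one \<open>q v\<close>, absorbed by the two on the left.\<close>
  also have "\<dots> \<le> Nc * ?Y + h v / Nc"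
    using Nc by (intro young_local[OF Au[OF v] y]) auto
  also have "h v / Nc \<le> q v" using h_le[OF v] Nc by (simp add: divide_le_eq mult.commute)
  finally have "q v \<le> Nc * ?Y" by simp
  also have "\<dots> \<le> Nc * (\<tau> * q ?w)" using le by (intro mult_left_mono) auto
  finally have qe: "q e \<le> Nc * (\<tau> * q ?w) - q ?w" using qv by simp
  let ?u0 = "?c + e"
  have u0: "?u0 \<in> carrier_vec n" using c e by simp
  have ueq: "u = ?u0 + v" using u c e w by (auto simp: v_def P_eq intro!: eq_vecI)
  \<comment> \<open>Half of the parallelogram identity; the factor 2 of the constant arises
    here.\<close>
  have "0 \<le> q (?c - e)" using q_nonneg c e by simp
  then have q0: "q ?u0 \<le> 2 * q ?c + 2 * q e"
    using c e A' bil_sym[OF A' c e] by (simp add: bil_linear[of A n n])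
  have u0w: "bil A ?u0 ?w = 0" using c e w A' cw ew by (simp add: bil_linear[of A n n])
  \<comment> \<open>Both parts of \<open>?u0\<close> are \<open>A\<close>-orthogonal to
    \<open>?w\<close>, so pairing \<open>?u0\<close> with \<open>u\<close> is the same as pairing it
    with \<open>?c\<close>.\<close>
  have "u = ?w + ?c" using u c by (auto simp: P_eq intro!: eq_vecI)
  then have "bil A ?u0 u = bil A ?u0 (?w + ?c)" by (rule arg_cong)
  also have "\<dots> = bil A ?u0 ?c" using u0w bil_add_right[OF A'(1) u0 w c] by simp
  finally have u0u: "bil A ?u0 u = bil A ?u0 ?c" .
  have y1: "2 * bil A ?u0 ?c \<le> (1 / ?C) * q ?u0 + q ?c / (1 / ?C)"
    using C by (intro sym_psd_young[OF sym_pd_psd[OF A] u0 c]) auto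
  have y2: "2 * bil A v u \<le> (1 / ?C) * ?Y + h u / (1 / ?C)"
    unfolding bil_def[of A] vf[OF Au[OF u]] using C by (intro young_local[OF Au[OF u] y]) auto
  have "q u = bil A (?u0 + v) u" using ueq by (rule arg_cong[where f = "\<lambda>x. bil A x u"])
  also have "\<dots> = bil A ?u0 u + bil A v u" using bil_add_left[OF A'(1) u0 v u] .
  finally have "2 * q u = 2 * bil A ?u0 ?c + 2 * bil A v u" using u0u by simp
  also have "\<dots> \<le> ((1 / ?C) * q ?u0 + q ?c / (1 / ?C)) + ((1 / ?C) * ?Y + h u / (1 / ?C))"
    using y1 y2 by (rule add_mono)
  also have "\<dots> = (1 / ?C) * (q ?u0 + ?Y) + ?C * (h u + q ?c)"
    by (simp only: distrib_left divide_divide_eq_right div_by_1 mult.commute ac_simps)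
  finally have "2 * q u \<le> (1 / ?C) * (q ?u0 + ?Y) + ?C * (h u + q ?c)" .
  moreover have "(1 / ?C) * (q ?u0 + ?Y) \<le> q u"
  proof -
    \<comment> \<open>The negative multiple of \<open>q ?w\<close> inherited from the bound on
      \<open>e\<close> is discarded, and \<open>2 * Nc * \<tau> + \<tau>\<close> is
      \<open>?C\<close>. The coefficient 2 of \<open>q ?c\<close> is dominated since
      \<open>?C > 2\<close>.\<close>
    have "q ?u0 + ?Y \<le> 2 * q ?c + 2 * (Nc * (\<tau> * q ?w) - q ?w) + \<tau> * q ?w"
      by (intro add_mono[OF order_trans[OF q0] le] add_mono mult_left_mono qe) auto
    also have "\<dots> \<le> 2 * q ?c + ?C * q ?w" using q_nonneg[OF w] by (simp add: algebra_simps)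
    also have "\<dots> \<le> ?C * q ?c + ?C * q ?w"
      using C q_nonneg[OF c] by (intro add_right_mono mult_right_mono) auto
    also have "\<dots> = ?C * q u" using pythagoras(1)[OF u] by (simp add: algebra_simps)
    finally have "q ?u0 + ?Y \<le> ?C * q u" .
    then have "(q ?u0 + ?Y) / ?C \<le> q u" using C by (subst pos_divide_le_eq) (auto simp: mult.commute)
    then show ?thesis by simp
  qed
  ultimately show ?thesis by linarith
qed

section \<open>The four eigenvalue estimates\<close>

lemma eigenvalue_H:
  assumes "cplx_eigenvalue (H * A) l"
  shows "l \<in> \<real>" "Re l \<le> Nc"
  using cplx_eigenvalue_bounds(1)[OF H_carrier H_sym A assms]
    cplx_eigenvalue_bounds(3)[OF H_carrier H_sym A assms h_le] by auto

lemma PHP: "P * H * P\<^sup>T \<in> carrier_mat n n" "(P * H * P\<^sup>T)\<^sup>T = P * H * P\<^sup>T"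
  using P_carrier H_carrier H_sym transpose_mult[of P n n H n] transpose_mult[of "P * H" n n "P\<^sup>T" n]
  by auto

lemma bil_PHP:
  assumes "u \<in> carrier_vec n"
  shows "bil (P * H * P\<^sup>T) (A *\<^sub>v u) (A *\<^sub>v u) = h (P *\<^sub>v u)"
  using bil_conj[of H n "P\<^sup>T" n "A *\<^sub>v u" "A *\<^sub>v u"] P_carrier H_carrier Au[OF assms] P_adjoint[OF assms]
  by (simp del: assoc_mult_mat)

text \<open>A nonzero eigenvalue survives compression by \<open>P\<close>, which yields the product
  \<open>P H P\<^sup>T A\<close> of a symmetric and a definite matrix. Its eigenvector lies in the
  range of \<open>P\<close>, where the lower bound of \<open>stable_on_range\<close> is
  available.\<close>

lemma eigenvalue_HP:
  assumes ev: "cplx_eigenvalue (H * A * P) l" and l: "l \<noteq> 0"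
  shows "l \<in> \<real>" "1 / \<tau> \<le> Re l" "Re l \<le> Nc"
proof -
  have "P * (H * A * P) = P * H * P\<^sup>T * A"
  proof (rule mat_eq_of_mult_vec)
    fix u :: "real Matrix.vec" assume u: "u \<in> carrier_vec n"
    have "(P * (H * A * P)) *\<^sub>v u = P *\<^sub>v (H *\<^sub>v (A *\<^sub>v (P *\<^sub>v u)))"
      using P_carrier H_carrier A' u by (simp add: assoc_mult_mat_vec[of _ n n _ n])
    also have "\<dots> = P *\<^sub>v (H *\<^sub>v (P\<^sup>T *\<^sub>v (A *\<^sub>v u)))" by (simp only: P_adjoint[OF u])
    also have "\<dots> = (P * H * P\<^sup>T * A) *\<^sub>v u"
      using P_carrier H_carrier A' u by (simp add: assoc_mult_mat_vec[of _ n n _ n])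
    finally show "(P * (H * A * P)) *\<^sub>v u = (P * H * P\<^sup>T * A) *\<^sub>v u" .
  qed (use P_carrier H_carrier A' in auto)
  moreover have "cplx_eigenvalue (P * (H * A * P)) l"
    using cplx_eigenvalue_compress[OF _ P_carrier P_idem ev l] H_carrier A' by simp
  ultimately have ev': "cplx_eigenvalue (P * H * P\<^sup>T * A) l" by (simp only:)
  show real: "l \<in> \<real>" using cplx_eigenvalue_sym_mult_pd(1)[OF PHP A ev'] .
  obtain x where x: "x \<in> carrier_vec n" "x \<noteq> 0\<^sub>v n" "(P * H * P\<^sup>T * A) *\<^sub>v x = Re l \<cdot>\<^sub>v x"
    using cplx_eigenvalue_sym_mult_pd(2)[OF PHP A ev'] by blast
  have l0: "Re l \<noteq> 0" using real l by (metis Reals_cases Re_complex_of_real of_real_0)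
  \<comment> \<open>\<open>P y\<close> is a nonzero multiple of \<open>x\<close>, which will show
    that \<open>P\<close> fixes \<open>x\<close>.\<close>
  define y where "y = H *\<^sub>v (P\<^sup>T *\<^sub>v (A *\<^sub>v x))"
  have y: "y \<in> carrier_vec n" using P_carrier H_carrier A' x by (simp add: y_def)
  have "(P * H * P\<^sup>T * A) *\<^sub>v x = P *\<^sub>v y"
    unfolding y_def using P_carrier H_carrier A' x by (simp add: assoc_mult_mat_vec[of _ n n _ n])
  then have "P *\<^sub>v y = Re l \<cdot>\<^sub>v x" using x by simp
  then have "P *\<^sub>v (Re l \<cdot>\<^sub>v x) = Re l \<cdot>\<^sub>v x" using P_vec(2)[OF y] by simp
  then have "Re l \<cdot>\<^sub>v (P *\<^sub>v x) = Re l \<cdot>\<^sub>v x" using P_carrier x by (simp add: mult_mat_vec[of _ n n])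
  then have "inverse (Re l) \<cdot>\<^sub>v (Re l \<cdot>\<^sub>v (P *\<^sub>v x)) = inverse (Re l) \<cdot>\<^sub>v (Re l \<cdot>\<^sub>v x)" by simp
  then have Px: "P *\<^sub>v x = x" using l0 by (simp add: smult_smult_assoc)
  have "q x \<le> \<tau> * h x" using stable_on_range[OF x(1)] R0_A_P[OF x(1)] Px by simp
  then have "1 / \<tau> * q x \<le> bil (P * H * P\<^sup>T) (A *\<^sub>v x) (A *\<^sub>v x)"
    using bil_PHP[OF x(1)] Px tau by (simp add: divide_le_eq mult.commute)
  then show "1 / \<tau> \<le> Re l" by (rule pd_eigenvalue_bounds(1)[OF PHP A x])
  have "bil (P * H * P\<^sup>T) (A *\<^sub>v x) (A *\<^sub>v x) \<le> Nc * q x" using bil_PHP[OF x(1)] Px h_le[OF x(1)] by simp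
  then show "Re l \<le> Nc" by (rule pd_eigenvalue_bounds(2)[OF PHP A x])
qed

text \<open>The form of the hybrid operator is \<open>h (P u) + q (cpart u)\<close>, block diagonal
  along the splitting of \<open>u\<close>. On the coarse block it coincides with \<open>q\<close>,
  which fits both bounds because \<open>1 \<le> Nc\<close> and \<open>1 < \<tau>\<close>.\<close>

lemma eigenvalue_hyb:
  assumes ev: "cplx_eigenvalue (H_hyb H P A R0 * A) l"
  shows "l \<in> \<real>" "1 / \<tau> \<le> Re l" "Re l \<le> Nc"
proof -
  let ?G = "H_hyb H P A R0"
  have G: "?G \<in> carrier_mat n n" "?G\<^sup>T = ?G"
    using PHP K_carrier K_sym transpose_add[of "P * H * P\<^sup>T" n n K] by (simp_all add: H_hyb_def)
  have bG: "bil ?G (A *\<^sub>v u) (A *\<^sub>v u) = h (P *\<^sub>v u) + q (cpart u)" if "u \<in> carrier_vec n" for u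
    using bil_add_mat[OF PHP(1) K_carrier Au Au] bil_PHP pythagoras(2) that by (simp add: H_hyb_def)
  show "l \<in> \<real>" using cplx_eigenvalue_bounds(1)[OF G A ev] .
  show "1 / \<tau> \<le> Re l"
  proof (rule cplx_eigenvalue_bounds(2)[OF G A ev])
    fix u :: "real Matrix.vec" assume u: "u \<in> carrier_vec n"
    have "q (P *\<^sub>v u) \<le> \<tau> * h (P *\<^sub>v u)"
      using stable_on_range[OF P_vec(1)[OF u] R0_A_P[OF u]] .
    moreover have "1 * q (cpart u) \<le> \<tau> * q (cpart u)"
      using tau q_nonneg[OF cpart_carrier[OF u]] by (intro mult_right_mono) auto
    ultimately have "q u \<le> \<tau> * (h (P *\<^sub>v u) + q (cpart u))"
      using pythagoras(1)[OF u] by (simp add: distrib_left)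
    then show "1 / \<tau> * q u \<le> bil ?G (A *\<^sub>v u) (A *\<^sub>v u)"
      using bG[OF u] tau by (simp add: divide_le_eq mult.commute)
  qed
  show "Re l \<le> Nc"
  proof (rule cplx_eigenvalue_bounds(3)[OF G A ev])
    fix u :: "real Matrix.vec" assume u: "u \<in> carrier_vec n"
    have "1 * q (cpart u) \<le> Nc * q (cpart u)"
      using Nc q_nonneg[OF cpart_carrier[OF u]] by (intro mult_right_mono) auto
    then show "bil ?G (A *\<^sub>v u) (A *\<^sub>v u) \<le> Nc * q u"
      using bG[OF u] h_le[OF P_vec(1)[OF u]] pythagoras(1)[OF u] by (simp add: distrib_left)
  qed
qed

text \<open>The extra 1 in the upper bound is the coarse term, whose energy is at most
  \<open>q u\<close> by \<open>pythagoras\<close>.\<close>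

lemma eigenvalue_ad:
  assumes ev: "cplx_eigenvalue (H_ad H A R0 * A) l"
  shows "l \<in> \<real>" "1 / ((1 + 2 * real Nc) * \<tau>) \<le> Re l" "Re l \<le> real Nc + 1"
proof -
  let ?G = "H_ad H A R0" and ?C = "(1 + 2 * real Nc) * \<tau>"
  have C: "0 < ?C" using tau by simp
  have G: "?G \<in> carrier_mat n n" "?G\<^sup>T = ?G"
    using H_carrier H_sym K_carrier K_sym transpose_add[of H n n K] by (simp_all add: H_ad_def)
  have bG: "bil ?G (A *\<^sub>v u) (A *\<^sub>v u) = h u + q (cpart u)" if "u \<in> carrier_vec n" for u
    using bil_add_mat[OF H_carrier K_carrier Au Au] pythagoras(2) that by (simp add: H_ad_def)
  show "l \<in> \<real>" using cplx_eigenvalue_bounds(1)[OF G A ev] .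
  show "1 / ?C \<le> Re l"
  proof (rule cplx_eigenvalue_bounds(2)[OF G A ev])
    fix u :: "real Matrix.vec" assume u: "u \<in> carrier_vec n"
    show "1 / ?C * q u \<le> bil ?G (A *\<^sub>v u) (A *\<^sub>v u)"
      using bG[OF u] ad_lower[OF u] C by (simp add: divide_le_eq mult.commute)
  qed
  show "Re l \<le> real Nc + 1"
  proof (rule cplx_eigenvalue_bounds(3)[OF G A ev])
    fix u :: "real Matrix.vec" assume u: "u \<in> carrier_vec n"
    show "bil ?G (A *\<^sub>v u) (A *\<^sub>v u) \<le> (real Nc + 1) * q u"
      using bG[OF u] h_le[OF u] pythagoras(1)[OF u] q_nonneg[OF P_vec(1)[OF u]]
      by (simp add: distrib_right)
  qed
qed

end

section \<open>Piecewise linear elasticity\<close>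

no_notation Matrix.vec_index (infixl "$" 100)
notation Finite_Cartesian_Product.vec_nth (infixl "$" 90)

text \<open>One formula for the triangles of both meshes: \<open>d\<close> selects the diagonal, and
  \<open>b\<close> the triangle on the bottom edge of the cell rather than the one on its top
  edge.\<close>

definition cell_tri :: "bool \<Rightarrow> bool \<Rightarrow> nat \<Rightarrow> nat \<Rightarrow> (real^2) set" where
  "cell_tri d b i j = convex hull {if d \<or> b then grid i j else grid (i+1) j,
     if b then grid (i+1) j else grid i (j+1), if \<not> d \<and> b then grid i (j+1) else grid (i+1) (j+1)}"

section \<open>Geometry of the triangulation\<close>

lemma vec2_eq_iff: "x = y \<longleftrightarrow> x $ 1 = y $ 1 \<and> x $ 2 = y $ 2" for x y :: "'a ^ 2"
  by (simp add: Finite_Cartesian_Product.vec_eq_iff forall_2)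

lemma mesh_eq: "mesh d = (\<Union>i<84. \<Union>j<42. {cell_tri d True i j, cell_tri d False i j})"
  by (cases d) (simp_all add: mesh_def cell_tri_def)

lemma mesh_cases:
  assumes "T \<in> mesh d"
  obtains b i j where "i < 84" "j < 42" "T = cell_tri d b i j"
  using assms unfolding mesh_eq by blast

lemma cell_tri_in_mesh:
  assumes "i < 84" "j < 42"
  shows "cell_tri d b i j \<in> mesh d"
proof -
  have "cell_tri d b i j \<in> {cell_tri d True i j, cell_tri d False i j}" by (cases b) simp_all
  then show ?thesis unfolding mesh_eq using assms by blast
qed

lemma finite_mesh: "finite (mesh d)"
  by (simp add: mesh_eq)

lemma grid_nth [simp]: "grid i j $ 1 = real i / 42" "grid i j $ 2 = real j / 42"
  by (simp_all add: grid_def)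

lemma grid_eq_iff [simp]: "grid i j = grid i' j' \<longleftrightarrow> i = i' \<and> j = j'"
  by (auto simp: vec2_eq_iff)

lemma mem_hull3:
  "x \<in> convex hull {p, q, r :: real^2} \<longleftrightarrow> (\<exists>u v w. 0 \<le> u \<and> 0 \<le> v \<and> 0 \<le> w \<and> u + v + w = 1
     \<and> x $ 1 = u * p $ 1 + v * q $ 1 + w * r $ 1 \<and> x $ 2 = u * p $ 2 + v * q $ 2 + w * r $ 2)"
  unfolding convex_hull_3 by (simp add: vec2_eq_iff) blast

text \<open>In the cell coordinates \<open>s\<close> and \<open>t\<close> each triangle is cut out
  by three half-planes. The witnesses in the converse direction are the barycentric
  coordinates.\<close>

lemma mem_cell_tri:
  "x \<in> cell_tri d b i j \<longleftrightarrow>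
     (let s = 42 * x $ 1 - real i; t = 42 * x $ 2 - real j in
      if d then if b then s \<le> 1 \<and> 0 \<le> t \<and> t \<le> s else 0 \<le> s \<and> t \<le> 1 \<and> s \<le> t
      else if b then 0 \<le> s \<and> 0 \<le> t \<and> s + t \<le> 1 else s \<le> 1 \<and> t \<le> 1 \<and> 1 \<le> s + t)"
  (is "_ \<longleftrightarrow> ?R")
proof
  assume "x \<in> cell_tri d b i j"
  then obtain u v w where uvw: "0 \<le> u" "0 \<le> v" "0 \<le> w" "u + v + w = 1" and
    x: "x $ 1 = u * (if d \<or> b then grid i j else grid (i+1) j) $ 1
       + v * (if b then grid (i+1) j else grid i (j+1)) $ 1
       + w * (if \<not> d \<and> b then grid i (j+1) else grid (i+1) (j+1)) $ 1"
    "x $ 2 = u * (if d \<or> b then grid i j else grid (i+1) j) $ 2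
       + v * (if b then grid (i+1) j else grid i (j+1)) $ 2
       + w * (if \<not> d \<and> b then grid i (j+1) else grid (i+1) (j+1)) $ 2"
    unfolding cell_tri_def mem_hull3 by blast
  from uvw(4) have u: "u = 1 - v - w" by simp
  show ?R using x uvw(1-3) unfolding u Let_def by (cases d; cases b) (simp_all add: field_simps)
next
  define s where "s = 42 * x $ 1 - real i"
  define t where "t = 42 * x $ 2 - real j"
  have x: "x $ 1 = (s + real i) / 42" "x $ 2 = (t + real j) / 42"
    by (simp_all add: s_def t_def)
  assume ?R
  then show "x \<in> cell_tri d b i j"
    unfolding s_def[symmetric] t_def[symmetric] Let_def
  proof ((cases d; cases b), goal_cases)
    case 1
    then show ?case unfolding cell_tri_def mem_hull3
      by (intro exI[of _ "1 - s"] exI[of _ "s - t"] exI[of _ t]) (auto simp: x field_simps)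
  next
    case 2
    then show ?case unfolding cell_tri_def mem_hull3
      by (intro exI[of _ "1 - t"] exI[of _ "t - s"] exI[of _ s]) (auto simp: x field_simps)
  next
    case 3
    then show ?case unfolding cell_tri_def mem_hull3
      by (intro exI[of _ "1 - s - t"] exI[of _ s] exI[of _ t]) (auto simp: x field_simps)
  next
    case 4
    then show ?case unfolding cell_tri_def mem_hull3
      by (intro exI[of _ "1 - t"] exI[of _ "1 - s"] exI[of _ "s + t - 1"]) (auto simp: x field_simps)
  qed
qed

lemma cell_tri_bounds:
  assumes "x \<in> cell_tri d b i j"
  shows "real i \<le> 42 * x $ 1" "42 * x $ 1 \<le> real i + 1" "real j \<le> 42 * x $ 2" "42 * x $ 2 \<le> real j + 1"
  using assms by (auto simp: mem_cell_tri Let_def split: if_splits)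

lemma mem_Omega: "x \<in> Omega \<longleftrightarrow> 0 \<le> x $ 1 \<and> x $ 1 \<le> 2 \<and> 0 \<le> x $ 2 \<and> x $ 2 \<le> 1"
  by (auto simp: Omega_def mem_box_cart forall_2)

lemma unit_interval_index:
  fixes y :: real
  assumes "0 \<le> y" "y \<le> real N" "0 < N"
  shows "\<exists>i<N. real i \<le> y \<and> y \<le> real i + 1"
proof (cases "y = real N")
  case True
  \<comment> \<open>At the right end the floor would be \<open>N\<close>, one cell too far; the
    point belongs to the last cell.\<close>
  then show ?thesis using assms by (intro exI[of _ "N - 1"]) (auto simp: of_nat_diff)
next
  case False
  then have "nat \<lfloor>y\<rfloor> < N" using assms by (simp add: nat_less_iff floor_less_iff)
  moreover have "real (nat \<lfloor>y\<rfloor>) \<le> y" "y \<le> real (nat \<lfloor>y\<rfloor>) + 1" using assms by linarith+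
  ultimately show ?thesis by blast
qed

lemma Union_mesh: "\<Union>(mesh d) = Omega"
proof (intro equalityI subsetI)
  fix x assume "x \<in> \<Union>(mesh d)"
  then obtain b i j where "i < 84" "j < 42" "x \<in> cell_tri d b i j" by (metis UnionE mesh_cases)
  then show "x \<in> Omega" using cell_tri_bounds[of x d b i j] by (auto simp: mem_Omega)
next
  fix x assume x: "x \<in> Omega"
  obtain i where i: "i < 84" "real i \<le> 42 * x $ 1" "42 * x $ 1 \<le> real i + 1"
    using unit_interval_index[of "42 * x $ 1" 84] x by (auto simp: mem_Omega)
  obtain j where j: "j < 42" "real j \<le> 42 * x $ 2" "42 * x $ 2 \<le> real j + 1"
    using unit_interval_index[of "42 * x $ 2" 42] x by (auto simp: mem_Omega)
  have "\<exists>b. x \<in> cell_tri d b i j"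
    unfolding mem_cell_tri Let_def ex_bool_eq using i j by auto
  then show "x \<in> \<Union>(mesh d)" using cell_tri_in_mesh i j by blast
qed

lemma negligible_line:
  fixes a b c :: real
  assumes "a \<noteq> 0 \<or> b \<noteq> 0"
  shows "negligible {x :: real^2. a * x $ 1 + b * x $ 2 = c}"
proof -
  have "vector [a, b] \<noteq> (0 :: real^2)" using assms by (auto simp: vec2_eq_iff)
  then have "negligible {x :: real^2. (vector [a, b] :: real^2) \<bullet> x = c}"
    by (intro negligible_hyperplane) auto
  then show ?thesis by (simp add: inner_vec_def sum_2)
qed

text \<open>Triangles of different cells meet inside a grid line, and the two triangles of one cell
  meet inside its diagonal.\<close>

lemma mesh_negligible_Int:
  assumes "T \<in> mesh d" "T' \<in> mesh d" "T \<noteq> T'"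
  shows "negligible (T \<inter> T')"
proof -
  obtain b i j where T: "T = cell_tri d b i j" using assms(1) by (rule mesh_cases)
  obtain b' i' j' where T': "T' = cell_tri d b' i' j'" using assms(2) by (rule mesh_cases)
  have sep: "i < i' \<or> i' < i \<or> j < j' \<or> j' < j \<or> i = i' \<and> j = j' \<and> b \<noteq> b'"
    using assms(3) unfolding T T'
    by (cases i i' rule: linorder_cases; cases j j' rule: linorder_cases; cases "b = b'") auto
  have bounds: "real i \<le> 42 * x $ 1 \<and> 42 * x $ 1 \<le> real i + 1 \<and> real j \<le> 42 * x $ 2 \<and> 42 * x $ 2 \<le> real j + 1
      \<and> real i' \<le> 42 * x $ 1 \<and> 42 * x $ 1 \<le> real i' + 1 \<and> real j' \<le> 42 * x $ 2 \<and> 42 * x $ 2 \<le> real j' + 1"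
    if "x \<in> T \<inter> T'" for x
    using cell_tri_bounds[of x d b i j] cell_tri_bounds[of x d b' i' j'] that by (simp add: T T')
  have "\<exists>u v c. (u \<noteq> 0 \<or> v \<noteq> 0) \<and> T \<inter> T' \<subseteq> {x :: real^2. u * x $ 1 + v * x $ 2 = c}"
    using sep
  proof (elim disjE, goal_cases)
    case 1
    have "42 * x $ 1 = real i'" if "x \<in> T \<inter> T'" for x using bounds[OF that] 1 by linarith
    then show ?case by (intro exI[of _ 42] exI[of _ 0] exI[of _ "real i'"]) auto
  next
    case 2
    have "42 * x $ 1 = real i" if "x \<in> T \<inter> T'" for x using bounds[OF that] 2 by linarith
    then show ?case by (intro exI[of _ 42] exI[of _ 0] exI[of _ "real i"]) auto
  next
    case 3
    have "42 * x $ 2 = real j'" if "x \<in> T \<inter> T'" for x using bounds[OF that] 3 by linarith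
    then show ?case by (intro exI[of _ 0] exI[of _ 42] exI[of _ "real j'"]) auto
  next
    case 4
    have "42 * x $ 2 = real j" if "x \<in> T \<inter> T'" for x using bounds[OF that] 4 by linarith
    then show ?case by (intro exI[of _ 0] exI[of _ 42] exI[of _ "real j"]) auto
  next
    case 5
    show ?case
    proof (cases d)
      case True
      have "42 * x $ 1 - 42 * x $ 2 = real i - real j" if "x \<in> T \<inter> T'" for x
        using that 5 True unfolding T T' Int_iff mem_cell_tri Let_def by (cases b; cases b') simp_all
      then show ?thesis by (intro exI[of _ 42] exI[of _ "-42"] exI[of _ "real i - real j"]) auto
    next
      case False
      have "42 * x $ 1 + 42 * x $ 2 = real i + real j + 1" if "x \<in> T \<inter> T'" for x
        using that 5 False unfolding T T' Int_iff mem_cell_tri Let_def by (cases b; cases b') simp_all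
      then show ?thesis by (intro exI[of _ 42] exI[of _ 42] exI[of _ "real i + real j + 1"]) auto
    qed
  qed
  then show ?thesis using negligible_subset[OF negligible_line] by blast
qed

text \<open>Twice the signed area of the triangle; it vanishes exactly when the three points are
  collinear.\<close>

definition area2 :: "real^2 \<Rightarrow> real^2 \<Rightarrow> real^2 \<Rightarrow> real" where
  "area2 p q r = (r $ 1 - p $ 1) * (q $ 2 - p $ 2) - (q $ 1 - p $ 1) * (r $ 2 - p $ 2)"

lemma grid_in_nodes: "grid i j \<in> mesh_nodes \<longleftrightarrow> i \<le> 84 \<and> j \<le> 42"
  by (auto simp: mesh_nodes_def)

lemma grid_in_cell_tri:
  assumes "grid k l \<in> cell_tri d b i j"
  shows "(k = i \<or> k = i + 1) \<and> (l = j \<or> l = j + 1)"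
  using cell_tri_bounds[OF assms] by auto

text \<open>The last property serves in both directions: vertices are nodes, where nodal functions
  have known values, and a node lying on the triangle is one of its vertices.\<close>

lemma mesh_triangle:
  assumes "T \<in> mesh d"
  obtains p q r where "T = convex hull {p, q, r}" "area2 p q r \<noteq> 0" "T \<inter> mesh_nodes = {p, q, r}"
proof -
  obtain b i j where ij: "i < 84" "j < 42" and T: "T = cell_tri d b i j" using assms by (rule mesh_cases)
  define p q r where "p = (if d \<or> b then grid i j else grid (i+1) j)"
    and "q = (if b then grid (i+1) j else grid i (j+1))"
    and "r = (if \<not> d \<and> b then grid i (j+1) else grid (i+1) (j+1))"
  have hull: "T = convex hull {p, q, r}"
    by (auto simp: T cell_tri_def p_def q_def r_def)
  moreover have "area2 p q r \<noteq> 0"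
    by (auto simp: area2_def p_def q_def r_def field_simps)
  moreover have "T \<inter> mesh_nodes = {p, q, r}"
  proof
    have "{p, q, r} \<subseteq> T" unfolding hull by (rule hull_subset)
    moreover have "{p, q, r} \<subseteq> mesh_nodes" using ij by (auto simp: grid_in_nodes p_def q_def r_def)
    ultimately show "{p, q, r} \<subseteq> T \<inter> mesh_nodes" by blast
    show "T \<inter> mesh_nodes \<subseteq> {p, q, r}"
    proof
      fix x assume x: "x \<in> T \<inter> mesh_nodes"
      then obtain k l where kl: "x = grid k l" by (auto simp: mesh_nodes_def)
      have xT: "grid k l \<in> cell_tri d b i j" using x kl T by simp
      then have "\<not> (d \<and> b \<and> k = i \<and> l = j + 1)" "\<not> (d \<and> \<not> b \<and> k = i + 1 \<and> l = j)"
        "\<not> (\<not> d \<and> b \<and> k = i + 1 \<and> l = j + 1)" "\<not> (\<not> d \<and> \<not> b \<and> k = i \<and> l = j)"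
        by (auto simp: mem_cell_tri)
      then show "x \<in> {p, q, r}"
        using grid_in_cell_tri[OF xT] by (auto simp: kl p_def q_def r_def)
    qed
  qed
  ultimately show ?thesis by (rule that)
qed

section \<open>Affine displacement fields and the elastic energy density\<close>

lemma mult_vec_nth2:
  fixes B :: "real^2^2"
  shows "(B *v x) $ i = B $ i $ 1 * x $ 1 + B $ i $ 2 * x $ 2"
  by (simp add: matrix_vector_mult_def sum_2)

lemma affine_zero_of_three_points:
  fixes B :: "real^2^2"
  assumes "B *v p + b = 0" "B *v q + b = 0" "B *v r + b = 0" "area2 p q r \<noteq> 0"
  shows "B = 0" "b = 0"
proof -
  have "B $ i $ 1 = 0 \<and> B $ i $ 2 = 0" for i
  proof -
    have e: "B $ i $ 1 * x $ 1 + B $ i $ 2 * x $ 2 + b $ i = 0" if "B *v x + b = 0" for x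
      using arg_cong[OF that, of "\<lambda>v. v $ i"] by (simp add: mult_vec_nth2)
    have 1: "B $ i $ 1 * (q $ 1 - p $ 1) + B $ i $ 2 * (q $ 2 - p $ 2) = 0"
      and 2: "B $ i $ 1 * (r $ 1 - p $ 1) + B $ i $ 2 * (r $ 2 - p $ 2) = 0"
      using e[OF assms(1)] e[OF assms(2)] e[OF assms(3)] by (auto simp: algebra_simps)
    have "B $ i $ 1 * area2 p q r
        = (B $ i $ 1 * (r $ 1 - p $ 1) + B $ i $ 2 * (r $ 2 - p $ 2)) * (q $ 2 - p $ 2)
        - (B $ i $ 1 * (q $ 1 - p $ 1) + B $ i $ 2 * (q $ 2 - p $ 2)) * (r $ 2 - p $ 2)"
      by (simp add: area2_def algebra_simps)
    then have "B $ i $ 1 * area2 p q r = 0" using 1 2 by simp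
    moreover have "B $ i $ 2 * area2 p q r
        = (B $ i $ 1 * (q $ 1 - p $ 1) + B $ i $ 2 * (q $ 2 - p $ 2)) * (r $ 1 - p $ 1)
        - (B $ i $ 1 * (r $ 1 - p $ 1) + B $ i $ 2 * (r $ 2 - p $ 2)) * (q $ 1 - p $ 1)"
      by (simp add: area2_def algebra_simps)
    then have "B $ i $ 2 * area2 p q r = 0" using 1 2 by simp
    ultimately show ?thesis using assms(4) by simp
  qed
  then show B: "B = 0" by (simp add: vec2_eq_iff)
  show "b = 0" using assms(1) by (simp add: B)
qed

definition sym_grad :: "real^2^2 \<Rightarrow> 2 \<Rightarrow> 2 \<Rightarrow> real" where
  "sym_grad B i j = (B $ i $ j + B $ j $ i) / 2"

text \<open>A vanishing symmetric part leaves a multiple of the rotation by a right angle. Such a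
  matrix is injective unless it is zero, yet it sends \<open>q - p\<close> to zero.\<close>

lemma rigid_zero_of_two_points:
  fixes B :: "real^2^2"
  assumes "B *v p + b = 0" "B *v q + b = 0" "p \<noteq> q" and rigid: "\<forall>i j. sym_grad B i j = 0"
  shows "B = 0" "b = 0"
proof -
  have d: "B $ 1 $ 1 = 0" "B $ 2 $ 2 = 0" "B $ 2 $ 1 = - B $ 1 $ 2"
    using rigid[rule_format, of 1 1] rigid[rule_format, of 2 2] rigid[rule_format, of 1 2]
    by (auto simp: sym_grad_def)
  have e: "B $ i $ 1 * (q $ 1 - p $ 1) + B $ i $ 2 * (q $ 2 - p $ 2) = 0" for i
    using arg_cong[OF assms(1), of "\<lambda>v. v $ i"] arg_cong[OF assms(2), of "\<lambda>v. v $ i"]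
    by (simp add: mult_vec_nth2 algebra_simps)
  have "B $ 1 $ 2 * (q $ 2 - p $ 2) = 0" "B $ 1 $ 2 * (q $ 1 - p $ 1) = 0"
    using e[of 1] e[of 2] d by auto
  moreover have "q $ 1 \<noteq> p $ 1 \<or> q $ 2 \<noteq> p $ 2" using assms(3) by (auto simp: vec2_eq_iff)
  ultimately have "B $ 1 $ 2 = 0" by auto
  then show B: "B = 0" using d by (simp add: vec2_eq_iff)
  show "b = 0" using assms(1) by (simp add: B)
qed

text \<open>The energy density of two constant gradients at Young's modulus 1. Both Lame parameters
  are linear in the modulus, so the modulus can be factored out.\<close>

definition cform :: "real^2^2 \<Rightarrow> real^2^2 \<Rightarrow> real" where
  "cform B B' = 2 * lame_mu 1 * (\<Sum>i\<in>UNIV. \<Sum>j\<in>UNIV. sym_grad B i j * sym_grad B' i j)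
     + lame_L 1 * (\<Sum>i\<in>UNIV. B $ i $ i) * (\<Sum>i\<in>UNIV. B' $ i $ i)"

lemma lame_1: "lame_mu 1 > 0" "lame_L 1 > 0" "lame_mu e = e * lame_mu 1" "lame_L e = e * lame_L 1"
  by (simp_all add: lame_mu_def lame_L_def poisson_ratio_def)

lemma cform_sym: "cform B B' = cform B' B"
  by (simp add: cform_def mult.commute mult.left_commute)

lemma cform_zero_left [simp]: "cform 0 B = 0"
  by (simp add: cform_def sym_grad_def)

lemma cform_add_left: "cform (B + C) B' = cform B B' + cform C B'"
  by (simp add: cform_def sum_2 sym_grad_def field_simps)

lemma cform_scale_left: "cform (c *\<^sub>R B) B' = c * cform B B'"
  by (simp add: cform_def sum_2 sym_grad_def field_simps)

lemma cform_sum_left: "cform (\<Sum>k\<in>K. x k *\<^sub>R G k) B' = (\<Sum>k\<in>K. x k * cform (G k) B')"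
  by (induction K rule: infinite_finite_induct) (auto simp: cform_add_left cform_scale_left)

lemma cform_sum:
  "cform (\<Sum>k\<in>K. x k *\<^sub>R G k) (\<Sum>l\<in>L. y l *\<^sub>R F l) = (\<Sum>k\<in>K. \<Sum>l\<in>L. x k * cform (G k) (F l) * y l)"
proof -
  have "cform (G k) (\<Sum>l\<in>L. y l *\<^sub>R F l) = (\<Sum>l\<in>L. y l * cform (G k) (F l))" for k
    by (simp add: cform_sym[of "G k"] cform_sum_left)
  then show ?thesis by (simp add: cform_sum_left sum_distrib_left mult_ac)
qed

lemma cform_nonneg: "0 \<le> cform B B"
proof -
  have "0 \<le> lame_L 1 * (\<Sum>i\<in>UNIV. B $ i $ i) * (\<Sum>i\<in>UNIV. B $ i $ i)"
    using lame_1(2) by (auto simp: mult.assoc zero_le_mult_iff)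
  moreover have "0 \<le> (\<Sum>i\<in>UNIV. \<Sum>j\<in>UNIV. sym_grad B i j * sym_grad B i j)"
    by (intro sum_nonneg) auto
  ultimately show ?thesis unfolding cform_def using lame_1(1) by simp
qed

text \<open>Both terms of the density are nonnegative because the Lame parameters are positive at
  this Poisson ratio, so the strain term vanishes by itself.\<close>

lemma cform_eq_0:
  assumes "cform B B = 0"
  shows "sym_grad B i j = 0"
proof -
  let ?s = "\<Sum>i\<in>UNIV. \<Sum>j\<in>UNIV. sym_grad B i j * sym_grad B i j"
  have "0 \<le> lame_L 1 * (\<Sum>i\<in>UNIV. B $ i $ i) * (\<Sum>i\<in>UNIV. B $ i $ i)"
    using lame_1(2) by (auto simp: mult.assoc zero_le_mult_iff)
  moreover have "0 \<le> ?s" by (intro sum_nonneg) auto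
  ultimately have "?s = 0" using assms lame_1(1) unfolding cform_def
    by (smt (verit) mult_pos_pos)
  then have "sym_grad B 1 1 * sym_grad B 1 1 + sym_grad B 1 2 * sym_grad B 1 2
      + (sym_grad B 2 1 * sym_grad B 2 1 + sym_grad B 2 2 * sym_grad B 2 2) = 0"
    by (simp add: sum_2)
  moreover have "0 \<le> sym_grad B k l * sym_grad B k l" for k l by simp
  ultimately have "sym_grad B k l * sym_grad B k l = 0" if "k = 1 \<or> k = 2" "l = 1 \<or> l = 2" for k l
    using that by (smt (verit))
  then show ?thesis using exhaust_2[of i] exhaust_2[of j] by auto
qed

text \<open>The constant gradient of \<open>v\<close> on the triangle \<open>T\<close>, taken as the
  linear part of an affine representation.\<close>

definition mesh_grad :: "(real^2) set \<Rightarrow> (real^2 \<Rightarrow> real^2) \<Rightarrow> real^2^2" where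
  "mesh_grad T v = (SOME B. \<exists>b. \<forall>x\<in>T. v x = B *v x + b)"

lemma mesh_grad:
  assumes "v \<in> V_h d" "T \<in> mesh d"
  shows "\<exists>b. \<forall>x\<in>T. v x = mesh_grad T v *v x + b"
  unfolding mesh_grad_def by (rule someI_ex) (use assms in \<open>auto simp: V_h_def\<close>)

lemma partial_deriv_eq:
  assumes "v \<in> V_h d" "T \<in> mesh d" "x \<in> interior T"
  shows "partial_deriv v i j x = mesh_grad T v $ i $ j"
proof -
  let ?B = "mesh_grad T v"
  obtain b where b: "\<And>x. x \<in> T \<Longrightarrow> v x = ?B *v x + b" using mesh_grad[OF assms(1,2)] by blast
  have "((\<lambda>x. ?B *v x + b) has_derivative (\<lambda>h. ?B *v h)) (at x)"
    by (intro has_derivative_add_const bounded_linear_imp_has_derivative matrix_vector_mul_bounded_linear)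
  then have "(v has_derivative (\<lambda>h. ?B *v h)) (at x)"
    by (rule has_derivative_transform_within_open[OF _ open_interior assms(3)])
      (use b interior_subset[of T] in auto)
  from frechet_derivative_at[OF this] have "frechet_derivative v (at x) = (\<lambda>h. ?B *v h)" ..
  then show ?thesis
    by (simp add: partial_deriv_def matrix_vector_mult_basis column_def)
qed

abbreviation energy_density where
  "energy_density E u v x \<equiv>
     2 * lame_mu (E x) * (\<Sum>i\<in>UNIV. \<Sum>j\<in>UNIV. strain u i j x * strain v i j x)
        + lame_L (E x) * divergence u x * divergence v x"

lemma energy_density_eq:
  assumes "u \<in> V_h d" "v \<in> V_h d" "T \<in> mesh d" "x \<in> interior T"
  shows "energy_density E u v x = cform (mesh_grad T u) (mesh_grad T v) * E x"
  using assms
  by (simp add: strain_def divergence_def partial_deriv_eq[OF _ assms(3,4)] cform_def sym_grad_def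
      lame_1(3)[of "E x"] lame_1(4)[of "E x"] algebra_simps)

section \<open>Integration over triangles\<close>

lemma mesh_compact: "T \<in> mesh d \<Longrightarrow> compact T"
  by (erule mesh_triangle) (simp add: finite_imp_compact_convex_hull)

lemma mesh_convex: "T \<in> mesh d \<Longrightarrow> convex T"
  by (erule mesh_triangle) simp

text \<open>Covers both distributions of Young's modulus at once; the positive lower bound gives
  every triangle a positive weight.\<close>

definition admissible :: "(real^2 \<Rightarrow> real) \<Rightarrow> bool" where
  "admissible E \<longleftrightarrow> E \<in> borel_measurable lebesgue \<and> (\<exists>e>0. \<forall>x. e \<le> E x) \<and> (\<exists>M. \<forall>x. E x \<le> M)"

lemma admissible_integrable:
  assumes "admissible E" "T \<in> mesh d"
  shows "set_integrable lebesgue T E"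
proof -
  obtain M where M: "\<And>x. E x \<le> M" using assms(1) by (auto simp: admissible_def)
  obtain e where e: "e > 0" "\<And>x. e \<le> E x" using assms(1) by (auto simp: admissible_def)
  have T: "T \<in> sets lebesgue" "emeasure lebesgue T < \<infinity>"
    using lmeasurable_compact[OF mesh_compact[OF assms(2)]] by (auto simp: fmeasurable_def)
  have "norm (E x) \<le> M" for x using M[of x] e(2)[of x] e(1) by simp
  then show ?thesis unfolding set_integrable_def
    using assms(1) T by (intro integrableI_bounded_set_indicator[where B = M]) (auto simp: admissible_def)
qed

lemma admissible_integral_pos:
  assumes "admissible E" "T \<in> mesh d"
  shows "0 < integral T E"
proof -
  obtain e where e: "e > 0" "\<And>x. e \<le> E x" using assms(1) by (auto simp: admissible_def)
  obtain p q r where T: "T = convex hull {p, q, r}" "area2 p q r \<noteq> 0" using assms(2) by (rule mesh_triangle)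
  have c: "measure lebesgue T > 0"
    using T content_triangle[of p q r] by (simp add: area2_def borel_compact finite_imp_compact_convex_hull)
  have lm: "T \<in> lmeasurable" using lmeasurable_compact[OF mesh_compact[OF assms(2)]] .
  have "0 < e * measure lebesgue T" using c e by simp
  also have "\<dots> = integral T (\<lambda>x. e * 1)"
    by (simp only: lmeasure_integral[OF lm] integral_mult_right)
  also have "\<dots> \<le> integral T E"
    using e set_lebesgue_integral_eq_integral(1)[OF admissible_integrable[OF assms]]
      lm[unfolded lmeasurable_iff_integrable_on]
    by (intro integral_le integrable_on_mult_right) auto
  finally show ?thesis .
qed

text \<open>The derivatives are controlled in the interior of \<open>T\<close>, and the frontier of
  a convex set is negligible. The gauge integral is recorded beside Lebesgue integrability because
  it adds up over triangles that overlap in null sets.\<close>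

lemma energy_on_triangle:
  assumes "admissible E" "u \<in> V_h d" "v \<in> V_h d" "T \<in> mesh d"
  shows "set_integrable lebesgue T (energy_density E u v)"
    "(energy_density E u v has_integral cform (mesh_grad T u) (mesh_grad T v) * integral T E) T"
proof -
  let ?c = "cform (mesh_grad T u) (mesh_grad T v)"
  have neg: "negligible (frontier T)" using mesh_convex[OF assms(4)] by (rule negligible_convex_frontier)
  have eq: "energy_density E u v x = ?c * E x" if "x \<in> T - frontier T" for x
    using energy_density_eq[OF assms(2,3,4)] that closure_subset[of T] by (auto simp: frontier_def)
  have i: "set_integrable lebesgue T E" using admissible_integrable[OF assms(1,4)] .
  have "set_integrable lebesgue T (\<lambda>x. ?c * E x)" using i by simp
  then show "set_integrable lebesgue T (energy_density E u v)"
    by (rule absolutely_integrable_spike[OF _ neg]) (rule eq)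
  have "((\<lambda>x. ?c * E x) has_integral ?c * integral T E) T"
    using set_lebesgue_integral_eq_integral(1)[OF i]
    by (intro has_integral_mult_right) (simp add: has_integral_integral)
  then show "(energy_density E u v has_integral ?c * integral T E) T"
    by (rule has_integral_spike[OF neg, rotated]) (rule eq)
qed

text \<open>The bridge from analysis to algebra: over any set of triangles the form is a finite sum
  of constant densities, weighted by the integrals of \<open>E\<close>.\<close>

lemma elasticity_form_eq:
  assumes "admissible E" "u \<in> V_h d" "v \<in> V_h d" "\<S> \<subseteq> mesh d"
  shows "elasticity_form E (\<Union>\<S>) u v
    = (\<Sum>T\<in>\<S>. cform (mesh_grad T u) (mesh_grad T v) * integral T E)"
proof -
  have fin: "finite \<S>" using assms(4) finite_mesh finite_subset by blast
  have "set_integrable lebesgue (\<Union>T\<in>\<S>. T) (energy_density E u v)"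
  proof (rule set_integrable_UN[OF fin])
    fix T assume "T \<in> \<S>"
    then have T: "T \<in> mesh d" using assms(4) by blast
    show "set_integrable lebesgue T (energy_density E u v)" by (rule energy_on_triangle(1)[OF assms(1-3) T])
    show "T \<in> sets lebesgue" using lmeasurable_compact[OF mesh_compact[OF T]] by (simp add: fmeasurable_def)
  qed
  then have "elasticity_form E (\<Union>\<S>) u v = integral (\<Union>\<S>) (energy_density E u v)"
    unfolding elasticity_form_def by (simp add: set_lebesgue_integral_eq_integral(2))
  also have "(energy_density E u v has_integral
      (\<Sum>T\<in>\<S>. cform (mesh_grad T u) (mesh_grad T v) * integral T E)) (\<Union>\<S>)"
  proof (rule has_integral_Union[OF fin])
    show "pairwise (\<lambda>S S'. negligible (S \<inter> S')) \<S>"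
      using mesh_negligible_Int assms(4) by (auto simp: pairwise_def)
  qed (use energy_on_triangle(2)[OF assms(1-3)] assms(4) in blast)
  then have "integral (\<Union>\<S>) (energy_density E u v)
      = (\<Sum>T\<in>\<S>. cform (mesh_grad T u) (mesh_grad T v) * integral T E)" by (rule integral_unique)
  finally show ?thesis .
qed

lemma subdomain_closed:
  assumes "decomposition d \<T>" "s \<in> {1..8}"
  shows "closed (subdomain \<T> s)" "\<T> s \<subseteq> mesh d"
proof -
  show sub: "\<T> s \<subseteq> mesh d" using assms by (auto simp: decomposition_def)
  show "closed (subdomain \<T> s)" unfolding subdomain_def
    using sub finite_subset[OF sub finite_mesh] mesh_compact compact_imp_closed
    by (intro closed_Union) auto
qed

lemma young_admissible:
  assumes "decomposition d \<T>" "E = young_checker \<T> \<or> E = young_layers \<T>"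
  shows "admissible E"
proof -
  let ?O = "\<Union>s\<in>{s\<in>{1..8}. odd s}. subdomain \<T> s"
  have "closed ?O" using subdomain_closed(1)[OF assms(1)] by (intro closed_UN) auto
  then have O: "?O \<in> sets borel" by simp
  have c: "young_checker \<T> = (\<lambda>x. if x \<in> ?O then 10^5 else 10^8)"
    by (auto simp: young_checker_def fun_eq_iff)
  have "(\<lambda>x. if x \<in> ?O then 10^5 else 10^8 :: real) \<in> borel_measurable borel"
    using O by (intro measurable_If_set) auto
  then have cm: "young_checker \<T> \<in> borel_measurable borel" unfolding c .
  let ?L = "{x :: real^2. x $ 2 \<in> {1/7..2/7} \<union> {3/7..4/7} \<union> {5/7..6/7}}"
  have "closed ((\<lambda>x :: real^2. x $ 2) -` ({1/7..2/7} \<union> {3/7..4/7} \<union> {5/7..6/7}))"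
    by (intro closed_vimage closed_Un closed_atLeastAtMost continuous_intros)
  then have L: "?L \<in> sets borel" by (simp add: vimage_def)
  have l: "young_layers \<T> = (\<lambda>x. young_checker \<T> x + (if x \<in> ?L then 10^9 else 0))"
    by (auto simp: young_layers_def fun_eq_iff)
  have "(\<lambda>x. if x \<in> ?L then 10^9 else 0 :: real) \<in> borel_measurable borel"
    using L by (intro measurable_If_set) auto
  then have "young_layers \<T> \<in> borel_measurable borel" unfolding l using cm by simp
  with cm assms(2) have "E \<in> borel_measurable borel" by auto
  then have "E \<in> borel_measurable lebesgue" by (intro measurable_completion) simp
  moreover have "10^5 \<le> E x \<and> E x \<le> 10^8 + 10^9" for x
    using assms(2) by (auto simp: young_layers_def young_checker_def)
  ultimately show ?thesis unfolding admissible_def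
    by (intro conjI exI[of _ "10^5"] exI[of _ "10^8 + 10^9"]) auto
qed

lemma sum_scaleR_mult_vec:
  fixes G :: "'i \<Rightarrow> real^2^2"
  shows "(\<Sum>k\<in>K. x k *\<^sub>R G k) *v p = (\<Sum>k\<in>K. x k *\<^sub>R (G k *v p))"
  by (induction K rule: infinite_finite_induct)
    (simp_all add: matrix_vector_mult_add_rdistrib scaleR_matrix_vector_assoc)

lemma grid_mem_cell_tri:
  "grid k l \<in> cell_tri d b i j \<longleftrightarrow>
     (if d then if b then k \<le> i + 1 \<and> j \<le> l \<and> l + i \<le> k + j else i \<le> k \<and> l \<le> j + 1 \<and> k + j \<le> l + i
      else if b then i \<le> k \<and> j \<le> l \<and> k + l \<le> i + j + 1 else k \<le> i + 1 \<and> l \<le> j + 1 \<and> i + j + 1 \<le> k + l)"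
proof -
  have e: "42 * grid k l $ 1 = real k" "42 * grid k l $ 2 = real l" by simp_all
  show ?thesis unfolding mem_cell_tri e Let_def by auto
qed

locale elasticity_fe =
  fixes d :: bool and n :: nat and dof :: "nat \<Rightarrow> (real^2) \<times> 2" and \<phi> :: "nat \<Rightarrow> real^2 \<Rightarrow> real^2"
    and \<T> :: "nat \<Rightarrow> (real^2) set set" and E :: "real^2 \<Rightarrow> real" and S :: "nat \<Rightarrow> nat list"
  assumes basis: "nodal_basis d n dof \<phi>"
    and decomp: "decomposition d \<T>"
    and young: "E = young_checker \<T> \<or> E = young_layers \<T>"
    and dofs: "\<forall>s\<in>{1..8}. distinct (S s) \<and> set (S s) = {k. k < n \<and> fst (dof k) \<in> subdomain \<T> s}"
begin

section \<open>Energies of the nodal basis\<close>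

lemma phi_V: "k < n \<Longrightarrow> \<phi> k \<in> V_h d"
  using basis by (simp add: nodal_basis_def)

lemma phi_node: "k < n \<Longrightarrow> p \<in> mesh_nodes \<Longrightarrow> \<phi> k p $ c = (if dof k = (p, c) then 1 else 0)"
  using basis by (simp add: nodal_basis_def)

lemma phi_other_node: "k < n \<Longrightarrow> p \<in> mesh_nodes \<Longrightarrow> p \<noteq> fst (dof k) \<Longrightarrow> \<phi> k p = 0"
  by (auto simp: vec2_eq_iff phi_node)

lemma dof_node:
  assumes "k < n"
  shows "fst (dof k) \<in> mesh_nodes"
proof -
  have "dof k \<in> (mesh_nodes - Dirichlet_boundary) \<times> UNIV"
    using basis assms unfolding nodal_basis_def by (meson bij_betwE lessThan_iff)
  then show ?thesis by (auto simp: mem_Times_iff)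
qed

lemma E_admissible: "admissible E"
  using young_admissible[OF decomp young] .

lemma weight_pos: "T \<in> mesh d \<Longrightarrow> 0 < integral T E"
  using admissible_integral_pos[OF E_admissible] .

lemma part: "s \<in> {1..8} \<Longrightarrow> \<T> s \<subseteq> mesh d"
  using decomp by (auto simp: decomposition_def)

abbreviation grad_phi :: "(real^2) set \<Rightarrow> nat \<Rightarrow> real^2^2" where
  "grad_phi T k \<equiv> mesh_grad T (\<phi> k)"

text \<open>Indexed by the set of triangles, so that the stiffness matrix, from
  \<open>mesh d\<close>, and the Neumann matrices, from \<open>\<T> s\<close>, share all their
  lemmas.\<close>

definition energy :: "(real^2) set set \<Rightarrow> nat \<Rightarrow> nat \<Rightarrow> real" where
  "energy \<S> k l = elasticity_form E (\<Union>\<S>) (\<phi> k) (\<phi> l)"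

lemma energy_eq:
  "\<S> \<subseteq> mesh d \<Longrightarrow> k < n \<Longrightarrow> l < n \<Longrightarrow>
    energy \<S> k l = (\<Sum>T\<in>\<S>. cform (grad_phi T k) (grad_phi T l) * integral T E)"
  unfolding energy_def by (intro elasticity_form_eq[OF E_admissible phi_V phi_V])

lemma energy_sym: "\<S> \<subseteq> mesh d \<Longrightarrow> k < n \<Longrightarrow> l < n \<Longrightarrow> energy \<S> k l = energy \<S> l k"
  by (simp add: energy_eq cform_sym)

lemma energy_quadratic:
  assumes "\<S> \<subseteq> mesh d" "K \<subseteq> {..<n}"
  shows "(\<Sum>k\<in>K. \<Sum>l\<in>K. x k * energy \<S> k l * x l)
    = (\<Sum>T\<in>\<S>. cform (\<Sum>k\<in>K. x k *\<^sub>R grad_phi T k) (\<Sum>k\<in>K. x k *\<^sub>R grad_phi T k) * integral T E)"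
proof -
  have "(\<Sum>k\<in>K. \<Sum>l\<in>K. x k * energy \<S> k l * x l)
      = (\<Sum>k\<in>K. \<Sum>l\<in>K. \<Sum>T\<in>\<S>. x k * cform (grad_phi T k) (grad_phi T l) * x l * integral T E)"
  proof (intro sum.cong refl)
    fix k l assume "k \<in> K" "l \<in> K"
    then have "energy \<S> k l = (\<Sum>T\<in>\<S>. cform (grad_phi T k) (grad_phi T l) * integral T E)"
      using assms by (intro energy_eq) auto
    then show "x k * energy \<S> k l * x l
        = (\<Sum>T\<in>\<S>. x k * cform (grad_phi T k) (grad_phi T l) * x l * integral T E)"
      by (simp add: sum_distrib_left sum_distrib_right mult_ac)
  qed
  also have "\<dots> = (\<Sum>T\<in>\<S>. (\<Sum>k\<in>K. \<Sum>l\<in>K. x k * cform (grad_phi T k) (grad_phi T l) * x l) * integral T E)"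
    by (simp add: sum.swap[of _ \<S>] sum_distrib_right)
  finally show ?thesis by (simp add: cform_sum)
qed

lemma energy_nonneg:
  assumes "\<S> \<subseteq> mesh d" "K \<subseteq> {..<n}"
  shows "0 \<le> (\<Sum>k\<in>K. \<Sum>l\<in>K. x k * energy \<S> k l * x l)"
  unfolding energy_quadratic[OF assms]
  using assms(1) by (intro sum_nonneg mult_nonneg_nonneg cform_nonneg) (auto intro: less_imp_le weight_pos)

lemma energy_zero_imp_rigid:
  assumes "\<S> \<subseteq> mesh d" "K \<subseteq> {..<n}" "(\<Sum>k\<in>K. \<Sum>l\<in>K. x k * energy \<S> k l * x l) = 0" "T \<in> \<S>"
  shows "sym_grad (\<Sum>k\<in>K. x k *\<^sub>R grad_phi T k) i j = 0"
proof -
  let ?g = "\<lambda>T. \<Sum>k\<in>K. x k *\<^sub>R grad_phi T k"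
  have fin: "finite \<S>" using assms(1) finite_mesh finite_subset by blast
  have nn: "0 \<le> cform (?g T) (?g T) * integral T E" if "T \<in> \<S>" for T
    using that assms(1) by (intro mult_nonneg_nonneg cform_nonneg) (auto intro: less_imp_le weight_pos)
  have "(\<Sum>T\<in>\<S>. cform (?g T) (?g T) * integral T E) = 0"
    using assms(3) unfolding energy_quadratic[OF assms(1,2)] .
  then have "cform (?g T) (?g T) * integral T E = 0"
    using assms(4) nn by (subst (asm) sum_nonneg_eq_0_iff[OF fin]) auto
  moreover have "0 < integral T E" using weight_pos assms(1,4) by blast
  ultimately have "cform (?g T) (?g T) = 0" by simp
  then show ?thesis by (rule cform_eq_0)
qed

text \<open>A displacement of zero energy is a rigid motion on every triangle. It vanishes on the
  Dirichlet boundary, and a rigid motion with two zeros is zero, so the zeros spread from one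
  column of the mesh to the next.\<close>

lemma energy_definite:
  assumes zero: "(\<Sum>k<n. \<Sum>l<n. x k * energy (mesh d) k l * x l) = 0" and k: "k < n"
  shows "x k = 0"
proof -
  define u where "u p = (\<Sum>k<n. x k *\<^sub>R \<phi> k p)" for p
  have u_zero: "u r = 0" if T: "T \<in> mesh d" and pq: "p \<in> T" "q \<in> T" "p \<noteq> q" "u p = 0" "u q = 0"
    and r: "r \<in> T" for T p q r
  proof -
    let ?g = "\<Sum>k<n. x k *\<^sub>R grad_phi T k"
    have "\<forall>k\<in>{..<n}. \<exists>b. \<forall>p\<in>T. \<phi> k p = grad_phi T k *v p + b"
      using mesh_grad[OF phi_V T] by blast
    from bchoice[OF this] obtain b where b: "\<forall>k\<in>{..<n}. \<forall>p\<in>T. \<phi> k p = grad_phi T k *v p + b k" ..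
    have u: "u p = ?g *v p + (\<Sum>k<n. x k *\<^sub>R b k)" if "p \<in> T" for p
      using b that by (simp add: u_def sum_scaleR_mult_vec scaleR_add_right sum.distrib)
    have rigid: "\<forall>i j. sym_grad ?g i j = 0"
      using energy_zero_imp_rigid[OF subset_refl subset_refl zero T] by blast
    have "?g = 0" "(\<Sum>k<n. x k *\<^sub>R b k) = 0"
      using rigid_zero_of_two_points[OF _ _ pq(3) rigid, of "\<Sum>k<n. x k *\<^sub>R b k"] u pq by auto
    then show ?thesis using u[OF r] by simp
  qed
  have column: "\<forall>j\<le>42. u (grid i j) = 0" if "i \<le> 84" for i
    using that
  proof (induction i)
    case 0
    have "\<phi> k (grid 0 j) = 0" if "k < n" "j \<le> 42" for k j
    proof -
      have "grid 0 j \<in> Dirichlet_boundary" using that by (simp add: Dirichlet_boundary_def mem_Omega)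
      then show ?thesis using phi_V[OF that(1)] unfolding V_h_def by blast
    qed
    then show ?case by (simp add: u_def)
  next
    case (Suc i)
    have i: "i < 84" using Suc.prems by simp
    have IH: "u (grid i j) = 0" if "j \<le> 42" for j using Suc that by simp
    have step: "u (grid (i+1) j) = 0 \<and> u (grid (i+1) (j+1)) = 0" if j: "j < 42" for j
    \<comment> \<open>The order depends on the diagonal: the triangle with an edge in column
      \<open>i\<close> is treated before the other one, whose second zero is the vertex just
      gained.\<close>
    proof (cases d)
      case True
      have "u (grid (i+1) (j+1)) = 0"
        by (rule u_zero[of "cell_tri d False i j" "grid i j" "grid i (j+1)"])
          (use IH j cell_tri_in_mesh[OF i j, of d False] True in \<open>auto simp: grid_mem_cell_tri\<close>)
      moreover have "u (grid (i+1) j) = 0"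
        by (rule u_zero[of "cell_tri d True i j" "grid i j" "grid (i+1) (j+1)"])
          (use IH j cell_tri_in_mesh[OF i j, of d True] True calculation in \<open>auto simp: grid_mem_cell_tri\<close>)
      ultimately show ?thesis by simp
    next
      case False
      have "u (grid (i+1) j) = 0"
        by (rule u_zero[of "cell_tri d True i j" "grid i j" "grid i (j+1)"])
          (use IH j cell_tri_in_mesh[OF i j, of d True] False in \<open>auto simp: grid_mem_cell_tri\<close>)
      moreover have "u (grid (i+1) (j+1)) = 0"
        by (rule u_zero[of "cell_tri d False i j" "grid i (j+1)" "grid (i+1) j"])
          (use IH j cell_tri_in_mesh[OF i j, of d False] False calculation in \<open>auto simp: grid_mem_cell_tri\<close>)
      ultimately show ?thesis by simp
    qed
    show ?case
    proof (intro allI impI)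
      fix j :: nat assume "j \<le> 42"
      \<comment> \<open>The top node of the column is reached as an upper corner of the last row of
        cells.\<close>
      then consider "j < 42" | "j = 41 + 1" by linarith
      then show "u (grid (Suc i) j) = 0" using step[of j] step[of 41] by cases simp_all
    qed
  qed
  obtain p c where pc: "dof k = (p, c)" by force
  have p: "p \<in> mesh_nodes" using dof_node[OF k] pc by simp
  then obtain i j where "i \<le> 84" "j \<le> 42" "p = grid i j" by (auto simp: mesh_nodes_def)
  then have "u p = 0" using column by blast
  have "dof l = (p, c) \<longleftrightarrow> l = k" if "l < n" for l
    using basis k that pc by (auto simp: nodal_basis_def bij_betw_def inj_on_def)
  then have "(\<Sum>l<n. x l * \<phi> l p $ c) = (\<Sum>l<n. if l = k then x k else 0)"
    using p by (intro sum.cong refl) (auto simp: phi_node)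
  also have "(\<Sum>l<n. x l * \<phi> l p $ c) = u p $ c" by (simp add: u_def)
  finally show ?thesis using k \<open>u p = 0\<close> by simp
qed

text \<open>Otherwise the basis function would be a rigid motion on a triangle at its own node,
  vanishing at the other two vertices, hence zero against its value 1. This positivity makes the
  \<open>k\<close>-scaling invertible.\<close>

lemma energy_diag_pos:
  assumes s: "s \<in> {1..8}" and k: "k \<in> set (S s)"
  shows "0 < energy (\<T> s) k k"
proof (rule ccontr)
  assume neg: "\<not> 0 < energy (\<T> s) k k"
  have kn: "k < n" and "fst (dof k) \<in> subdomain \<T> s" using dofs s k by auto
  then obtain T where T: "T \<in> \<T> s" "fst (dof k) \<in> T" by (auto simp: subdomain_def)
  have Tm: "T \<in> mesh d" using T part[OF s] by blast
  have "0 \<le> energy (\<T> s) k k"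
    using energy_nonneg[OF part[OF s], of "{k}" "\<lambda>_. 1"] kn by simp
  then have z: "(\<Sum>i\<in>{k}. \<Sum>l\<in>{k}. 1 * energy (\<T> s) i l * 1) = 0" using neg by simp
  have rigid: "\<forall>i j. sym_grad (grad_phi T k) i j = 0"
    using energy_zero_imp_rigid[where x = "\<lambda>_. 1", OF part[OF s] _ z T(1)] kn by simp
  obtain b where b: "\<And>x. x \<in> T \<Longrightarrow> \<phi> k x = grad_phi T k *v x + b"
    using mesh_grad[OF phi_V[OF kn] Tm] by blast
  obtain p q r where pqr: "area2 p q r \<noteq> 0" "T \<inter> mesh_nodes = {p, q, r}" using Tm by (rule mesh_triangle)
  then have "p \<noteq> q" "q \<noteq> r" "p \<noteq> r" by (auto simp: area2_def)
  moreover have "fst (dof k) \<in> {p, q, r}" using dof_node[OF kn] T(2) pqr(2) by blast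
  ultimately obtain v w where vw: "v \<in> {p, q, r}" "w \<in> {p, q, r}" "v \<noteq> w" "v \<noteq> fst (dof k)" "w \<noteq> fst (dof k)"
    by blast
  have z0: "grad_phi T k *v v + b = 0" if "v \<in> {p, q, r}" "v \<noteq> fst (dof k)" for v
    using phi_other_node[OF kn _ that(2)] b[of v] that(1) pqr(2) by (metis IntE)
  have "grad_phi T k = 0" "b = 0"
    using rigid_zero_of_two_points[OF z0[OF vw(1,4)] z0[OF vw(2,5)] vw(3) rigid] by auto
  then have "\<phi> k (fst (dof k)) = 0" using b[OF T(2)] by simp
  moreover have "\<phi> k (fst (dof k)) $ snd (dof k) = 1" using phi_node[OF kn dof_node[OF kn]] by simp
  ultimately show False by simp
qed

text \<open>On a triangle that does not contain the node of \<open>k\<close>, the basis function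
  vanishes at all three vertices and so has zero gradient. This lets sums over the degrees of
  freedom of a subdomain run over all of them.\<close>

lemma energy_outside:
  assumes s: "s \<in> {1..8}" and k: "k < n" "k \<notin> set (S s)" and l: "l < n"
  shows "energy (\<T> s) k l = 0"
proof -
  have "grad_phi T k = 0" if "T \<in> \<T> s" for T
  proof -
    have Tm: "T \<in> mesh d" using that part[OF s] by blast
    obtain b where b: "\<And>x. x \<in> T \<Longrightarrow> \<phi> k x = grad_phi T k *v x + b"
      using mesh_grad[OF phi_V[OF k(1)] Tm] by blast
    obtain p q r where pqr: "area2 p q r \<noteq> 0" "T \<inter> mesh_nodes = {p, q, r}" using Tm by (rule mesh_triangle)
    have "fst (dof k) \<notin> T" using dofs s k that by (auto simp: subdomain_def)
    then have "grad_phi T k *v v + b = 0" if "v \<in> {p, q, r}" for v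
      using phi_other_node[OF k(1), of v] b[of v] that pqr(2) by (metis IntE)
    then show ?thesis using affine_zero_of_three_points(1)[of _ p b q r] pqr(1) by blast
  qed
  then show ?thesis by (simp add: energy_eq[OF part[OF s] k(1) l])
qed

text \<open>The triangles are partitioned among the subdomains, so the weighted sums add up exactly,
  with no interface contributions.\<close>

lemma energy_mesh:
  assumes "k < n" "l < n"
  shows "energy (mesh d) k l = (\<Sum>s\<in>{1..8}. energy (\<T> s) k l)"
proof -
  let ?f = "\<lambda>T. cform (grad_phi T k) (grad_phi T l) * integral T E"
  have m: "mesh d = (\<Union>s\<in>{1..8}. \<T> s)" and dis: "disjoint_family_on \<T> {1..8}"
    using decomp by (auto simp: decomposition_def)
  have fin: "\<forall>s\<in>{1..8}. finite (\<T> s)" using part finite_subset[OF _ finite_mesh] by blast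
  have "(\<Sum>T\<in>(\<Union>s\<in>{1..8}. \<T> s). ?f T) = (\<Sum>s\<in>{1..8}. \<Sum>T\<in>\<T> s. ?f T)"
    using fin dis by (intro sum.UNION_disjoint) (auto simp: disjoint_family_on_def)
  also have "\<dots> = (\<Sum>s\<in>{1..8}. energy (\<T> s) k l)"
    by (intro sum.cong refl energy_eq[OF part assms, symmetric])
  finally have "(\<Sum>T\<in>mesh d. ?f T) = (\<Sum>s\<in>{1..8}. energy (\<T> s) k l)" unfolding m .
  then show ?thesis by (simp only: energy_eq[OF subset_refl assms])
qed

lemma dof_covered:
  assumes "k < n"
  shows "\<exists>s\<in>{1..8}. k \<in> set (S s)"
proof -
  have "fst (dof k) \<in> Omega" using dof_node[OF assms] by (auto simp: mesh_nodes_def mem_Omega)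
  then obtain T where "T \<in> mesh d" "fst (dof k) \<in> T" using Union_mesh by blast
  moreover have "mesh d = (\<Union>s\<in>{1..8}. \<T> s)" using decomp by (simp add: decomposition_def)
  ultimately obtain s where "s \<in> {1..8}" "fst (dof k) \<in> subdomain \<T> s"
    unfolding subdomain_def by blast
  then show ?thesis using dofs assms by blast
qed

end

notation Matrix.vec_index (infixl "$" 100)
no_notation Finite_Cartesian_Product.vec_nth (infixl "$" 90)

section \<open>Spectral coarse spaces\<close>

lemma scalar_prod_self_eq_0:
  assumes "v \<in> carrier_vec m" "sp v v = 0"
  shows "v = 0\<^sub>v m"
proof (rule eq_vecI)
  fix i assume "i < dim_vec (0\<^sub>v m)"
  then have i: "i < m" by simp
  have "(\<Sum>i<m. v $ i * v $ i) = 0" using assms by (simp add: scalar_prod_def lessThan_atLeast0)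
  then have "\<forall>i\<in>{..<m}. v $ i * v $ i = 0" by (subst (asm) sum_nonneg_eq_0_iff) auto
  then show "v $ i = 0\<^sub>v m $ i" using i by simp
qed (use assms in auto)

text \<open>For \<open>z = M x\<close> the number \<open>bil M z x\<close> is the squared length of
  \<open>z\<close>, while Young's inequality bounds it by an arbitrarily small multiple of
  \<open>bil M z z\<close>.\<close>

lemma sym_psd_null:
  assumes M: "sym_psd m M" and x: "x \<in> carrier_vec m" "bil M x x = 0"
  shows "M *\<^sub>v x = 0\<^sub>v m"
proof -
  have M': "M \<in> carrier_mat m m" using M by (simp add: sym_psd_def)
  define z where "z = M *\<^sub>v x"
  have z: "z \<in> carrier_vec m" using M' x by (simp add: z_def)
  have le: "2 * bil M z x \<le> c * bil M z z" if "0 < c" for c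
    using sym_psd_young[OF M z x(1) that] x(2) by simp
  have "bil M z x \<le> 0"
  proof (rule ccontr)
    assume "\<not> bil M z x \<le> 0"
    then have a: "0 < bil M z x" by simp
    then have "0 < bil M z z" using le[of 1] by simp
    \<comment> \<open>This weight turns the bound into \<open>2 a \<le> a\<close> for the positive
      number \<open>a = bil M z x\<close>.\<close>
    then show False using le[of "bil M z x / bil M z z"] a by simp
  qed
  moreover have "bil M z x = sp z z" by (simp add: bil_def z_def)
  moreover have "0 \<le> sp z z" by (simp add: scalar_prod_def sum_nonneg)
  ultimately have "sp z z = 0" by simp
  then show ?thesis using scalar_prod_self_eq_0[OF z] by (simp add: z_def)
qed

lemma vspan_cols:
  assumes "W \<in> carrier_mat m q"
  shows "vspan m (set (cols W)) = {W *\<^sub>v x | x. x \<in> carrier_vec q}"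
proof -
  interpret vec_space "TYPE(real)" m .
  have d: "dim_row W = m" "dim_col W = q" using assms by auto
  have "vspan m (set (cols W)) = {y \<in> carrier_vec m. \<exists>x\<in>carrier_vec q. W *\<^sub>v x = y}"
    using col_space_eq[OF assms] unfolding col_space_def vspan_def d .
  also have "\<dots> = {W *\<^sub>v x | x. x \<in> carrier_vec q}"
  proof (intro equalityI subsetI)
    fix y assume "y \<in> {W *\<^sub>v x | x. x \<in> carrier_vec q}"
    then obtain x where "y = W *\<^sub>v x" "x \<in> carrier_vec q" by blast
    then show "y \<in> {y \<in> carrier_vec m. \<exists>x\<in>carrier_vec q. W *\<^sub>v x = y}"
      using mult_mat_vec_carrier[OF assms] by auto
  qed auto
  finally show ?thesis .
qed

text \<open>On the part with eigenvalues at least \<open>inverse \<tau>\<close>, the form of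
  \<open>B\<close> is at most \<open>\<tau>\<close> times that of \<open>M\<close>; by orthogonality
  the \<open>M\<close>-energy of this part does not exceed that of \<open>y\<close>.\<close>

lemma split_low:
  assumes M: "sym_psd m M" and B: "sym_pd m B" and \<tau>: "\<tau> > 0" and y: "y \<in> carrier_vec m"
  shows "\<exists>y0 y1. y0 \<in> Y_L (inverse \<tau>) M B \<and> y0 \<in> carrier_vec m \<and> y1 \<in> carrier_vec m
    \<and> y = y0 + y1 \<and> bil B y1 y1 \<le> \<tau> * bil M y y"
proof -
  interpret pencil m M B using M B by unfold_locales (auto simp: sym_psd_def)
  obtain yL yH where *: "yL \<in> Y_L (inverse \<tau>) M B" "yL \<in> carrier_vec m" "yH \<in> carrier_vec m"
    "y = yL + yH" "bil M yL yH = 0" "inverse \<tau> * bil B yH yH \<le> bil M yH yH"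
    using split_at[OF y, of "inverse \<tau>"] by (elim exE conjE) (rule that)
  have "bil M y y = bil M yL yL + bil M yH yH"
    using *(2-5) MA bil_sym[OF MA *(2,3)] by (simp add: bil_linear[of M m m])
  moreover have "0 \<le> bil M yL yL" using M *(2) by (simp add: sym_psd_def)
  ultimately have "inverse \<tau> * bil B yH yH \<le> bil M y y" using *(6) by simp
  then have "bil B yH yH \<le> \<tau> * bil M y y" using \<tau> by (simp add: field_simps)
  then show ?thesis using *(1-4) by (intro exI conjI)
qed

text \<open>The two matrices of the pencil are exchanged relative to \<open>split_low\<close>, so
  \<open>M\<close> stands where definiteness is required. Compression to the range of
  \<open>M\<close> restores it, and the kernel goes to the coarse space separately. The part left to
  the local solvers is now the low one, where \<open>B\<close> is at most \<open>\<tau>\<close>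
  times \<open>M\<close>.\<close>

lemma split_high:
  assumes M: "sym_psd m M" and B: "sym_pd m B" and \<tau>: "\<tau> > 0" and y: "y \<in> carrier_vec m"
    and W: "orthonormal_range_basis W M"
  shows "\<exists>k w y1. k \<in> mat_kernel M \<and> k \<in> carrier_vec m
    \<and> w \<in> Y_H \<tau> (W\<^sup>T * B * W) (W\<^sup>T * M * W) \<and> W *\<^sub>v w \<in> carrier_vec m \<and> y1 \<in> carrier_vec m
    \<and> y = k + W *\<^sub>v w + y1 \<and> bil B y1 y1 \<le> \<tau> * bil M y y"
proof -
  define q where "q = dim_col W"
  have M': "M \<in> carrier_mat m m" "M\<^sup>T = M" using M by (auto simp: sym_psd_def)
  have B': "B \<in> carrier_mat m m" "B\<^sup>T = B" using B by (auto simp: sym_pd_def)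
  have dM: "dim_row M = m" "dim_col M = m" using M' by auto
  from W have dW: "dim_row W = m" and WW: "W\<^sup>T * W = 1\<^sub>m q"
    and span: "vspan m (set (cols W)) = mat_range M"
    unfolding orthonormal_range_basis_def q_def dM by auto
  have Wc: "W \<in> carrier_mat m q" using dW by (auto simp: q_def)
  have rng: "{W *\<^sub>v x | x. x \<in> carrier_vec q} = {M *\<^sub>v x | x. x \<in> carrier_vec m}"
    using span unfolding vspan_cols[OF Wc] mat_range_def dM .
  have MW: "\<exists>x\<in>carrier_vec q. M *\<^sub>v z = W *\<^sub>v x" if "z \<in> carrier_vec m" for z
  proof -
    have "M *\<^sub>v z \<in> {W *\<^sub>v x | x. x \<in> carrier_vec q}" unfolding rng using that by blast
    then show ?thesis by blast
  qed
  have WM: "\<exists>z\<in>carrier_vec m. W *\<^sub>v x = M *\<^sub>v z" if "x \<in> carrier_vec q" for x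
  proof -
    have "W *\<^sub>v x \<in> {M *\<^sub>v x | x. x \<in> carrier_vec m}" unfolding rng[symmetric] using that by blast
    then show ?thesis by blast
  qed
  have WTW: "W\<^sup>T *\<^sub>v (W *\<^sub>v x) = x" if "x \<in> carrier_vec q" for x
    using Wc WW that assoc_mult_mat_vec[of "W\<^sup>T" q m W q x] by simp
  have inj: "x = 0\<^sub>v q" if "x \<in> carrier_vec q" "W *\<^sub>v x = 0\<^sub>v m" for x
    using WTW[OF that(1)] that(2) Wc by (simp add: mult_mat_zero_vec[of _ q m])
  \<comment> \<open>The orthogonal complement of the range of a symmetric matrix is its
    kernel.\<close>
  have kernel: "M *\<^sub>v k = 0\<^sub>v m" if k: "k \<in> carrier_vec m" "W\<^sup>T *\<^sub>v k = 0\<^sub>v q" for k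
  proof -
    have Mk: "M *\<^sub>v k \<in> carrier_vec m" using M' k by simp
    then obtain x where x: "x \<in> carrier_vec q" "M *\<^sub>v (M *\<^sub>v k) = W *\<^sub>v x" using MW by blast
    have "sp (M *\<^sub>v k) (M *\<^sub>v k) = sp (M *\<^sub>v (M *\<^sub>v k)) k"
      using M' k Mk sp_mult_mat_left[of M m m "M *\<^sub>v k" k] by simp
    also have "\<dots> = 0" using x Wc k by (simp add: sp_mult_mat_left[of W m q])
    finally show ?thesis using scalar_prod_self_eq_0[OF Mk] by simp
  qed
  let ?A = "W\<^sup>T * B * W" and ?B = "W\<^sup>T * M * W"
  have A: "sym_pd q ?A" using sym_pd_conj[OF B Wc] inj by blast
  have A': "?A \<in> carrier_mat q q" "?A\<^sup>T = ?A" using A by (auto simp: sym_pd_def)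
  have B2: "sym_pd q ?B"
  proof -
    have "?B\<^sup>T = W\<^sup>T * (W\<^sup>T * M)\<^sup>T" using M' Wc by (intro transpose_mult) auto
    also have "(W\<^sup>T * M)\<^sup>T = M * W" using M' Wc transpose_mult[of "W\<^sup>T" q m M m] by simp
    also have "W\<^sup>T * (M * W) = ?B" using M' Wc by (intro assoc_mult_mat[symmetric]) auto
    finally have sym: "?B\<^sup>T = ?B" .
    \<comment> \<open>A null vector of \<open>M\<close> that lies in the range of \<open>M\<close>
      is orthogonal to itself.\<close>
    have pos: "0 < bil ?B x x" if x: "x \<in> carrier_vec q" "x \<noteq> 0\<^sub>v q" for x
    proof (rule ccontr)
      assume neg: "\<not> 0 < bil ?B x x"
      have e: "bil ?B x x = bil M (W *\<^sub>v x) (W *\<^sub>v x)" using bil_conj[OF M'(1) Wc x(1) x(1)] .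
      have Wx: "W *\<^sub>v x \<in> carrier_vec m" using Wc x by simp
      then have "bil M (W *\<^sub>v x) (W *\<^sub>v x) = 0" using M neg e by (force simp: sym_psd_def)
      then have null: "M *\<^sub>v (W *\<^sub>v x) = 0\<^sub>v m" using sym_psd_null[OF M Wx] by simp
      obtain z where z: "z \<in> carrier_vec m" "W *\<^sub>v x = M *\<^sub>v z" using WM[OF x(1)] by blast
      have "sp (W *\<^sub>v x) (W *\<^sub>v x) = sp z (M *\<^sub>v (W *\<^sub>v x))"
        using z Wx M' sp_mult_mat_left[of M m m z "W *\<^sub>v x"] by simp
      also have "\<dots> = 0" using null z by simp
      finally have "W *\<^sub>v x = 0\<^sub>v m" using scalar_prod_self_eq_0[OF Wx] by simp
      then show False using inj x by blast
    qed
    show ?thesis unfolding sym_pd_def using sym pos Wc M' by auto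
  qed
  interpret pencil q ?A ?B using A' B2 by unfold_locales auto
  define c where "c = W\<^sup>T *\<^sub>v y"
  have c: "c \<in> carrier_vec q" using Wc y by (simp add: c_def)
  obtain wL wH where w: "wH \<in> Y_H \<tau> ?A ?B" "wL \<in> carrier_vec q" "wH \<in> carrier_vec q"
    "c = wL + wH" "bil ?B wL wH = 0" "bil ?A wL wL \<le> \<tau> * bil ?B wL wL"
    using split_at[OF c, of \<tau>] by (elim exE conjE) (rule that)
  \<comment> \<open>\<open>W * W\<^sup>T\<close> is the orthogonal projection onto the range of
    \<open>M\<close>, so \<open>k\<close> is the kernel component of \<open>y\<close>.\<close>
  define k where "k = y - W *\<^sub>v c"
  have Wv: "W *\<^sub>v x \<in> carrier_vec m" if "x \<in> carrier_vec q" for x using Wc that by simp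
  have k: "k \<in> carrier_vec m" using y Wv[OF c] by (simp add: k_def)
  have "W\<^sup>T *\<^sub>v k = c - c"
    unfolding k_def using Wc y Wv[OF c] WTW[OF c]
    by (simp add: mult_minus_distrib_mat_vec[of _ q m] c_def[symmetric])
  then have "W\<^sup>T *\<^sub>v k = 0\<^sub>v q" using c by simp
  then have Mk: "M *\<^sub>v k = 0\<^sub>v m" using kernel[OF k] by simp
  have "y = k + W *\<^sub>v c" using y Wv[OF c] dW by (auto simp: k_def intro!: eq_vecI)
  have Wadd: "W *\<^sub>v c = W *\<^sub>v wL + W *\<^sub>v wH"
    using Wc w by (simp add: mult_add_distrib_mat_vec[of W m q])
  have yeq: "y = k + W *\<^sub>v wH + W *\<^sub>v wL"
    using \<open>y = k + W *\<^sub>v c\<close> k Wv[OF w(2)] Wv[OF w(3)] unfolding Wadd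
    by (auto simp: comm_add_vec[of "W *\<^sub>v wL" m] assoc_add_vec[of _ m])
  have "bil M y y = bil M (W *\<^sub>v c) (W *\<^sub>v c)"
  proof -
    have k0: "bil M x k = 0" if "x \<in> carrier_vec m" for x using that by (simp add: bil_def Mk)
    have "bil M (k + W *\<^sub>v c) (k + W *\<^sub>v c) = bil M (W *\<^sub>v c) (W *\<^sub>v c)"
      using k Wv[OF c] M' k0[OF k] k0[OF Wv[OF c]] bil_sym[OF M' k Wv[OF c]]
      by (simp add: bil_linear[of M m m])
    then show ?thesis using \<open>y = k + W *\<^sub>v c\<close> by simp
  qed
  also have "\<dots> = bil ?B c c" using bil_conj[OF M'(1) Wc c c] by simp
  also have "\<dots> = bil ?B wL wL + bil ?B wH wH"
    unfolding w(4) using w(2,3,5) MB' bil_sym[OF MB' w(2,3)] by (simp add: bil_linear[of ?B q q])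
  finally have "bil ?B wL wL \<le> bil M y y" using sym_pd_nonneg[OF B2 w(3)] by simp
  then have "\<tau> * bil ?B wL wL \<le> \<tau> * bil M y y" using \<tau> by simp
  then have "bil B (W *\<^sub>v wL) (W *\<^sub>v wL) \<le> \<tau> * bil M y y"
    using w(6) bil_conj[OF B'(1) Wc w(2) w(2)] by simp
  moreover have "k \<in> mat_kernel M" using k Mk M' by (simp add: mat_kernel_def)
  ultimately show ?thesis using w(1) k Wv[OF w(2)] Wv[OF w(3)] yeq by (intro exI conjI)
qed

section \<open>Diagonal matrices and congruences\<close>

definition diagm :: "nat \<Rightarrow> (nat \<Rightarrow> real) \<Rightarrow> real mat" where
  "diagm m f = Matrix.mat m m (\<lambda>(i, j). if i = j then f i else 0)"

lemma diagm_carrier [simp]: "diagm m f \<in> carrier_mat m m"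
  by (simp add: diagm_def)

lemma diagm_mult_vec:
  assumes "x \<in> carrier_vec m"
  shows "diagm m f *\<^sub>v x = Matrix.vec m (\<lambda>i. f i * x $ i)"
proof (rule eq_vecI)
  fix i assume "i < dim_vec (Matrix.vec m (\<lambda>i. f i * x $ i))"
  then have i: "i < m" by simp
  have "(diagm m f *\<^sub>v x) $ i = (\<Sum>j<m. if j = i then f i * x $ i else 0)"
    using i assms
    by (simp add: diagm_def scalar_prod_def lessThan_atLeast0 if_distrib[of "\<lambda>c. c * _"] cong: if_cong)
  then show "(diagm m f *\<^sub>v x) $ i = Matrix.vec m (\<lambda>i. f i * x $ i) $ i" using i by simp
qed (simp add: diagm_def)

lemma minv_diagm:
  assumes "\<And>i. i < m \<Longrightarrow> f i \<noteq> 0"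
  shows "minv (diagm m f) = diagm m (\<lambda>i. inverse (f i))"
proof -
  have eq: "diagm m f * diagm m g = 1\<^sub>m m" if "\<And>i. i < m \<Longrightarrow> f i * g i = 1" for f g
  proof (rule mat_eq_of_mult_vec)
    fix u :: "real Matrix.vec" assume u: "u \<in> carrier_vec m"
    have "(diagm m f * diagm m g) *\<^sub>v u = diagm m f *\<^sub>v (diagm m g *\<^sub>v u)"
      by (rule assoc_mult_mat_vec[OF diagm_carrier diagm_carrier u])
    also have "\<dots> = 1\<^sub>m m *\<^sub>v u"
      using u that by (auto simp: diagm_mult_vec mult.assoc[symmetric] intro!: eq_vecI)
    finally show "(diagm m f * diagm m g) *\<^sub>v u = 1\<^sub>m m *\<^sub>v u" .
  qed (use mult_carrier_mat[OF diagm_carrier diagm_carrier] in auto)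
  show ?thesis
    by (rule minvI[OF diagm_carrier diagm_carrier]; rule eq) (use assms in auto)
qed

lemma sym_psd_conj:
  assumes A: "sym_psd n A" and B: "B \<in> carrier_mat n k"
  shows "sym_psd k (B\<^sup>T * A * B)"
proof -
  have A': "A \<in> carrier_mat n n" "A\<^sup>T = A" using A by (auto simp: sym_psd_def)
  have "(B\<^sup>T * A * B)\<^sup>T = B\<^sup>T * (B\<^sup>T * A)\<^sup>T" using A' B by (intro transpose_mult) auto
  also have "(B\<^sup>T * A)\<^sup>T = A * B" using A' B transpose_mult[of "B\<^sup>T" k n A n] by simp
  also have "B\<^sup>T * (A * B) = B\<^sup>T * A * B" using A' B by (intro assoc_mult_mat[symmetric]) auto
  finally have sym: "(B\<^sup>T * A * B)\<^sup>T = B\<^sup>T * A * B" .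
  have "0 \<le> bil (B\<^sup>T * A * B) x x" if "x \<in> carrier_vec k" for x
    using A B that unfolding bil_conj[OF A'(1) B that that] sym_psd_def by simp
  then show ?thesis unfolding sym_psd_def using sym A' B by auto
qed

section \<open>Stiffness, Neumann, restriction and scaling matrices\<close>

context elasticity_fe
begin

abbreviation "stiff \<equiv> stiffness E n \<phi>"
abbreviation "restr \<equiv> \<lambda>s. restriction n (S s)"
abbreviation "neum \<equiv> \<lambda>s. neumann E (subdomain \<T> s) \<phi> (S s)"
abbreviation "sz s \<equiv> length (S s)"

lemma stiff: "stiff \<in> carrier_mat n n" "i < n \<Longrightarrow> j < n \<Longrightarrow> stiff $$ (i, j) = energy (mesh d) i j"
  by (simp_all add: stiffness_def energy_def Union_mesh)

lemma neum: "neum s \<in> carrier_mat (sz s) (sz s)"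
  "i < sz s \<Longrightarrow> j < sz s \<Longrightarrow> neum s $$ (i, j) = energy (\<T> s) (S s ! i) (S s ! j)"
  by (simp_all add: neumann_def energy_def subdomain_def)

lemma restr: "restr s \<in> carrier_mat (sz s) n"
  by (simp add: restriction_def)

lemma S_sub: "s \<in> {1..8} \<Longrightarrow> set (S s) \<subseteq> {..<n}"
  using dofs by auto

lemma S_nth: "s \<in> {1..8} \<Longrightarrow> i < sz s \<Longrightarrow> S s ! i < n"
  using S_sub nth_mem by blast

lemma S_bij: "s \<in> {1..8} \<Longrightarrow> bij_betw ((!) (S s)) {..<sz s} (set (S s))"
  using dofs by (intro bij_betw_nth) auto

lemma sum_S:
  assumes "s \<in> {1..8}"
  shows "(\<Sum>i<sz s. f (S s ! i)) = (\<Sum>k<n. if k \<in> set (S s) then f k else 0)"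
proof -
  have "(\<Sum>i<sz s. f (S s ! i)) = sum f (set (S s))" by (rule sum.reindex_bij_betw[OF S_bij[OF assms]])
  also have "\<dots> = (\<Sum>k<n. if k \<in> set (S s) then f k else 0)"
    using S_sub[OF assms] by (simp add: sum.If_cases Int_absorb1)
  finally show ?thesis .
qed

lemma double_sum_S:
  assumes "s \<in> {1..8}"
  shows "(\<Sum>i<sz s. \<Sum>j<sz s. f (S s ! i) (S s ! j)) = (\<Sum>k\<in>set (S s). \<Sum>l\<in>set (S s). f k l)"
proof -
  have "(\<Sum>i<sz s. \<Sum>j<sz s. f (S s ! i) (S s ! j)) = (\<Sum>i<sz s. \<Sum>l\<in>set (S s). f (S s ! i) l)"
    by (rule sum.cong[OF refl]) (rule sum.reindex_bij_betw[OF S_bij[OF assms]])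
  also have "\<dots> = (\<Sum>k\<in>set (S s). \<Sum>l\<in>set (S s). f k l)"
    by (rule sum.reindex_bij_betw[OF S_bij[OF assms]])
  finally show ?thesis .
qed

lemma restr_mult_vec:
  assumes "s \<in> {1..8}" "x \<in> carrier_vec n"
  shows "restr s *\<^sub>v x = Matrix.vec (sz s) (\<lambda>i. x $ (S s ! i))"
proof (rule eq_vecI)
  fix i assume "i < dim_vec (Matrix.vec (sz s) (\<lambda>i. x $ (S s ! i)))"
  then have i: "i < sz s" by simp
  have "(restr s *\<^sub>v x) $ i = (\<Sum>j<n. if j = S s ! i then x $ j else 0)"
    using i assms(2)
    by (simp add: restriction_def scalar_prod_def lessThan_atLeast0 if_distrib[of "\<lambda>c. c * _"] cong: if_cong)
  then show "(restr s *\<^sub>v x) $ i = Matrix.vec (sz s) (\<lambda>i. x $ (S s ! i)) $ i"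
    using i S_nth[OF assms(1) i] by simp
qed (simp add: restriction_def)

lemma restr_conj_index:
  assumes s: "s \<in> {1..8}" and X: "X \<in> carrier_mat n n" and ij: "i < sz s" "j < sz s"
  shows "(restr s * X * (restr s)\<^sup>T) $$ (i, j) = X $$ (S s ! i, S s ! j)"
proof -
  have Y: "restr s * X \<in> carrier_mat (sz s) n" using restr[of s] X by simp
  have RX: "(restr s * X) $$ (i, l) = X $$ (S s ! i, l)" if l: "l < n" for l
  proof -
    have "(restr s * X) $$ (i, l) = (\<Sum>k<n. if k = S s ! i then X $$ (k, l) else 0)"
      using ij l X
      by (simp add: restriction_def scalar_prod_def lessThan_atLeast0 if_distrib[of "\<lambda>c. c * _"] cong: if_cong)
    then show ?thesis using S_nth[OF s ij(1)] by simp
  qed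
  have "(restr s * X * (restr s)\<^sup>T) $$ (i, j) = (\<Sum>l<n. (restr s * X) $$ (i, l) * restr s $$ (j, l))"
    using ij X Y restr[of s] by (simp add: scalar_prod_def lessThan_atLeast0 del: assoc_mult_mat)
  also have "\<dots> = (\<Sum>l<n. if l = S s ! j then X $$ (S s ! i, l) else 0)"
    using ij RX by (intro sum.cong) (auto simp: restriction_def)
  finally show ?thesis using S_nth[OF s ij(2)] by simp
qed

text \<open>\<open>restr s\<close> is onto, so its transpose is injective: with
  \<open>y = restr s *\<^sub>v v\<close>, the square of \<open>y\<close> is the pairing of the
  transposed image of \<open>y\<close> with \<open>v\<close>.\<close>

lemma restr_transpose_inj:
  assumes s: "s \<in> {1..8}" and y: "y \<in> carrier_vec (sz s)" "(restr s)\<^sup>T *\<^sub>v y = 0\<^sub>v n"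
  shows "y = 0\<^sub>v (sz s)"
proof -
  \<comment> \<open>An extension of \<open>y\<close> to all degrees of freedom; its entries off the
    subdomain are arbitrary and are erased by \<open>restr s\<close>.\<close>
  define v where "v = Matrix.vec n (\<lambda>k. y $ inv_into {..<sz s} ((!) (S s)) k)"
  have v: "v \<in> carrier_vec n" by (simp add: v_def)
  have "v $ (S s ! i) = y $ i" if "i < sz s" for i
    using S_bij[OF s] that S_nth[OF s that] by (simp add: v_def bij_betw_def inv_into_f_f)
  then have "restr s *\<^sub>v v = y" unfolding restr_mult_vec[OF s v] using y(1) by (intro eq_vecI) auto
  then have "sp y y = sp y (restr s *\<^sub>v v)" by simp
  also have "\<dots> = sp ((restr s)\<^sup>T *\<^sub>v y) v"
    using y(1) v restr[of s] by (simp add: sp_mult_mat_left[of _ n "sz s"])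
  also have "\<dots> = 0" using v by (simp add: y(2))
  finally show ?thesis using scalar_prod_self_eq_0[OF y(1)] by simp
qed

lemma stiff_pd: "sym_pd n stiff"
proof -
  have b: "bil stiff x x = (\<Sum>k<n. \<Sum>l<n. x $ k * energy (mesh d) k l * x $ l)" if "x \<in> carrier_vec n" for x
    unfolding bil_mat_sum[OF stiff(1) that that] by (intro sum.cong refl) (simp add: stiff(2))
  have "stiff\<^sup>T = stiff" using stiff energy_sym[OF subset_refl] by (intro eq_matI) auto
  moreover have "0 < bil stiff x x" if x: "x \<in> carrier_vec n" "x \<noteq> 0\<^sub>v n" for x
  proof (rule ccontr)
    assume neg: "\<not> 0 < bil stiff x x"
    have "0 \<le> bil stiff x x" unfolding b[OF x(1)] by (rule energy_nonneg) auto
    then have "(\<Sum>k<n. \<Sum>l<n. x $ k * energy (mesh d) k l * x $ l) = 0" using neg b[OF x(1)] by simp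
    then have "\<forall>k<n. x $ k = 0" using energy_definite[of "\<lambda>k. x $ k"] by blast
    then have "x = 0\<^sub>v n" using x(1) by (intro eq_vecI) auto
    then show False using x(2) by simp
  qed
  ultimately show ?thesis using stiff(1) by (auto simp: sym_pd_def)
qed

lemma local_pd:
  assumes "s \<in> {1..8}"
  shows "sym_pd (sz s) (restr s * stiff * (restr s)\<^sup>T)"
  using sym_pd_conj[OF stiff_pd, of "(restr s)\<^sup>T" "sz s"] restr restr_transpose_inj[OF assms] by simp

lemma neum_psd:
  assumes s: "s \<in> {1..8}"
  shows "sym_psd (sz s) (neum s)"
proof -
  have "(neum s)\<^sup>T = neum s"
  proof (rule eq_matI)
    fix i j assume "i < dim_row (neum s)" "j < dim_col (neum s)"
    then have ij: "i < sz s" "j < sz s" using neum(1)[of s] by auto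
    then have "neum s $$ (j, i) = neum s $$ (i, j)"
      using energy_sym[OF part[OF s] S_nth[OF s ij(1)] S_nth[OF s ij(2)]] by (simp add: neum(2))
    then show "(neum s)\<^sup>T $$ (i, j) = neum s $$ (i, j)" using ij neum(1)[of s] by simp
  qed (use neum(1)[of s] in auto)
  moreover have "0 \<le> bil (neum s) y y" if y: "y \<in> carrier_vec (sz s)" for y
  proof -
    define x where "x k = y $ inv_into {..<sz s} ((!) (S s)) k" for k
    have x: "x (S s ! i) = y $ i" if "i < sz s" for i
      using S_bij[OF s] that by (simp add: x_def bij_betw_def inv_into_f_f)
    have "bil (neum s) y y = (\<Sum>i<sz s. \<Sum>j<sz s. x (S s ! i) * energy (\<T> s) (S s ! i) (S s ! j) * x (S s ! j))"
      unfolding bil_mat_sum[OF neum(1) y y] by (intro sum.cong refl) (simp add: neum(2) x)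
    also have "\<dots> = (\<Sum>k\<in>set (S s). \<Sum>l\<in>set (S s). x k * energy (\<T> s) k l * x l)"
      by (rule double_sum_S[OF s])
    finally show ?thesis using energy_nonneg[OF part[OF s] S_sub[OF s]] by simp
  qed
  ultimately show ?thesis using neum(1) by (auto simp: sym_psd_def)
qed

text \<open>The Neumann matrices add up to \<open>A\<close>, in terms of quadratic forms: by
  \<open>energy_outside\<close> each local double sum may run over all degrees of freedom.\<close>

lemma sum_neum:
  assumes x: "x \<in> carrier_vec n"
  shows "(\<Sum>s\<in>{1..8}. bil (neum s) (restr s *\<^sub>v x) (restr s *\<^sub>v x)) = bil stiff x x"
proof -
  have "bil (neum s) (restr s *\<^sub>v x) (restr s *\<^sub>v x) = (\<Sum>k<n. \<Sum>l<n. x $ k * energy (\<T> s) k l * x $ l)"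
    if s: "s \<in> {1..8}" for s
  proof -
    have c: "restr s *\<^sub>v x \<in> carrier_vec (sz s)" using restr[of s] x by simp
    have e: "(restr s *\<^sub>v x) $ i = x $ (S s ! i)" if "i < sz s" for i
      using that by (simp add: restr_mult_vec[OF s x] del: index_mult_mat_vec)
    have "bil (neum s) (restr s *\<^sub>v x) (restr s *\<^sub>v x)
        = (\<Sum>i<sz s. \<Sum>j<sz s. x $ (S s ! i) * energy (\<T> s) (S s ! i) (S s ! j) * x $ (S s ! j))"
      unfolding bil_mat_sum[OF neum(1) c c]
      by (intro sum.cong refl) (simp add: neum(2) e del: index_mult_mat_vec)
    also have "\<dots> = (\<Sum>k\<in>set (S s). \<Sum>l\<in>set (S s). x $ k * energy (\<T> s) k l * x $ l)"
      by (rule double_sum_S[OF s])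
    also have "\<dots> = (\<Sum>k\<in>set (S s). \<Sum>l<n. x $ k * energy (\<T> s) k l * x $ l)"
    proof (rule sum.cong[OF refl])
      fix k assume "k \<in> set (S s)"
      then have k: "k < n" using S_sub[OF s] by blast
      have "energy (\<T> s) k l = 0" if "l < n" "l \<notin> set (S s)" for l
        using energy_outside[OF s that k] energy_sym[OF part[OF s] k that(1)] by simp
      then show "(\<Sum>l\<in>set (S s). x $ k * energy (\<T> s) k l * x $ l)
          = (\<Sum>l<n. x $ k * energy (\<T> s) k l * x $ l)"
        using S_sub[OF s] by (intro sum.mono_neutral_left) auto
    qed
    also have "\<dots> = (\<Sum>k<n. \<Sum>l<n. x $ k * energy (\<T> s) k l * x $ l)"
      using S_sub[OF s] energy_outside[OF s] by (intro sum.mono_neutral_left) (auto intro!: sum.neutral)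
    finally show ?thesis .
  qed
  then have "(\<Sum>s\<in>{1..8}. bil (neum s) (restr s *\<^sub>v x) (restr s *\<^sub>v x))
      = (\<Sum>s\<in>{1..8}. \<Sum>k<n. \<Sum>l<n. x $ k * energy (\<T> s) k l * x $ l)" by (rule sum.cong[OF refl])
  also have "\<dots> = (\<Sum>k<n. \<Sum>s\<in>{1..8}. \<Sum>l<n. x $ k * energy (\<T> s) k l * x $ l)" by (rule sum.swap)
  also have "\<dots> = (\<Sum>k<n. \<Sum>l<n. \<Sum>s\<in>{1..8}. x $ k * energy (\<T> s) k l * x $ l)"
    by (intro sum.cong refl sum.swap)
  also have "\<dots> = bil stiff x x"
    unfolding bil_mat_sum[OF stiff(1) x x]
    by (intro sum.cong refl) (simp add: stiff(2) energy_mesh sum_distrib_left sum_distrib_right)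
  finally show ?thesis .
qed

text \<open>The weights are indexed by global degrees of freedom, which makes both scalings
  instances of one notion. Positivity gives invertible \<open>D s\<close>, the unit sums give the
  partition of unity.\<close>

definition unity_weights :: "(nat \<Rightarrow> nat \<Rightarrow> real) \<Rightarrow> bool" where
  "unity_weights \<delta> \<longleftrightarrow> (\<forall>s\<in>{1..8}. \<forall>k\<in>set (S s). 0 < \<delta> s k)
     \<and> (\<forall>k<n. (\<Sum>s\<in>{1..8}. if k \<in> set (S s) then \<delta> s k else 0) = 1)"

text \<open>The diagonal entry of \<open>A\<close> at \<open>k\<close> is the sum of the local
  energies of \<open>\<phi> k\<close>, which vanish on subdomains without \<open>k\<close>; hence
  the quotients sum to 1.\<close>

lemma k_scaling_diag:
  "\<exists>\<delta>. unity_weights \<delta> \<and> (\<forall>s\<in>{1..8}. k_scaling stiff restr neum s = diagm (sz s) (\<lambda>i. \<delta> s (S s ! i)))"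
proof (intro exI conjI ballI)
  let ?\<delta> = "\<lambda>s k. energy (\<T> s) k k / energy (mesh d) k k"
  have nn: "0 \<le> energy (\<T> s) k k" if "s \<in> {1..8}" "k < n" for s k
    using energy_nonneg[OF part[OF that(1)], of "{k}" "\<lambda>_. 1"] that(2) by simp
  have pos: "0 < energy (mesh d) k k" if k: "k < n" for k
  proof -
    obtain s where s: "s \<in> {1..8}" "k \<in> set (S s)" using dof_covered[OF k] by blast
    have "0 < energy (\<T> s) k k" by (rule energy_diag_pos[OF s])
    also have "\<dots> \<le> (\<Sum>s\<in>{1..8}. energy (\<T> s) k k)"
      using s nn k by (intro member_le_sum) auto
    finally show ?thesis by (simp add: energy_mesh[OF k k])
  qed
  show "unity_weights ?\<delta>" unfolding unity_weights_def
  proof (intro conjI ballI allI impI)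
    fix s k assume s: "s \<in> {1..8}" and k: "k \<in> set (S s)"
    have "k < n" using S_sub[OF s] k by blast
    then show "0 < ?\<delta> s k" using energy_diag_pos[OF s k] pos by (intro divide_pos_pos)
  next
    fix k assume k: "k < n"
    have "(\<Sum>s\<in>{1..8}. if k \<in> set (S s) then ?\<delta> s k else 0) = (\<Sum>s\<in>{1..8}. ?\<delta> s k)"
      using energy_outside[OF _ k _ k] by (intro sum.cong refl) auto
    also have "\<dots> = energy (mesh d) k k / energy (mesh d) k k"
      by (simp only: sum_divide_distrib[symmetric] energy_mesh[OF k k])
    also have "\<dots> = 1" using pos[OF k] by simp
    finally show "(\<Sum>s\<in>{1..8}. if k \<in> set (S s) then ?\<delta> s k else 0) = 1" .
  qed
  fix s :: nat assume s: "s \<in> {1..8}"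
  show "k_scaling stiff restr neum s = diagm (sz s) (\<lambda>i. ?\<delta> s (S s ! i))"
    unfolding k_scaling_def diagm_def using neum(1)[of s] S_nth[OF s] restr_conj_index[OF s stiff(1)]
    by (intro eq_matI) (auto simp: stiff(2) neum(2) simp del: assoc_mult_mat)
qed

lemma multiplicity_scaling_diag:
  "\<exists>\<delta>. unity_weights \<delta> \<and> (\<forall>s\<in>{1..8}. multiplicity_scaling n restr s = diagm (sz s) (\<lambda>i. \<delta> s (S s ! i)))"
proof (intro exI conjI ballI)
  \<comment> \<open>The number of subdomains that contain the degree of freedom \<open>k\<close>;
    these numbers are the diagonal of the matrix inverted in the multiplicity scaling.\<close>
  define \<mu> where "\<mu> k = (\<Sum>s\<in>{1..8::nat}. if k \<in> set (S s) then 1 else 0 :: real)" for k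
  let ?\<delta> = "\<lambda>s k. inverse (\<mu> k)"
  have pos: "0 < \<mu> k" if k: "k < n" for k
  proof -
    obtain s where s: "s \<in> {1..8}" "k \<in> set (S s)" using dof_covered[OF k] by blast
    have "(if k \<in> set (S s) then 1 else 0 :: real) \<le> \<mu> k"
      unfolding \<mu>_def using s by (intro member_le_sum) auto
    then show ?thesis using s by simp
  qed
  show "unity_weights ?\<delta>" unfolding unity_weights_def
  proof (intro conjI ballI allI impI)
    fix s k assume s: "s \<in> {1..8}" and k: "k \<in> set (S s)"
    have "k < n" using S_sub[OF s] k by blast
    then show "0 < ?\<delta> s k" using pos by simp
  next
    fix k assume k: "k < n"
    have "(\<Sum>s\<in>{1..8}. if k \<in> set (S s) then ?\<delta> s k else 0)
        = (\<Sum>s\<in>{1..8::nat}. inverse (\<mu> k) * (if k \<in> set (S s) then 1 else 0))"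
      by (intro sum.cong) auto
    also have "\<dots> = inverse (\<mu> k) * \<mu> k" by (simp only: sum_distrib_left \<mu>_def)
    also have "\<dots> = 1" using pos[OF k] by simp
    finally show "(\<Sum>s\<in>{1..8}. if k \<in> set (S s) then ?\<delta> s k else 0) = 1" .
  qed
  have RTR: "((restr s)\<^sup>T * restr s) $$ (k, l) = (if k = l \<and> k \<in> set (S s) then 1 else 0)"
    if s: "s \<in> {1..8}" and kl: "k < n" "l < n" for s k l
  proof -
    have "((restr s)\<^sup>T * restr s) $$ (k, l) = (\<Sum>i<sz s. if S s ! i = k then if k = l then 1 else 0 else 0)"
      using kl by (auto simp: restriction_def scalar_prod_def lessThan_atLeast0 intro!: sum.cong)
    also have "\<dots> = (\<Sum>i\<in>set (S s). if i = k then if k = l then 1 else 0 else 0)"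
      by (rule sum.reindex_bij_betw[OF S_bij[OF s]])
    finally show ?thesis by simp
  qed
  have "msum n n (\<lambda>t. (restr t)\<^sup>T * restr t) {1..8} = diagm n \<mu>"
    unfolding msum_def diagm_def
    by (intro eq_matI) (auto simp: RTR \<mu>_def simp del: index_mult_mat intro!: sum.cong)
  then have inv: "minv (msum n n (\<lambda>t. (restr t)\<^sup>T * restr t) {1..8}) = diagm n (\<lambda>k. inverse (\<mu> k))"
    using minv_diagm[of n \<mu>] pos by force
  fix s :: nat assume s: "s \<in> {1..8}"
  have nth: "S s ! i = S s ! j \<longleftrightarrow> i = j" if "i < sz s" "j < sz s" for i j
    using dofs s that by (simp add: nth_eq_iff_index_eq)
  show "multiplicity_scaling n restr s = diagm (sz s) (\<lambda>i. ?\<delta> s (S s ! i))"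
    unfolding multiplicity_scaling_def inv
  proof (rule eq_matI)
    fix i j assume "i < dim_row (diagm (sz s) (\<lambda>i. ?\<delta> s (S s ! i)))"
      "j < dim_col (diagm (sz s) (\<lambda>i. ?\<delta> s (S s ! i)))"
    then have ij: "i < sz s" "j < sz s" by (auto simp: diagm_def)
    show "(restr s * diagm n (\<lambda>k. inverse (\<mu> k)) * (restr s)\<^sup>T) $$ (i, j) = diagm (sz s) (\<lambda>i. ?\<delta> s (S s ! i)) $$ (i, j)"
      unfolding restr_conj_index[OF s diagm_carrier ij] using ij S_nth[OF s] nth by (simp add: diagm_def)
  qed (simp_all add: diagm_def restriction_def)
qed

end

section \<open>Stable splittings for the two coarse spaces\<close>

lemma bchoice2:
  assumes "\<forall>s\<in>I. \<exists>a b. Q s a b"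
  shows "\<exists>f g. \<forall>s\<in>I. Q s (f s) (g s)"
proof -
  from bchoice[OF assms] obtain f where "\<forall>s\<in>I. \<exists>b. Q s (f s) b" ..
  from bchoice[OF this] show ?thesis by (rule exI[of _ f])
qed

lemma bchoice3:
  assumes "\<forall>s\<in>I. \<exists>a b c. Q s a b c"
  shows "\<exists>f g h. \<forall>s\<in>I. Q s (f s) (g s) (h s)"
proof -
  from bchoice[OF assms] obtain f where "\<forall>s\<in>I. \<exists>b c. Q s (f s) b c" ..
  from bchoice2[OF this] show ?thesis by (rule exI[of _ f])
qed

lemma vsum_in_space_sum:
  assumes "finite I" "\<And>s. s \<in> I \<Longrightarrow> u s \<in> U s" "\<And>s. s \<in> I \<Longrightarrow> u s \<in> carrier_vec m"
  shows "vsum m u I \<in> space_sum m I U"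
proof -
  have "vsum m u I = finsum_vec TYPE(real) m u I"
    by (rule finsum_vec_eq_vsum[OF assms(1,3), symmetric])
  then show ?thesis unfolding space_sum_def using assms(2) by (intro CollectI exI conjI ballI)
qed

text \<open>The last conclusion, injectivity of the transpose, makes the coarse matrix positive
  definite.\<close>

lemma rows_form_basis:
  assumes "rows_form_basis n R0 V0" and k: "dim_row R0 = k"
  shows "R0 \<in> carrier_mat (k) n"
    "\<And>v. v \<in> V0 \<Longrightarrow> \<exists>z\<in>carrier_vec (k). v = R0\<^sup>T *\<^sub>v z"
    "\<And>z. z \<in> carrier_vec (k) \<Longrightarrow> R0\<^sup>T *\<^sub>v z = 0\<^sub>v n \<Longrightarrow> z = 0\<^sub>v (k)"
proof -
  note basis = assms(1)[unfolded rows_form_basis_def]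
  have dim: "dim_col R0 = n" and dist: "distinct (rows R0)"
    and ind: "vlin_indpt n (set (rows R0))" and span: "vspan n (set (rows R0)) = V0"
    by (rule basis[THEN conjunct1] basis[THEN conjunct2, THEN conjunct1]
        basis[THEN conjunct2, THEN conjunct2, THEN conjunct1]
        basis[THEN conjunct2, THEN conjunct2, THEN conjunct2])+
  show "R0 \<in> carrier_mat (k) n" by (rule carrier_matI[OF k dim])
  have R0T: "R0\<^sup>T \<in> carrier_mat n (k)"
    by (rule carrier_matI) (simp_all only: index_transpose_mat dim k)
  show "\<exists>z\<in>carrier_vec (k). v = R0\<^sup>T *\<^sub>v z" if "v \<in> V0" for v
  proof -
    have "v \<in> {R0\<^sup>T *\<^sub>v x | x. x \<in> carrier_vec (k)}"
      using that unfolding vspan_cols[OF R0T, symmetric] cols_transpose span .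
    then obtain x where "v = R0\<^sup>T *\<^sub>v x" "x \<in> carrier_vec (k)" by (elim CollectE exE conjE) (rule that)
    then show ?thesis by (intro bexI)
  qed
  interpret vec_space "TYPE(real)" n .
  show "z = 0\<^sub>v (k)" if "z \<in> carrier_vec (k)" "R0\<^sup>T *\<^sub>v z = 0\<^sub>v n" for z
  proof (rule ccontr)
    assume "z \<noteq> 0\<^sub>v (k)"
    from lin_depI[OF R0T that(1) this that(2), unfolded cols_transpose, OF dist] ind show False
      unfolding vlin_indpt_def by contradiction
  qed
qed

context elasticity_fe
begin

abbreviation "local_stiff s \<equiv> restr s * stiff * (restr s)\<^sup>T"

definition scaled_neumann :: "(nat \<Rightarrow> real mat) \<Rightarrow> nat \<Rightarrow> real mat" where
  "scaled_neumann D s = minv (D s) * neum s * minv (D s)"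

definition partition_scaling :: "(nat \<Rightarrow> real mat) \<Rightarrow> bool" where
  "partition_scaling D \<longleftrightarrow>
     (\<exists>\<delta>. unity_weights \<delta> \<and> (\<forall>s\<in>{1..8}. D s = diagm (sz s) (\<lambda>i. \<delta> s (S s ! i))))"

text \<open>The inverse scalings in the matrix cancel the \<open>D s\<close> in the vector, so the
  scaled local component carries exactly the unscaled Neumann energy.\<close>

lemma scaled_neumann:
  assumes D: "partition_scaling D" and s: "s \<in> {1..8}"
  shows "sym_psd (sz s) (scaled_neumann D s)" "D s \<in> carrier_mat (sz s) (sz s)"
    "v \<in> carrier_vec (sz s) \<Longrightarrow>
      bil (scaled_neumann D s) (D s *\<^sub>v v) (D s *\<^sub>v v) = bil (neum s) v v"
proof -
  obtain \<delta> where \<delta>: "unity_weights \<delta>" and Ds: "D s = diagm (sz s) (\<lambda>i. \<delta> s (S s ! i))"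
    using D s by (auto simp: partition_scaling_def)
  have pos: "\<delta> s (S s ! i) \<noteq> 0" if "i < sz s" for i
    using \<delta> s nth_mem[OF that] unfolding unity_weights_def by force
  let ?D = "diagm (sz s) (\<lambda>i. inverse (\<delta> s (S s ! i)))"
  have inv: "minv (D s) = ?D" unfolding Ds using pos by (rule minv_diagm)
  have "?D\<^sup>T = ?D" by (intro eq_matI) (auto simp: diagm_def)
  then have M: "scaled_neumann D s = ?D\<^sup>T * neum s * ?D" by (simp add: scaled_neumann_def inv)
  show "sym_psd (sz s) (scaled_neumann D s)" unfolding M by (rule sym_psd_conj[OF neum_psd[OF s] diagm_carrier])
  show Dc: "D s \<in> carrier_mat (sz s) (sz s)" by (simp add: Ds)
  assume v: "v \<in> carrier_vec (sz s)"
  then have Dv: "D s *\<^sub>v v \<in> carrier_vec (sz s)" using Dc by simp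
  have "?D *\<^sub>v (D s *\<^sub>v v) = v"
    using v pos unfolding Ds by (auto simp: diagm_mult_vec intro!: eq_vecI)
  then show "bil (scaled_neumann D s) (D s *\<^sub>v v) (D s *\<^sub>v v) = bil (neum s) v v"
    unfolding M bil_conj[OF neum(1) diagm_carrier Dv Dv] by simp
qed

text \<open>The resolution of the identity by the matrices \<open>(R s)\<^sup>T * D s * R s\<close>,
  tested against \<open>f\<close>: at each degree of freedom the weights add up to 1.\<close>

lemma partition_of_unity:
  assumes D: "partition_scaling D" and u: "u \<in> carrier_vec n" and f: "f \<in> carrier_vec n"
  shows "sp u f = (\<Sum>s\<in>{1..8}. sp (D s *\<^sub>v (restr s *\<^sub>v u)) (restr s *\<^sub>v f))"
proof -
  obtain \<delta> where \<delta>: "unity_weights \<delta>" and Ds: "\<And>s. s \<in> {1..8} \<Longrightarrow> D s = diagm (sz s) (\<lambda>i. \<delta> s (S s ! i))"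
    using D by (auto simp: partition_scaling_def)
  have "sp (D s *\<^sub>v (restr s *\<^sub>v u)) (restr s *\<^sub>v f)
      = (\<Sum>k<n. u $ k * f $ k * (if k \<in> set (S s) then \<delta> s k else 0))" if s: "s \<in> {1..8}" for s
  proof -
    have "sp (D s *\<^sub>v (restr s *\<^sub>v u)) (restr s *\<^sub>v f)
        = (\<Sum>i<sz s. \<delta> s (S s ! i) * u $ (S s ! i) * f $ (S s ! i))"
      unfolding Ds[OF s] restr_mult_vec[OF s u] restr_mult_vec[OF s f]
      by (simp add: diagm_mult_vec scalar_prod_def lessThan_atLeast0)
    also have "\<dots> = (\<Sum>k<n. if k \<in> set (S s) then \<delta> s k * u $ k * f $ k else 0)"
      by (rule sum_S[OF s])
    also have "\<dots> = (\<Sum>k<n. u $ k * f $ k * (if k \<in> set (S s) then \<delta> s k else 0))"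
      by (intro sum.cong) auto
    finally show ?thesis .
  qed
  then have "(\<Sum>s\<in>{1..8}. sp (D s *\<^sub>v (restr s *\<^sub>v u)) (restr s *\<^sub>v f))
      = (\<Sum>s\<in>{1..8}. \<Sum>k<n. u $ k * f $ k * (if k \<in> set (S s) then \<delta> s k else 0))"
    by (rule sum.cong[OF refl])
  also have "\<dots> = (\<Sum>k<n. \<Sum>s\<in>{1..8}. u $ k * f $ k * (if k \<in> set (S s) then \<delta> s k else 0))"
    by (rule sum.swap)
  also have "\<dots> = (\<Sum>k<n. u $ k * f $ k * (\<Sum>s\<in>{1..8}. if k \<in> set (S s) then \<delta> s k else 0))"
    by (simp only: sum_distrib_left)
  also have "\<dots> = (\<Sum>k<n. u $ k * f $ k)"
    using \<delta> by (intro sum.cong) (auto simp: unity_weights_def)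
  also have "\<dots> = sp u f" using f by (simp add: scalar_prod_def lessThan_atLeast0)
  finally show ?thesis by simp
qed

text \<open>Common to both coarse spaces: \<open>y0 s\<close> is the part of the local component
  sent to \<open>V0\<close>, and \<open>y1 s\<close> is what is left to the local solver. The local
  bounds add up to \<open>\<tau>\<close> times the full energy because the Neumann energies add up
  to it.\<close>

lemma stable_splitting:
  assumes D: "partition_scaling D" and R0: "rows_form_basis n R0 V0" "dim_row R0 = k" and u: "u \<in> carrier_vec n"
    and y: "\<And>s. s \<in> {1..8} \<Longrightarrow> y0 s \<in> carrier_vec (sz s) \<and> y1 s \<in> carrier_vec (sz s)
      \<and> D s *\<^sub>v (restr s *\<^sub>v u) = y0 s + y1 s
      \<and> bil (local_stiff s) (y1 s) (y1 s)
        \<le> \<tau> * bil (scaled_neumann D s) (D s *\<^sub>v (restr s *\<^sub>v u)) (D s *\<^sub>v (restr s *\<^sub>v u))"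
    and V0: "vsum n (\<lambda>s. (restr s)\<^sup>T *\<^sub>v y0 s) {1..8} \<in> V0"
  shows "\<exists>z y. z \<in> carrier_vec (k) \<and> (\<forall>s\<in>{1..8}. y s \<in> carrier_vec (sz s))
      \<and> (\<forall>f\<in>carrier_vec n. sp u f = sp z (R0 *\<^sub>v f) + (\<Sum>s\<in>{1..8}. sp (y s) (restr s *\<^sub>v f)))
      \<and> (\<Sum>s\<in>{1..8}. bil (local_stiff s) (y s) (y s)) \<le> \<tau> * bil stiff u u"
proof -
  obtain z where z: "z \<in> carrier_vec (k)"
    "vsum n (\<lambda>s. (restr s)\<^sup>T *\<^sub>v y0 s) {1..8} = R0\<^sup>T *\<^sub>v z"
    using rows_form_basis(2)[OF R0 V0] by blast
  note R0c = rows_form_basis(1)[OF R0]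
  have Rv: "restr s *\<^sub>v v \<in> carrier_vec (sz s)" if "v \<in> carrier_vec n" for s v using restr[of s] that by simp
  have RTv: "(restr s)\<^sup>T *\<^sub>v y0 s \<in> carrier_vec n" if "s \<in> {1..8}" for s using restr[of s] y[OF that] by simp
  have weak: "sp u f = sp z (R0 *\<^sub>v f) + (\<Sum>s\<in>{1..8}. sp (y1 s) (restr s *\<^sub>v f))" if f: "f \<in> carrier_vec n" for f
  proof -
    have "sp z (R0 *\<^sub>v f) = sp (vsum n (\<lambda>s. (restr s)\<^sup>T *\<^sub>v y0 s) {1..8}) f"
      unfolding z(2) using R0c z(1) f by (simp add: sp_mult_mat_left[of _ n k])
    also have "\<dots> = (\<Sum>s\<in>{1..8}. sp ((restr s)\<^sup>T *\<^sub>v y0 s) f)" by (rule sp_vsum_left[OF f RTv])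
    also have "\<dots> = (\<Sum>s\<in>{1..8}. sp (y0 s) (restr s *\<^sub>v f))"
    proof (rule sum.cong[OF refl])
      fix s :: nat assume "s \<in> {1..8}"
      then show "sp ((restr s)\<^sup>T *\<^sub>v y0 s) f = sp (y0 s) (restr s *\<^sub>v f)"
        using restr[of s] y f by (simp add: sp_mult_mat_left[of _ n "sz s"])
    qed
    finally have "sp z (R0 *\<^sub>v f) + (\<Sum>s\<in>{1..8}. sp (y1 s) (restr s *\<^sub>v f))
        = (\<Sum>s\<in>{1..8}. sp (y0 s) (restr s *\<^sub>v f) + sp (y1 s) (restr s *\<^sub>v f))"
      by (simp only: sum.distrib)
    also have "\<dots> = (\<Sum>s\<in>{1..8}. sp (D s *\<^sub>v (restr s *\<^sub>v u)) (restr s *\<^sub>v f))"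
    proof (rule sum.cong[OF refl])
      fix s :: nat assume "s \<in> {1..8}"
      from y[OF this] have y0: "y0 s \<in> carrier_vec (sz s)" and y1: "y1 s \<in> carrier_vec (sz s)"
        and e: "D s *\<^sub>v (restr s *\<^sub>v u) = y0 s + y1 s" by auto
      show "sp (y0 s) (restr s *\<^sub>v f) + sp (y1 s) (restr s *\<^sub>v f) = sp (D s *\<^sub>v (restr s *\<^sub>v u)) (restr s *\<^sub>v f)"
        unfolding e by (rule add_scalar_prod_distrib[OF y0 y1 Rv[OF f], symmetric])
    qed
    also have "\<dots> = sp u f" by (rule partition_of_unity[OF D u f, symmetric])
    finally show ?thesis by simp
  qed
  have bound: "(\<Sum>s\<in>{1..8}. bil (local_stiff s) (y1 s) (y1 s)) \<le> \<tau> * bil stiff u u"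
  proof -
    have "(\<Sum>s\<in>{1..8}. bil (local_stiff s) (y1 s) (y1 s)) \<le> (\<Sum>s\<in>{1..8}. \<tau> * bil (neum s) (restr s *\<^sub>v u) (restr s *\<^sub>v u))"
    proof (rule sum_mono)
      fix s :: nat assume s: "s \<in> {1..8}"
      show "bil (local_stiff s) (y1 s) (y1 s) \<le> \<tau> * bil (neum s) (restr s *\<^sub>v u) (restr s *\<^sub>v u)"
        using y[OF s] unfolding scaled_neumann(3)[OF D s Rv[OF u]] by blast
    qed
    also have "\<dots> = \<tau> * bil stiff u u" by (simp only: sum_distrib_left[symmetric] sum_neum[OF u])
    finally show ?thesis .
  qed
  show ?thesis using z(1) weak bound y by (intro exI[of _ z] exI[of _ y1] conjI ballI) auto
qed

lemma stable_coarse_L: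
  assumes D: "partition_scaling D" and R0: "rows_form_basis n R0 V0" "dim_row R0 = k" and \<tau>: "\<tau> > 1"
    and V0: "V0 = coarse_L n \<tau> stiff restr (scaled_neumann D)" and u: "u \<in> carrier_vec n"
  shows "\<exists>z y. z \<in> carrier_vec (k) \<and> (\<forall>s\<in>{1..8}. y s \<in> carrier_vec (sz s))
      \<and> (\<forall>f\<in>carrier_vec n. sp u f = sp z (R0 *\<^sub>v f) + (\<Sum>s\<in>{1..8}. sp (y s) (restr s *\<^sub>v f)))
      \<and> (\<Sum>s\<in>{1..8}. bil (local_stiff s) (y s) (y s)) \<le> \<tau> * bil stiff u u"
proof -
  let ?y = "\<lambda>s. D s *\<^sub>v (restr s *\<^sub>v u)"
  have yc: "?y s \<in> carrier_vec (sz s)" if "s \<in> {1..8}" for s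
    using scaled_neumann(2)[OF D that] restr[of s] u by simp
  have "\<forall>s\<in>{1..8}. \<exists>y0 y1. y0 \<in> Y_L (inverse \<tau>) (scaled_neumann D s) (local_stiff s)
      \<and> y0 \<in> carrier_vec (sz s) \<and> y1 \<in> carrier_vec (sz s) \<and> ?y s = y0 + y1
      \<and> bil (local_stiff s) y1 y1 \<le> \<tau> * bil (scaled_neumann D s) (?y s) (?y s)"
    using \<tau> by (intro ballI split_low[OF scaled_neumann(1)[OF D] local_pd _ yc]) auto
  from bchoice2[OF this] obtain y0 y1 where y: "\<forall>s\<in>{1..8}. y0 s \<in> Y_L (inverse \<tau>) (scaled_neumann D s) (local_stiff s)
      \<and> y0 s \<in> carrier_vec (sz s) \<and> y1 s \<in> carrier_vec (sz s) \<and> ?y s = y0 s + y1 s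
      \<and> bil (local_stiff s) (y1 s) (y1 s) \<le> \<tau> * bil (scaled_neumann D s) (?y s) (?y s)"
    by (elim exE) (rule that)
  have "vsum n (\<lambda>s. (restr s)\<^sup>T *\<^sub>v y0 s) {1..8} \<in> V0"
    unfolding V0 coarse_L_def
  proof (rule vsum_in_space_sum)
    fix s :: nat assume s: "s \<in> {1..8}"
    show "(restr s)\<^sup>T *\<^sub>v y0 s \<in> (\<lambda>y. (restr s)\<^sup>T *\<^sub>v y) ` Y_L (inverse \<tau>) (scaled_neumann D s) (local_stiff s)"
      using bspec[OF y s] by (elim conjE) (rule imageI)
    have "y0 s \<in> carrier_vec (sz s)" using bspec[OF y s] by (elim conjE)
    then show "(restr s)\<^sup>T *\<^sub>v y0 s \<in> carrier_vec n" using restr[of s] by simp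
  qed simp
  then show ?thesis
  proof (rule stable_splitting[OF D R0 u, rotated])
    fix s :: nat assume s: "s \<in> {1..8}"
    show "y0 s \<in> carrier_vec (sz s) \<and> y1 s \<in> carrier_vec (sz s) \<and> ?y s = y0 s + y1 s
        \<and> bil (local_stiff s) (y1 s) (y1 s) \<le> \<tau> * bil (scaled_neumann D s) (?y s) (?y s)"
      using bspec[OF y s] by (elim conjE) (intro conjI)
  qed
qed

lemma stable_coarse_H:
  assumes D: "partition_scaling D" and R0: "rows_form_basis n R0 V0" "dim_row R0 = k" and \<tau>: "\<tau> > 1"
    and W: "\<forall>s\<in>{1..8}. orthonormal_range_basis (W s) (scaled_neumann D s)"
    and V0: "V0 = coarse_H n \<tau> stiff restr (scaled_neumann D) W" and u: "u \<in> carrier_vec n"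
  shows "\<exists>z y. z \<in> carrier_vec (k) \<and> (\<forall>s\<in>{1..8}. y s \<in> carrier_vec (sz s))
      \<and> (\<forall>f\<in>carrier_vec n. sp u f = sp z (R0 *\<^sub>v f) + (\<Sum>s\<in>{1..8}. sp (y s) (restr s *\<^sub>v f)))
      \<and> (\<Sum>s\<in>{1..8}. bil (local_stiff s) (y s) (y s)) \<le> \<tau> * bil stiff u u"
proof -
  let ?y = "\<lambda>s. D s *\<^sub>v (restr s *\<^sub>v u)"
  let ?Y = "\<lambda>s. Y_H \<tau> ((W s)\<^sup>T * local_stiff s * W s) ((W s)\<^sup>T * scaled_neumann D s * W s)"
  have yc: "?y s \<in> carrier_vec (sz s)" if "s \<in> {1..8}" for s
    using scaled_neumann(2)[OF D that] restr[of s] u by simp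
  have "\<forall>s\<in>{1..8}. \<exists>c w y1. c \<in> mat_kernel (scaled_neumann D s) \<and> c \<in> carrier_vec (sz s)
      \<and> w \<in> ?Y s \<and> W s *\<^sub>v w \<in> carrier_vec (sz s) \<and> y1 \<in> carrier_vec (sz s)
      \<and> ?y s = c + W s *\<^sub>v w + y1
      \<and> bil (local_stiff s) y1 y1 \<le> \<tau> * bil (scaled_neumann D s) (?y s) (?y s)"
    using \<tau> by (intro ballI split_high[OF scaled_neumann(1)[OF D] local_pd _ yc bspec[OF W]]) auto
  from bchoice3[OF this] obtain c w y1 where y: "\<forall>s\<in>{1..8}. c s \<in> mat_kernel (scaled_neumann D s)
      \<and> c s \<in> carrier_vec (sz s)
      \<and> w s \<in> ?Y s \<and> W s *\<^sub>v w s \<in> carrier_vec (sz s) \<and> y1 s \<in> carrier_vec (sz s)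
      \<and> ?y s = c s + W s *\<^sub>v w s + y1 s
      \<and> bil (local_stiff s) (y1 s) (y1 s) \<le> \<tau> * bil (scaled_neumann D s) (?y s) (?y s)"
    by (elim exE) (rule that)
  let ?a = "vsum n (\<lambda>s. (restr s)\<^sup>T *\<^sub>v c s) {1..8}" and ?b = "vsum n (\<lambda>s. (restr s)\<^sup>T *\<^sub>v (W s *\<^sub>v w s)) {1..8}"
  have cc: "(restr s)\<^sup>T *\<^sub>v c s \<in> carrier_vec n" and wc: "(restr s)\<^sup>T *\<^sub>v (W s *\<^sub>v w s) \<in> carrier_vec n"
    and add: "(restr s)\<^sup>T *\<^sub>v (c s + W s *\<^sub>v w s) = (restr s)\<^sup>T *\<^sub>v c s + (restr s)\<^sup>T *\<^sub>v (W s *\<^sub>v w s)"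
    if "s \<in> {1..8}" for s
  proof -
    have "c s \<in> carrier_vec (sz s)" using bspec[OF y that] by (elim conjE)
    moreover have "W s *\<^sub>v w s \<in> carrier_vec (sz s)" using bspec[OF y that] by (elim conjE)
    ultimately show "(restr s)\<^sup>T *\<^sub>v c s \<in> carrier_vec n" "(restr s)\<^sup>T *\<^sub>v (W s *\<^sub>v w s) \<in> carrier_vec n"
      "(restr s)\<^sup>T *\<^sub>v (c s + W s *\<^sub>v w s) = (restr s)\<^sup>T *\<^sub>v c s + (restr s)\<^sup>T *\<^sub>v (W s *\<^sub>v w s)"
      using restr[of s] by (simp_all add: mult_add_distrib_mat_vec[of "(restr s)\<^sup>T" n "sz s"])
  qed
  \<comment> \<open>The coarse space is a sum of two separately assembled spaces, so the kernel
    parts and the eigenvector parts have to be collected apart.\<close>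
  have sum: "vsum n (\<lambda>s. (restr s)\<^sup>T *\<^sub>v (c s + W s *\<^sub>v w s)) {1..8} = ?a + ?b"
  proof (rule eq_vecI)
    fix i assume "i < dim_vec (?a + ?b)"
    then have i: "i < n" by (simp add: vsum_def)
    have "((restr s)\<^sup>T *\<^sub>v (c s + W s *\<^sub>v w s)) $ i = ((restr s)\<^sup>T *\<^sub>v c s) $ i + ((restr s)\<^sup>T *\<^sub>v (W s *\<^sub>v w s)) $ i"
      if "s \<in> {1..8}" for s
      unfolding add[OF that] by (rule index_add_vec(1)) (simp only: carrier_vecD[OF wc[OF that]] i)
    then show "vsum n (\<lambda>s. (restr s)\<^sup>T *\<^sub>v (c s + W s *\<^sub>v w s)) {1..8} $ i = (?a + ?b) $ i"
      using i by (simp add: vsum_def sum.distrib del: index_mult_mat_vec)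
  qed (simp add: vsum_def)
  have "?a \<in> space_sum n {1..8} (\<lambda>s. (\<lambda>y. (restr s)\<^sup>T *\<^sub>v y) ` mat_kernel (scaled_neumann D s))"
  proof (rule vsum_in_space_sum)
    fix s :: nat assume s: "s \<in> {1..8}"
    show "(restr s)\<^sup>T *\<^sub>v c s \<in> (\<lambda>y. (restr s)\<^sup>T *\<^sub>v y) ` mat_kernel (scaled_neumann D s)"
      using bspec[OF y s] by (elim conjE) (rule imageI)
  qed (simp_all add: cc)
  moreover have "?b \<in> space_sum n {1..8} (\<lambda>s. (\<lambda>y. (restr s)\<^sup>T *\<^sub>v (W s *\<^sub>v y)) ` ?Y s)"
  proof (rule vsum_in_space_sum)
    fix s :: nat assume s: "s \<in> {1..8}"
    show "(restr s)\<^sup>T *\<^sub>v (W s *\<^sub>v w s) \<in> (\<lambda>y. (restr s)\<^sup>T *\<^sub>v (W s *\<^sub>v y)) ` ?Y s"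
      using bspec[OF y s] by (elim conjE) (rule imageI)
  qed (simp_all add: wc)
  ultimately have "vsum n (\<lambda>s. (restr s)\<^sup>T *\<^sub>v (c s + W s *\<^sub>v w s)) {1..8} \<in> V0"
    unfolding V0 coarse_H_def sum by (intro CollectI exI conjI) (rule refl)
  then show ?thesis
  proof (rule stable_splitting[OF D R0 u, rotated])
    fix s :: nat assume s: "s \<in> {1..8}"
    show "c s + W s *\<^sub>v w s \<in> carrier_vec (sz s) \<and> y1 s \<in> carrier_vec (sz s)
        \<and> ?y s = c s + W s *\<^sub>v w s + y1 s
        \<and> bil (local_stiff s) (y1 s) (y1 s) \<le> \<tau> * bil (scaled_neumann D s) (?y s) (?y s)"
      using bspec[OF y s] by (elim conjE) (intro conjI add_carrier_vec)
  qed
qed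

end

theorem theorem20:
  fixes d :: bool and n Nc :: nat and \<tau> :: real
    and dof :: "nat \<Rightarrow> (real^2) \<times> 2"
    and \<phi> :: "nat \<Rightarrow> real^2 \<Rightarrow> real^2"
    and \<T> :: "nat \<Rightarrow> (real^2) set set"
    and E :: "real^2 \<Rightarrow> real"
    and S :: "nat \<Rightarrow> nat list"
    and A R0 P0 H :: "real mat"
    and R AN D M :: "nat \<Rightarrow> real mat"
    and V0 :: "real Matrix.vec set"
  assumes basis: "nodal_basis d n dof \<phi>"
    and decomp: "decomposition d \<T>"
    and young: "E = young_checker \<T> \<or> E = young_layers \<T>"
    and dofs: "\<forall>s\<in>{1..8}. distinct (S s) \<and> set (S s) = {k. k < n \<and> fst (dof k) \<in> subdomain \<T> s}"
    and A: "A = stiffness E n \<phi>"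
    and R: "R = (\<lambda>s. restriction n (S s))"
    and AN: "AN = (\<lambda>s. neumann E (subdomain \<T> s) \<phi> (S s))"
    and D: "D = multiplicity_scaling n R \<or> D = k_scaling A R AN"
    and M: "M = (\<lambda>s. minv (D s) * AN s * minv (D s))"
    and H: "H = additive_schwarz n A R"
    and Nc: "coloring A R Nc"
    and tau: "\<tau> > 1"
    and V0: "V0 = coarse_L n \<tau> A R M
           \<or> (\<exists>W. (\<forall>s\<in>{1..8}. orthonormal_range_basis (W s) (M s))
                  \<and> V0 = coarse_H n \<tau> A R M W)"
    and R0: "rows_form_basis n R0 V0"
    and P0: "P0 = coarse_proj n A R0"
  shows "(\<forall>l. cplx_eigenvalue (H * A) l \<longrightarrow>
            l \<in> \<real> \<and> Re l \<le> real Nc)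
       \<and> (\<forall>l. cplx_eigenvalue (H * A * P0) l \<and> l \<noteq> 0 \<longrightarrow>
            l \<in> \<real> \<and> 1 / \<tau> \<le> Re l \<and> Re l \<le> real Nc)
       \<and> (\<forall>l. cplx_eigenvalue (H_hyb H P0 A R0 * A) l \<longrightarrow>
            l \<in> \<real> \<and> 1 / \<tau> \<le> Re l \<and> Re l \<le> real Nc)
       \<and> (\<forall>l. cplx_eigenvalue (H_ad H A R0 * A) l \<longrightarrow>
            l \<in> \<real> \<and> 1 / ((1 + 2 * real Nc) * \<tau>) \<le> Re l \<and> Re l \<le> real Nc + 1)"
proof -
  interpret elasticity_fe d n dof \<phi> \<T> E S
    using basis decomp young dofs by unfold_locales
  have scaling: "partition_scaling D"
    using D
  proof
    assume "D = multiplicity_scaling n R"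
    then show ?thesis unfolding R partition_scaling_def by (simp only: multiplicity_scaling_diag)
  next
    assume "D = k_scaling A R AN"
    then show ?thesis unfolding A R AN partition_scaling_def by (simp only: k_scaling_diag)
  qed
  have M': "M = scaled_neumann D" unfolding M AN scaled_neumann_def by (rule refl)
  obtain k where k: "dim_row R0 = k" by simp
  note basis_k = R0 k
  have stable: "\<exists>z y. z \<in> carrier_vec (k) \<and> (\<forall>s\<in>{1..8}. y s \<in> carrier_vec (length (S s)))
      \<and> (\<forall>f\<in>carrier_vec n. sp u f = sp z (R0 *\<^sub>v f) + (\<Sum>s\<in>{1..8}. sp (y s) (R s *\<^sub>v f)))
      \<and> (\<Sum>s\<in>{1..8}. bil (R s * A * (R s)\<^sup>T) (y s) (y s)) \<le> \<tau> * bil A u u"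
    if u: "u \<in> carrier_vec n" for u
    using V0[unfolded A R M']
  proof (elim disjE exE conjE)
    assume "V0 = coarse_L n \<tau> stiff restr (scaled_neumann D)"
    from stable_coarse_L[OF scaling basis_k tau this u] show ?thesis unfolding A R .
  next
    fix W assume "\<forall>s\<in>{1..8}. orthonormal_range_basis (W s) (scaled_neumann D s)"
      "V0 = coarse_H n \<tau> stiff restr (scaled_neumann D) W"
    from stable_coarse_H[OF scaling basis_k tau this u] show ?thesis unfolding A R .
  qed
  \<comment> \<open>An empty family of colours cannot cover the eight subdomains.\<close>
  have Nc1: "Nc \<ge> 1"
  proof (rule ccontr)
    assume "\<not> Nc \<ge> 1"
    then have "{1..Nc} = {}" by simp
    moreover obtain C :: "nat \<Rightarrow> nat set" where "(\<Union>j\<in>{1..Nc}. C j) = {1..8}"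
      using Nc unfolding coloring_def by (elim exE conjE) (rule that)
    ultimately show False by simp
  qed
  interpret two_level n k A R0 "{1..8}" "\<lambda>s. length (S s)" R \<tau> Nc H
  proof
    show "sym_pd n A" unfolding A by (rule stiff_pd)
    show "R s \<in> carrier_mat (length (S s)) n" for s unfolding R by (rule restr)
    show "sym_pd (length (S s)) (R s * A * (R s)\<^sup>T)" if "s \<in> {1..8}" for s
      unfolding A R using that by (rule local_pd)
    show R0c: "R0 \<in> carrier_mat (k) n" by (rule rows_form_basis(1)[OF basis_k])
    \<comment> \<open>The double transpose fits the congruence lemma with
      \<open>B = R0\<^sup>T\<close>.\<close>
    have "sym_pd (k) (R0\<^sup>T\<^sup>T * A * R0\<^sup>T)"
      unfolding A using R0c rows_form_basis(3)[OF basis_k] by (intro sym_pd_conj[OF stiff_pd]) auto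
    then show "sym_pd (k) (R0 * A * R0\<^sup>T)" by simp
    show "H = msum n n (\<lambda>s. (R s)\<^sup>T * minv (R s * A * (R s)\<^sup>T) * R s) {1..8}"
      unfolding H additive_schwarz_def ..
  qed (use Nc Nc1 tau stable in \<open>simp_all add: coloring_def\<close>)
  show ?thesis
    unfolding P0
    by (intro conjI allI impI; (elim conjE)?)
      (erule eigenvalue_H | (erule eigenvalue_HP, assumption) | erule eigenvalue_hyb | erule eigenvalue_ad)+
qed

end
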